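(* Let $M$ be a noetherian gcd-monoid satisfying the $3$-Ore condition, let $U(M)$ be its enveloping group and $\iota : M \to U(M)$ the canonical morphism. (i) The morphism $\iota$ is injective (that is, $M$ embeds in $U(M)$), and every element $g$ of $U(M)$ admits a unique representation $$g = \iota(a_1)\,\iota(a_2)^{-1}\,\iota(a_3)\,\iota(a_4)^{-1}\cdots \iota(a_n)^{\pm 1}$$ where $n \ge 0$ ($n=0$ giving the empty product), $a_1,\dots,a_n \in M$, and - $a_n \neq 1$ (if $n\ge 1$); - the right gcd of $a_1$ and $a_2$ is $1$ (if $n \ge 2$); - for every even $i$ with $2\le i<n$: if $x \ne 1$ left divides $a_{i+1}$, then $x$ and $a_i$ have no common right multiple; - for every odd $i$ with $3\le i<n$: if $x\neq 1$ right divides $a_{i+1}$, then $x$ and $a_i$ have no common left multiple. (ii) If, moreover, $M$ admits a presentation by length-preserving relations and contains finitely many basic elements, then the word problem for $U(M)$ is decidable.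
   Context: For $a,b$ in a monoid $M$: $a$ left divides $b$ (and $b$ is a right multiple of $a$) if $b=ax$ for some $x\in M$; $a$ right divides $b$ (and $b$ is a left multiple of $a$) if $b=xa$ for some $x \in M$. A gcd-monoid is a cancellative monoid with no nontrivial invertible element in which any two elements admit a left gcd (greatest lower bound for left divisibility) and a right gcd (greatest lower bound for right divisibility). In a gcd-monoid, two elements with a common right multiple have a unique right lcm $a\vee b$ (least upper bound for left divisibility), and symmetrically for left lcms. $M$ is noetherian if both the proper left divisibility relation ($b=ax$ with $x$ not invertible) and the proper right divisibility relation are well-founded. $3$-Ore condition: any three elements of $M$ that pairwise admit a common right multiple admit a global common right multiple, and any three elements of $M$ that pairwise admit a common left multiple admit a global common left multiple. The enveloping group $U(M)$, with $\iota : M\to U(M)$, is the universal group of $M$: every morphism from $M$ to a group factors through $\iota$. If $M$ has monoid presentation $\langle S\mid R\rangle^+$, then $U(M)$ has group presentation $\langle S \mid R\rangle$. A length-preserving relation is a relation $u=v$ between words $u,v$ of the same length. An atom of $M$ is a non-invertible element that is not a product of two non-invertible elements. An element of $M$ is right basic if it lies in the smallest subset of $M$ containing the atoms and closed under the operation sending $(a,b)$ such that $a\vee b$ exists to the element $a'$ with $a\vee b=ba'$; left basic elements are defined symmetrically using left lcms; an element is basic if it is right basic or left basic. The word problem is taken with respect to the (finite) generating set of $U(M)$ given by the atoms of $M$. *)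

theory Defs
  imports "HOL-Algebra.Divisibility" "HOL-Algebra.Generated_Groups" "HOL-Library.Nat_Bijection"
begin

section \<open>Divisibility in a noncommutative monoid\<close>

text \<open>
  \<^const>\<open>factor\<close> (infix \<open>divides\<close>) is left divisibility: \<open>b = a \<otimes> c\<close>. So
  \<^const>\<open>isgcd\<close> and \<^const>\<open>islcm\<close>, used in a noncommutative monoid, are the left gcd and
  the right lcm. Their mirror images are the following.
\<close>

definition right_divides :: "('a, 'm) monoid_scheme \<Rightarrow> 'a \<Rightarrow> 'a \<Rightarrow> bool" where
  "right_divides M a b \<longleftrightarrow> (\<exists>x\<in>carrier M. b = x \<otimes>\<^bsub>M\<^esub> a)"

definition is_right_gcd :: "('a, 'm) monoid_scheme \<Rightarrow> 'a \<Rightarrow> 'a \<Rightarrow> 'a \<Rightarrow> bool" where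
  "is_right_gcd M d a b \<longleftrightarrow> right_divides M d a \<and> right_divides M d b \<and>
     (\<forall>y\<in>carrier M. right_divides M y a \<and> right_divides M y b \<longrightarrow> right_divides M y d)"

definition is_left_lcm :: "('a, 'm) monoid_scheme \<Rightarrow> 'a \<Rightarrow> 'a \<Rightarrow> 'a \<Rightarrow> bool" where
  "is_left_lcm M c a b \<longleftrightarrow> right_divides M a c \<and> right_divides M b c \<and>
     (\<forall>y\<in>carrier M. right_divides M a y \<and> right_divides M b y \<longrightarrow> right_divides M c y)"

definition common_right_multiple :: "('a, 'm) monoid_scheme \<Rightarrow> 'a set \<Rightarrow> bool" where
  "common_right_multiple M A \<longleftrightarrow> (\<exists>c\<in>carrier M. \<forall>a\<in>A. a divides\<^bsub>M\<^esub> c)"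

definition common_left_multiple :: "('a, 'm) monoid_scheme \<Rightarrow> 'a set \<Rightarrow> bool" where
  "common_left_multiple M A \<longleftrightarrow> (\<exists>c\<in>carrier M. \<forall>a\<in>A. right_divides M a c)"

locale gcd_monoid = monoid_cancel +
  assumes Units_trivial: "Units G = {\<one>}"
    and left_gcd_exists:
      "\<lbrakk>a \<in> carrier G; b \<in> carrier G\<rbrakk> \<Longrightarrow> \<exists>d\<in>carrier G. d gcdof a b"
    and right_gcd_exists:
      "\<lbrakk>a \<in> carrier G; b \<in> carrier G\<rbrakk> \<Longrightarrow> \<exists>d\<in>carrier G. is_right_gcd G d a b"

definition noetherian :: "('a, 'm) monoid_scheme \<Rightarrow> bool" where
  "noetherian M \<longleftrightarrow>
     wf {(a, b). a \<in> carrier M \<and> b \<in> carrier M \<and>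
                 (\<exists>x\<in>carrier M. x \<notin> Units M \<and> b = a \<otimes>\<^bsub>M\<^esub> x)} \<and>
     wf {(a, b). a \<in> carrier M \<and> b \<in> carrier M \<and>
                 (\<exists>x\<in>carrier M. x \<notin> Units M \<and> b = x \<otimes>\<^bsub>M\<^esub> a)}"

definition three_Ore :: "('a, 'm) monoid_scheme \<Rightarrow> bool" where
  "three_Ore M \<longleftrightarrow>
     (\<forall>a\<in>carrier M. \<forall>b\<in>carrier M. \<forall>c\<in>carrier M.
        (common_right_multiple M {a, b} \<and> common_right_multiple M {b, c} \<and>
         common_right_multiple M {a, c} \<longrightarrow> common_right_multiple M {a, b, c}) \<and>
        (common_left_multiple M {a, b} \<and> common_left_multiple M {b, c} \<and>
         common_left_multiple M {a, c} \<longrightarrow> common_left_multiple M {a, b, c}))"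

definition atoms :: "('a, 'm) monoid_scheme \<Rightarrow> 'a set" where
  "atoms M = {a \<in> carrier M. a \<notin> Units M \<and>
     (\<forall>x\<in>carrier M. \<forall>y\<in>carrier M. a = x \<otimes>\<^bsub>M\<^esub> y \<longrightarrow> x \<in> Units M \<or> y \<in> Units M)}"

inductive_set right_basic :: "('a, 'm) monoid_scheme \<Rightarrow> 'a set"
  for M :: "('a, 'm) monoid_scheme" where
  atom: "a \<in> atoms M \<Longrightarrow> a \<in> right_basic M"
| residue: "\<lbrakk>a \<in> right_basic M; b \<in> right_basic M; c \<in> carrier M; c lcmof\<^bsub>M\<^esub> a b;
     a' \<in> carrier M; c = b \<otimes>\<^bsub>M\<^esub> a'\<rbrakk> \<Longrightarrow> a' \<in> right_basic M"

inductive_set left_basic :: "('a, 'm) monoid_scheme \<Rightarrow> 'a set"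
  for M :: "('a, 'm) monoid_scheme" where
  atom: "a \<in> atoms M \<Longrightarrow> a \<in> left_basic M"
| residue: "\<lbrakk>a \<in> left_basic M; b \<in> left_basic M; c \<in> carrier M; is_left_lcm M c a b;
     a' \<in> carrier M; c = a' \<otimes>\<^bsub>M\<^esub> b\<rbrakk> \<Longrightarrow> a' \<in> left_basic M"

definition basic_elements :: "('a, 'm) monoid_scheme \<Rightarrow> 'a set" where
  "basic_elements M = right_basic M \<union> left_basic M"

section \<open>Monoid presentations\<close>

inductive_set word_cong :: "'b set \<Rightarrow> ('b list \<times> 'b list) set \<Rightarrow> ('b list \<times> 'b list) set"
  for S :: "'b set" and R :: "('b list \<times> 'b list) set" where
  base: "\<lbrakk>(u, v) \<in> R; u \<in> lists S; v \<in> lists S\<rbrakk> \<Longrightarrow> (u, v) \<in> word_cong S R"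
| refl: "u \<in> lists S \<Longrightarrow> (u, u) \<in> word_cong S R"
| sym: "(u, v) \<in> word_cong S R \<Longrightarrow> (v, u) \<in> word_cong S R"
| trans: "\<lbrakk>(u, v) \<in> word_cong S R; (v, w) \<in> word_cong S R\<rbrakk> \<Longrightarrow> (u, w) \<in> word_cong S R"
| ctxt: "\<lbrakk>(u, v) \<in> word_cong S R; x \<in> lists S; y \<in> lists S\<rbrakk>
    \<Longrightarrow> (x @ u @ y, x @ v @ y) \<in> word_cong S R"

definition presented_monoid :: "'b set \<Rightarrow> ('b list \<times> 'b list) set \<Rightarrow> 'b list set monoid" where
  "presented_monoid S R =
     \<lparr>carrier = lists S // word_cong S R,
      mult = (\<lambda>A B. \<Union>u\<in>A. \<Union>v\<in>B. word_cong S R `` {u @ v}),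
      one = word_cong S R `` {[]}\<rparr>"

definition length_preserving :: "('b list \<times> 'b list) set \<Rightarrow> bool" where
  "length_preserving R \<longleftrightarrow> (\<forall>(u, v)\<in>R. length u = length v)"

section \<open>The enveloping group\<close>

text \<open>
  Words over \<open>carrier M \<times> bool\<close>: the letter \<open>(a, True)\<close> stands for \<open>a\<close> and \<open>(a, False)\<close>
  for its formal inverse. The relations are the multiplication table of \<open>M\<close> together with
  the relations making each \<open>(a, False)\<close> inverse to \<open>(a, True)\<close>.
\<close>

definition envelope_rels ::
    "('a, 'm) monoid_scheme \<Rightarrow> (('a \<times> bool) list \<times> ('a \<times> bool) list) set" where
  "envelope_rels M =
     {([(\<one>\<^bsub>M\<^esub>, True)], [])} \<union>
     {([(a, True), (b, True)], [(a \<otimes>\<^bsub>M\<^esub> b, True)]) |a b. a \<in> carrier M \<and> b \<in> carrier M} \<union>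
     {([(a, s), (a, \<not> s)], []) |a s. a \<in> carrier M}"

definition envelope :: "('a, 'm) monoid_scheme \<Rightarrow> ('a \<times> bool) list set monoid" where
  "envelope M = presented_monoid (carrier M \<times> UNIV) (envelope_rels M)"

definition envelope_map :: "('a, 'm) monoid_scheme \<Rightarrow> 'a \<Rightarrow> ('a \<times> bool) list set" where
  "envelope_map M a = word_cong (carrier M \<times> UNIV) (envelope_rels M) `` {[(a, True)]}"

lemma word_cong_in_lists:
  assumes "(u, v) \<in> word_cong S R"
  shows "u \<in> lists S \<and> v \<in> lists S"
  using assms by induction auto

lemma equiv_word_cong: "equiv (lists S) (word_cong S R)"
proof (rule equivI)
  show "word_cong S R \<subseteq> lists S \<times> lists S"
    using word_cong_in_lists by fast
  show "refl_on (lists S) (word_cong S R)"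
    by (rule refl_onI) (rule word_cong.refl)
  show "sym (word_cong S R)"
    by (rule symI) (rule word_cong.sym)
  show "trans (word_cong S R)"
    by (rule transI) (rule word_cong.trans)
qed

lemma word_cong_append:
  assumes "(u, u') \<in> word_cong S R" "(v, v') \<in> word_cong S R"
  shows "(u @ v, u' @ v') \<in> word_cong S R"
proof -
  have "(u @ v, u' @ v) \<in> word_cong S R"
    using word_cong.ctxt[OF assms(1), of "[]" v] word_cong_in_lists[OF assms(2)] by simp
  moreover have "(u' @ v, u' @ v') \<in> word_cong S R"
    using word_cong.ctxt[OF assms(2), of u' "[]"] word_cong_in_lists[OF assms(1)] by simp
  ultimately show ?thesis by (rule word_cong.trans)
qed

lemma presented_monoid_mult:
  assumes "u \<in> lists S" "v \<in> lists S"
  shows "(word_cong S R `` {u}) \<otimes>\<^bsub>presented_monoid S R\<^esub> (word_cong S R `` {v})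
    = word_cong S R `` {u @ v}"
proof -
  have "congruent2 (word_cong S R) (word_cong S R) (\<lambda>u v. word_cong S R `` {u @ v})"
    by (rule congruent2I'[of "word_cong S R" "word_cong S R"])
      (simp add: equiv_class_eq[OF equiv_word_cong] word_cong_append)
  from UN_equiv_class2[OF equiv_word_cong equiv_word_cong this assms]
  show ?thesis by (simp add: presented_monoid_def)
qed

lemma presented_monoid_carrierE:
  assumes "X \<in> carrier (presented_monoid S R)"
  obtains u where "u \<in> lists S" "X = word_cong S R `` {u}"
proof -
  from assms have "X \<in> lists S // word_cong S R" by (simp add: presented_monoid_def)
  then show thesis by (rule quotientE) (rule that)
qed

lemma presented_monoid_carrierI:
  "u \<in> lists S \<Longrightarrow> word_cong S R `` {u} \<in> carrier (presented_monoid S R)"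
  by (simp add: presented_monoid_def quotientI)

lemma presented_monoid_one: "\<one>\<^bsub>presented_monoid S R\<^esub> = word_cong S R `` {[]}"
  by (simp add: presented_monoid_def)

lemma monoid_presented_monoid: "monoid (presented_monoid S R)" (is "monoid ?P")
proof (rule monoidI)
  show "\<one>\<^bsub>?P\<^esub> \<in> carrier ?P"
    unfolding presented_monoid_one by (rule presented_monoid_carrierI) simp
next
  fix X Y assume "X \<in> carrier ?P" "Y \<in> carrier ?P"
  then obtain u v where uv: "u \<in> lists S" "v \<in> lists S"
    and XY: "X = word_cong S R `` {u}" "Y = word_cong S R `` {v}"
    by (metis presented_monoid_carrierE)
  show "X \<otimes>\<^bsub>?P\<^esub> Y \<in> carrier ?P"
    unfolding XY presented_monoid_mult[OF uv] by (rule presented_monoid_carrierI) (use uv in simp)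
next
  fix X Y Z assume "X \<in> carrier ?P" "Y \<in> carrier ?P" "Z \<in> carrier ?P"
  then obtain u v w where uvw: "u \<in> lists S" "v \<in> lists S" "w \<in> lists S"
    and XYZ: "X = word_cong S R `` {u}" "Y = word_cong S R `` {v}" "Z = word_cong S R `` {w}"
    by (metis presented_monoid_carrierE)
  have "u @ v \<in> lists S" "v @ w \<in> lists S" using uvw by simp_all
  then show "X \<otimes>\<^bsub>?P\<^esub> Y \<otimes>\<^bsub>?P\<^esub> Z = X \<otimes>\<^bsub>?P\<^esub> (Y \<otimes>\<^bsub>?P\<^esub> Z)"
    unfolding XYZ by (simp only: presented_monoid_mult uvw append_assoc)
next
  fix X assume "X \<in> carrier ?P"
  then obtain u where u: "u \<in> lists S" and X: "X = word_cong S R `` {u}"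
    by (rule presented_monoid_carrierE)
  show "\<one>\<^bsub>?P\<^esub> \<otimes>\<^bsub>?P\<^esub> X = X" "X \<otimes>\<^bsub>?P\<^esub> \<one>\<^bsub>?P\<^esub> = X"
    unfolding X presented_monoid_one
    by (simp_all only: presented_monoid_mult u lists.Nil append_Nil append_Nil2)
qed

lemma envelope_inverse:
  assumes "u \<in> lists (carrier M \<times> UNIV)"
  shows "(map (\<lambda>(a, s). (a, \<not> s)) (rev u) @ u, [])
    \<in> word_cong (carrier M \<times> UNIV) (envelope_rels M)" (is "(?inv u @ u, []) \<in> ?C")
  using assms
proof (induction u)
  case Nil
  then show ?case by (simp add: word_cong.refl)
next
  case (Cons l u)
  obtain a s where l: "l = (a, s)" by (cases l)
  have a: "a \<in> carrier M" using Cons.hyps l by auto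
  have inv: "?inv u \<in> lists (carrier M \<times> UNIV)"
    using Cons.hyps by (force simp: in_lists_conv_set)
  have "([(a, \<not> s), (a, s)], []) \<in> ?C"
    using a by (intro word_cong.base) (force simp: envelope_rels_def)+
  from word_cong.ctxt[OF this inv Cons.hyps(2)]
  have "(?inv (l # u) @ l # u, ?inv u @ u) \<in> ?C" by (simp add: l)
  then show ?case using Cons.IH by (rule word_cong.trans)
qed

lemma group_envelope: "group (envelope M)"
proof -
  interpret monoid "envelope M" unfolding envelope_def by (rule monoid_presented_monoid)
  show ?thesis
  proof (rule group_l_invI)
    fix X assume "X \<in> carrier (envelope M)"
    then obtain u where u: "u \<in> lists (carrier M \<times> UNIV)"
      and X: "X = word_cong (carrier M \<times> UNIV) (envelope_rels M) `` {u}"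
      unfolding envelope_def by (rule presented_monoid_carrierE)
    have inv: "map (\<lambda>(a, s). (a, \<not> s)) (rev u) \<in> lists (carrier M \<times> UNIV)"
      using u by (force simp: in_lists_conv_set)
    show "\<exists>Y\<in>carrier (envelope M). Y \<otimes>\<^bsub>envelope M\<^esub> X = \<one>\<^bsub>envelope M\<^esub>"
      unfolding envelope_def X
      by (rule bexI[OF _ presented_monoid_carrierI[OF inv]])
        (use envelope_inverse[OF u] in \<open>simp add: presented_monoid_mult[OF inv u]
          presented_monoid_one equiv_class_eq[OF equiv_word_cong]\<close>)
  qed
qed

lemma envelope_map_hom: "monoid M \<Longrightarrow> envelope_map M \<in> hom M (envelope M)"
proof (rule homI)
  fix a b assume ab: "a \<in> carrier M" "b \<in> carrier M" and "monoid M"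
  then have "([(a, True), (b, True)], [(a \<otimes>\<^bsub>M\<^esub> b, True)])
      \<in> word_cong (carrier M \<times> UNIV) (envelope_rels M)"
    by (intro word_cong.base) (force simp: envelope_rels_def monoid.m_closed)+
  with ab show "envelope_map M (a \<otimes>\<^bsub>M\<^esub> b)
      = envelope_map M a \<otimes>\<^bsub>envelope M\<^esub> envelope_map M b"
    by (simp add: envelope_map_def envelope_def presented_monoid_mult
        equiv_class_eq[OF equiv_word_cong])
qed (simp add: envelope_map_def envelope_def presented_monoid_carrierI)

theorem envelope_universal:
  assumes M: "monoid M" and H: "group H" and f: "f \<in> hom M H"
  shows "\<exists>h\<in>hom (envelope M) H. \<forall>a\<in>carrier M. h (envelope_map M a) = f a"
    and "\<lbrakk>h \<in> hom (envelope M) H; h' \<in> hom (envelope M) H;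
           \<forall>a\<in>carrier M. h (envelope_map M a) = f a; \<forall>a\<in>carrier M. h' (envelope_map M a) = f a;
           X \<in> carrier (envelope M)\<rbrakk> \<Longrightarrow> h X = h' X"
proof -
  interpret H: group H by (rule H)
  let ?S = "carrier M \<times> (UNIV :: bool set)"
  let ?C = "word_cong ?S (envelope_rels M)"
  define val where "val = (\<lambda>w. foldr (\<lambda>(a, s) z. (if s then f a else inv\<^bsub>H\<^esub> f a) \<otimes>\<^bsub>H\<^esub> z) w \<one>\<^bsub>H\<^esub>)"
  have fc: "f a \<in> carrier H" if "a \<in> carrier M" for a using f that by (auto simp: hom_def)
  have valc: "val w \<in> carrier H" if "w \<in> lists ?S" for w
    using that by induction (auto simp: val_def fc)
  have val_app: "val (u @ v) = val u \<otimes>\<^bsub>H\<^esub> val v" if "u \<in> lists ?S" "v \<in> lists ?S" for u v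
    using that(1)
  proof induction
    case Nil
    then show ?case using valc[OF that(2)] by (simp add: val_def)
  next
    case (Cons l u)
    then show ?case using valc[OF that(2)] valc[of u]
      by (auto simp: val_def fc H.m_assoc)
  qed
  have f1: "f \<one>\<^bsub>M\<^esub> = \<one>\<^bsub>H\<^esub>"
  proof -
    have "f \<one>\<^bsub>M\<^esub> \<otimes>\<^bsub>H\<^esub> f \<one>\<^bsub>M\<^esub> = f (\<one>\<^bsub>M\<^esub> \<otimes>\<^bsub>M\<^esub> \<one>\<^bsub>M\<^esub>)"
      using f monoid.one_closed[OF M] by (simp add: hom_mult)
    then show ?thesis
      using monoid.one_closed[OF M] monoid.l_one[OF M] fc by (simp add: H.r_cancel_one)
  qed
  have resp: "val u = val v" if "(u, v) \<in> ?C" for u v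
    using that
  proof induction
    case (base u v)
    then show ?case
      using fc f by (auto simp: envelope_rels_def val_def f1 hom_mult)
  next
    case (ctxt u v x y)
    then show ?case using word_cong_in_lists[OF ctxt(1)] by (simp add: val_app)
  qed auto
  define h where "h X = val (SOME w. w \<in> X)" for X
  have hval: "h (?C `` {w}) = val w" if "w \<in> lists ?S" for w
  proof -
    have "(SOME v. v \<in> ?C `` {w}) \<in> ?C `` {w}"
      by (rule someI[of _ w]) (use that in \<open>simp add: word_cong.refl\<close>)
    then show ?thesis unfolding h_def using resp by auto
  qed
  show "\<exists>h\<in>hom (envelope M) H. \<forall>a\<in>carrier M. h (envelope_map M a) = f a"
  proof (intro bexI[of _ h] ballI homI)
    show "h (envelope_map M a) = f a" if "a \<in> carrier M" for a
      using that hval[of "[(a, True)]"] fc by (simp add: envelope_map_def val_def)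
    show "h X \<in> carrier H" if "X \<in> carrier (envelope M)" for X
      using that unfolding envelope_def
      by (rule presented_monoid_carrierE) (simp add: hval valc)
    fix X Y assume X: "X \<in> carrier (envelope M)" and Y: "Y \<in> carrier (envelope M)"
    obtain u where u: "u \<in> lists ?S" "X = ?C `` {u}"
      using X unfolding envelope_def by (rule presented_monoid_carrierE)
    obtain v where v: "v \<in> lists ?S" "Y = ?C `` {v}"
      using Y unfolding envelope_def by (rule presented_monoid_carrierE)
    have uv: "u @ v \<in> lists ?S" using u v by simp
    show "h (X \<otimes>\<^bsub>envelope M\<^esub> Y) = h X \<otimes>\<^bsub>H\<^esub> h Y"
      unfolding envelope_def u(2) v(2) presented_monoid_mult[OF u(1) v(1)]
      by (simp only: hval[OF uv] hval[OF u(1)] hval[OF v(1)] val_app[OF u(1) v(1)])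
  qed
  show "h X = h' X"
    if hom: "h \<in> hom (envelope M) H" "h' \<in> hom (envelope M) H"
      and eq: "\<forall>a\<in>carrier M. h (envelope_map M a) = f a"
        "\<forall>a\<in>carrier M. h' (envelope_map M a) = f a"
      and X: "X \<in> carrier (envelope M)" for h h' X
  proof -
    interpret E: group "envelope M" by (rule group_envelope)
    interpret h: group_hom "envelope M" H h by unfold_locales (rule hom)
    interpret h': group_hom "envelope M" H h' by unfold_locales (rule hom)
    have mapc: "envelope_map M a \<in> carrier (envelope M)" if "a \<in> carrier M" for a
      using that by (simp add: envelope_map_def envelope_def presented_monoid_carrierI)
    have letter: "h (?C `` {[(a, s)]}) = h' (?C `` {[(a, s)]})" if a: "a \<in> carrier M" for a s
    proof (cases s)
      case True
      then show ?thesis using a eq by (simp add: envelope_map_def)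
    next
      case False
      have "([(a, False), (a, True)], []) \<in> ?C"
        using a by (intro word_cong.base) (force simp: envelope_rels_def)+
      then have "?C `` {[(a, False)]} \<otimes>\<^bsub>envelope M\<^esub> envelope_map M a = \<one>\<^bsub>envelope M\<^esub>"
        using a by (simp add: envelope_map_def envelope_def presented_monoid_mult
            presented_monoid_one equiv_class_eq[OF equiv_word_cong])
      then have "?C `` {[(a, False)]} = inv\<^bsub>envelope M\<^esub> (envelope_map M a)"
        using a mapc by (intro E.inv_equality[symmetric])
          (auto simp: envelope_def presented_monoid_carrierI)
      then show ?thesis using False a eq mapc by simp
    qed
    obtain u where u: "u \<in> lists ?S" and Xu: "X = ?C `` {u}"
      using X unfolding envelope_def by (rule presented_monoid_carrierE)
    from u have "h (?C `` {u}) = h' (?C `` {u})"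
    proof induction
      case Nil
      then show ?case using h.hom_one h'.hom_one
        by (simp add: envelope_def presented_monoid_one)
    next
      case (Cons l u)
      obtain a s where l: "l = (a, s)" "a \<in> carrier M" using Cons.hyps by auto
      have "?C `` {l # u} = ?C `` {[l]} \<otimes>\<^bsub>envelope M\<^esub> ?C `` {u}"
        using l Cons.hyps by (simp add: envelope_def presented_monoid_mult)
      moreover have "?C `` {[l]} \<in> carrier (envelope M)" "?C `` {u} \<in> carrier (envelope M)"
        using l Cons.hyps by (simp_all add: envelope_def presented_monoid_carrierI)
      ultimately show ?case using Cons.IH letter[OF l(2)] l(1) by simp
    qed
    then show ?thesis by (simp add: Xu)
  qed
qed

section \<open>Reduced multifractions\<close>

text \<open>
  \<open>alt_prod G f True [a\<^sub>1, a\<^sub>2, a\<^sub>3, \<dots>]\<close> is the product of \<open>f a\<^sub>1\<close>, \<open>inv (f a\<^sub>2)\<close>, \<open>f a\<^sub>3\<close>, and so on.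
\<close>

primrec alt_prod :: "('g, 'm) monoid_scheme \<Rightarrow> ('a \<Rightarrow> 'g) \<Rightarrow> bool \<Rightarrow> 'a list \<Rightarrow> 'g" where
  "alt_prod G f s [] = \<one>\<^bsub>G\<^esub>"
| "alt_prod G f s (a # as) =
     (if s then f a else inv\<^bsub>G\<^esub> (f a)) \<otimes>\<^bsub>G\<^esub> alt_prod G f (\<not> s) as"

text \<open>
  The entries are numbered from 1: the entry \<open>a\<^sub>i\<close> is \<open>as ! (i - 1)\<close>, and \<open>a\<^bsub>i+1\<^esub>\<close> is \<open>as ! i\<close>.
\<close>

definition reduced_multifraction :: "('a, 'm) monoid_scheme \<Rightarrow> 'a list \<Rightarrow> bool" where
  "reduced_multifraction M as \<longleftrightarrow>
     set as \<subseteq> carrier M \<and>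
     (length as \<ge> 1 \<longrightarrow> last as \<noteq> \<one>\<^bsub>M\<^esub>) \<and>
     (length as \<ge> 2 \<longrightarrow> is_right_gcd M \<one>\<^bsub>M\<^esub> (as ! 0) (as ! 1)) \<and>
     (\<forall>i. even i \<and> 2 \<le> i \<and> i < length as \<longrightarrow>
        (\<forall>x\<in>carrier M. x \<noteq> \<one>\<^bsub>M\<^esub> \<and> x divides\<^bsub>M\<^esub> (as ! i) \<longrightarrow>
           \<not> common_right_multiple M {x, as ! (i - 1)})) \<and>
     (\<forall>i. odd i \<and> 3 \<le> i \<and> i < length as \<longrightarrow>
        (\<forall>x\<in>carrier M. x \<noteq> \<one>\<^bsub>M\<^esub> \<and> right_divides M x (as ! i) \<longrightarrow>
           \<not> common_left_multiple M {x, as ! (i - 1)}))"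

section \<open>Decidability\<close>

text \<open>
  Partial recursive functions. Arities are not tracked: \<^term>\<open>rec_eval p xs y\<close> states that
  the program \<open>p\<close> halts on the argument tuple \<open>xs\<close> with result \<open>y\<close>.
\<close>

datatype recf =
    Zero
  | Succ
  | Proj nat
  | Comp recf "recf list"
  | PrimRec recf recf
  | Mu recf

inductive rec_eval :: "recf \<Rightarrow> nat list \<Rightarrow> nat \<Rightarrow> bool" where
  zero: "rec_eval Zero xs 0"
| succ: "rec_eval Succ [x] (Suc x)"
| proj: "i < length xs \<Longrightarrow> rec_eval (Proj i) xs (xs ! i)"
| comp: "\<lbrakk>list_all2 (\<lambda>g y. rec_eval g xs y) gs ys; rec_eval f ys z\<rbrakk>
    \<Longrightarrow> rec_eval (Comp f gs) xs z"
| prim_0: "rec_eval f xs y \<Longrightarrow> rec_eval (PrimRec f g) (0 # xs) y"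
| prim_Suc: "\<lbrakk>rec_eval (PrimRec f g) (n # xs) y; rec_eval g (n # y # xs) z\<rbrakk>
    \<Longrightarrow> rec_eval (PrimRec f g) (Suc n # xs) z"
| mu: "\<lbrakk>rec_eval f (n # xs) 0; \<forall>m<n. \<exists>y>0. rec_eval f (m # xs) y\<rbrakk>
    \<Longrightarrow> rec_eval (Mu f) xs n"

lemma rec_eval_deterministic:
  assumes "rec_eval p xs y" "rec_eval p xs y'"
  shows "y = y'"
  using assms
proof (induction arbitrary: y' rule: rec_eval.induct)
  case (zero xs)
  then show ?case by (auto elim: rec_eval.cases)
next
  case (succ x)
  then show ?case by (auto elim: rec_eval.cases)
next
  case (proj i xs)
  from proj.prems show ?case by cases auto
next
  case (comp xs gs ys f z)
  from comp.prems obtain ys' where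
    ys': "list_all2 (\<lambda>g y. rec_eval g xs y) gs ys'" "rec_eval f ys' y'"
    by cases auto
  have "ys = ys'"
    using comp.IH(1) ys'(1) by (auto simp: list_all2_conv_all_nth intro!: nth_equalityI)
  then show ?case using comp.IH(2) ys'(2) by blast
next
  case (prim_0 f xs y g)
  from prim_0.prems show ?case by cases (use prim_0.IH in auto)
next
  case (prim_Suc f g n xs y z)
  from prim_Suc.prems show ?case by cases (use prim_Suc.IH in blast)
next
  case (mu f n xs)
  from mu.prems obtain "rec_eval f (y' # xs) 0" "\<forall>m<y'. \<exists>y>0. rec_eval f (m # xs) y"
    by cases auto
  with mu.IH show ?case by (metis less_irrefl linorder_neqE_nat)
qed

definition decidable_set :: "nat set \<Rightarrow> bool" where
  "decidable_set A \<longleftrightarrow> (\<exists>p. \<forall>n. rec_eval p [n] (of_bool (n \<in> A)))"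

text \<open>
  Words in the generators \<open>xs ! 0\<close>, \<open>xs ! 1\<close>, \<open>\<dots>\<close> of a group: \<open>Inl i\<close> is the generator \<open>xs ! i\<close>
  and \<open>Inr i\<close> its inverse. They are coded as natural numbers by the standard computable
  bijections \<^const>\<open>sum_encode\<close> and \<^const>\<open>list_encode\<close>.
\<close>

definition group_words :: "'g list \<Rightarrow> (nat + nat) list set" where
  "group_words xs = lists ({..<length xs} <+> {..<length xs})"

definition word_value :: "('g, 'm) monoid_scheme \<Rightarrow> 'g list \<Rightarrow> (nat + nat) list \<Rightarrow> 'g" where
  "word_value G xs w =
     foldr (\<otimes>\<^bsub>G\<^esub>) (map (case_sum (\<lambda>i. xs ! i) (\<lambda>i. inv\<^bsub>G\<^esub> (xs ! i))) w) \<one>\<^bsub>G\<^esub>"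

text \<open>
  Decidability of the word problem with respect to a finite generating set \<open>X\<close>. It does not
  depend on the enumeration \<open>xs\<close> of \<open>X\<close>, so all enumerations are required to work.
\<close>

definition decidable_word_problem :: "('g, 'm) monoid_scheme \<Rightarrow> 'g set \<Rightarrow> bool" where
  "decidable_word_problem G X \<longleftrightarrow>
     finite X \<and> X \<subseteq> carrier G \<and> generate G X = carrier G \<and>
     (\<forall>xs. set xs = X \<longrightarrow>
        decidable_set {list_encode (map sum_encode w) |w.
          w \<in> group_words xs \<and> word_value G xs w = \<one>\<^bsub>G\<^esub>})"

end

theory Submission
  imports Defs "HOL-Algebra.Bij"
begin

text \<open>
  A multifraction \<open>a\<^sub>1/a\<^sub>2/a\<^sub>3/\<dots>\<close> stands for \<open>a\<^sub>1 a\<^sub>2\<inverse> a\<^sub>3 \<dots>\<close> in the enveloping group. One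
  reduces it by moving a divisor of \<open>a\<^bsub>i+1\<^esub>\<close> through \<open>a\<^sub>i\<close>, that is, by replacing
  \<open>a\<^sub>i\<inverse> (x d)\<close> with \<open>x' e\<inverse> d\<close> whenever \<open>a\<^sub>i x' = x e\<close>; this does not change the value in the
  group. Noetherianity makes reduction terminate, since the last entry that changes is replaced by
  a proper divisor. The 3-Ore condition gives local confluence, the critical case being that of two
  divisors of the same \<open>a\<^bsub>i+1\<^esub>\<close>. So normal forms are unique, and \<open>M\<close> acts on them by bijections
  via left multiplication of \<open>a\<^sub>1\<close>. By the universal property the enveloping group acts too, and
  applying a group element to the trivial multifraction recovers its normal form.

  For the word problem, the residues of the basic elements by a product are obtained by composing
  those of the factors. Hence, if there are finitely many basic elements, whether a word in the
  atoms and their inverses spells a reduced multifraction is decided by a finite automaton, and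
  \<open>M\<close> has a finite presentation. To decide whether a word represents \<open>1\<close>, search for a derivation
  from it to a word spelling a reduced multifraction, and see whether that word is empty.
\<close>

section \<open>Total recursive functions\<close>

text \<open>Injectivity of \<open>envelope_map\<close> is not an ingredient but a corollary: an
  element of \<open>M\<close> is a multifraction of length at most one, so uniqueness covers it. The
  group is met only through its universal property. Left multiplication by \<open>m\<close> is
  bijective on normal forms because putting \<open>1/m\<close> in front of a multifraction undoes it
  up to reduction.

  For decidability the obstacle is that the entries read from a word are unbounded, while an
  automaton has finite memory. But irreducibility is a condition on adjacent entries, and as every
  nontrivial divisor is a multiple of an atom, it only asks which atoms divide an entry and which
  have a common multiple with it. Both can be read off from the residues of basic elements by the
  entry, a relation on a finite set. No bound on the length of derivations is computed; the
  unbounded search is total because every word is congruent to one spelling a reduced multifraction.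
  As decidability refers to concrete programs, the search has to be exhibited as a recursive
  function on codes of words.\<close>

definition recursive :: "nat \<Rightarrow> (nat list \<Rightarrow> nat) \<Rightarrow> bool" where
  "recursive k f \<longleftrightarrow> (\<exists>p. \<forall>xs. length xs = k \<longrightarrow> rec_eval p xs (f xs))"

lemma recursive_cong:
  "recursive k f \<Longrightarrow> (\<And>xs. length xs = k \<Longrightarrow> f xs = g xs) \<Longrightarrow> recursive k g"
  unfolding recursive_def by (elim exE) (metis (no_types, lifting))

lemma recursive_zero: "recursive k (\<lambda>_. 0)"
  unfolding recursive_def using rec_eval.zero by blast

lemma recursive_proj: "i < k \<Longrightarrow> recursive k (\<lambda>xs. xs ! i)"
  unfolding recursive_def using rec_eval.proj by blast

lemma recursive_Suc: "recursive 1 (\<lambda>xs. Suc (xs ! 0))"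
  unfolding recursive_def by (rule exI[of _ Succ]) (auto simp: length_Suc_conv rec_eval.succ)

lemma recursive_comp:
  assumes f: "recursive (length gs) f" and gs: "\<And>g. g \<in> set gs \<Longrightarrow> recursive k g"
  shows "recursive k (\<lambda>xs. f (map (\<lambda>g. g xs) gs))"
proof -
  obtain p where p: "\<And>xs. length xs = length gs \<Longrightarrow> rec_eval p xs (f xs)"
    using f by (auto simp: recursive_def)
  have "\<exists>ps. \<forall>xs. length xs = k \<longrightarrow> list_all2 (\<lambda>p y. rec_eval p xs y) ps (map (\<lambda>g. g xs) gs)"
    using gs
  proof (induction gs)
    case Nil
    show ?case by (rule exI[of _ "[]"]) simp
  next
    case (Cons g gs)
    obtain ps where "\<forall>xs. length xs = k \<longrightarrow> list_all2 (\<lambda>p y. rec_eval p xs y) ps (map (\<lambda>g. g xs) gs)"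
      using Cons by auto
    moreover obtain q where "\<forall>xs. length xs = k \<longrightarrow> rec_eval q xs (g xs)"
      using Cons.prems[of g] by (auto simp: recursive_def)
    ultimately show ?case by (intro exI[of _ "q # ps"]) simp
  qed
  then obtain ps where
    "\<And>xs. length xs = k \<Longrightarrow> list_all2 (\<lambda>p y. rec_eval p xs y) ps (map (\<lambda>g. g xs) gs)"
    by blast
  then have "rec_eval (Comp p ps) xs (f (map (\<lambda>g. g xs) gs))" if "length xs = k" for xs
    using that by (intro rec_eval.comp) (auto intro: p)
  then show ?thesis unfolding recursive_def by blast
qed

lemma recursive_prim:
  assumes "recursive k f" "recursive (Suc (Suc k)) g"
  shows "recursive (Suc k) (\<lambda>xs. rec_nat (f (tl xs)) (\<lambda>n y. g (n # y # tl xs)) (hd xs))"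
proof -
  obtain p where p: "\<And>xs. length xs = k \<Longrightarrow> rec_eval p xs (f xs)"
    using assms(1) by (auto simp: recursive_def)
  obtain q where q: "\<And>xs. length xs = Suc (Suc k) \<Longrightarrow> rec_eval q xs (g xs)"
    using assms(2) by (auto simp: recursive_def)
  have "rec_eval (PrimRec p q) (n # ys) (rec_nat (f ys) (\<lambda>n y. g (n # y # ys)) n)"
    if "length ys = k" for n ys
  proof (induction n)
    case 0
    show ?case using that by (auto intro: rec_eval.prim_0 p)
  next
    case (Suc n)
    have "rec_eval q (n # rec_nat (f ys) (\<lambda>n y. g (n # y # ys)) n # ys)
        (g (n # rec_nat (f ys) (\<lambda>n y. g (n # y # ys)) n # ys))"
      by (rule q) (simp add: that)
    from rec_eval.prim_Suc[OF Suc.IH this] show ?case by simp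
  qed
  then show ?thesis unfolding recursive_def
    by (intro exI[of _ "PrimRec p q"]) (auto simp: length_Suc_conv)
qed

text \<open>Termination of the search is a hypothesis, so only total functions occur; minimality of
  the zero gives the positive values that \<open>rec_eval.mu\<close> demands below it.\<close>

lemma recursive_mu:
  assumes f: "recursive (Suc k) f" and ex: "\<And>xs. length xs = k \<Longrightarrow> \<exists>n. f (n # xs) = 0"
  shows "recursive k (\<lambda>xs. LEAST n. f (n # xs) = 0)"
proof -
  obtain p where p: "\<And>xs. length xs = Suc k \<Longrightarrow> rec_eval p xs (f xs)"
    using f by (auto simp: recursive_def)
  have "rec_eval (Mu p) xs (LEAST n. f (n # xs) = 0)" if len: "length xs = k" for xs
  proof (rule rec_eval.mu)
    have "f ((LEAST n. f (n # xs) = 0) # xs) = 0" by (rule LeastI_ex) (rule ex[OF len])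
    then show "rec_eval p ((LEAST n. f (n # xs) = 0) # xs) 0"
      using p[of "(LEAST n. f (n # xs) = 0) # xs"] len by simp
    show "\<forall>m<LEAST n. f (n # xs) = 0. \<exists>y>0. rec_eval p (m # xs) y"
    proof (intro allI impI)
      fix m assume "m < (LEAST n. f (n # xs) = 0)"
      then have "f (m # xs) > 0" using not_less_Least by blast
      then show "\<exists>y>0. rec_eval p (m # xs) y" using p[of "m # xs"] len by auto
    qed
  qed
  then show ?thesis unfolding recursive_def by blast
qed

definition recursive1 :: "(nat \<Rightarrow> nat) \<Rightarrow> bool" where
  "recursive1 f \<longleftrightarrow> recursive 1 (\<lambda>xs. f (xs ! 0))"

definition recursive2 :: "(nat \<Rightarrow> nat \<Rightarrow> nat) \<Rightarrow> bool" where
  "recursive2 f \<longleftrightarrow> recursive 2 (\<lambda>xs. f (xs ! 0) (xs ! 1))"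

lemma recursive1_app: "recursive1 f \<Longrightarrow> recursive k g \<Longrightarrow> recursive k (\<lambda>xs. f (g xs))"
  using recursive_comp[of "[g]" "\<lambda>xs. f (xs ! 0)" k] by (simp add: recursive1_def)

lemma recursive2_app:
  "recursive2 f \<Longrightarrow> recursive k g \<Longrightarrow> recursive k h \<Longrightarrow> recursive k (\<lambda>xs. f (g xs) (h xs))"
  using recursive_comp[of "[g, h]" "\<lambda>xs. f (xs ! 0) (xs ! 1)" k]
  by (auto simp: recursive2_def numeral_2_eq_2)

lemma recursive1_Suc: "recursive1 Suc"
  using recursive_Suc by (simp add: recursive1_def)

lemma recursive_const: "recursive k (\<lambda>_. c)"
  by (induction c) (auto intro: recursive_zero recursive1_app[OF recursive1_Suc])

lemma recursive1_prim:
  assumes "recursive2 g"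
  shows "recursive1 (rec_nat c g)"
proof -
  have "recursive (Suc 0) (\<lambda>xs. rec_nat c (\<lambda>n y. g ((n # y # tl xs) ! 0) ((n # y # tl xs) ! 1)) (hd xs))"
    using assms recursive_prim[OF recursive_const[of 0 c], of "\<lambda>xs. g (xs ! 0) (xs ! 1)"]
    by (simp add: recursive2_def numeral_2_eq_2)
  then have "recursive 1 (\<lambda>xs. rec_nat c g (xs ! 0))"
    unfolding One_nat_def by (rule recursive_cong) (auto simp: length_Suc_conv)
  then show ?thesis by (simp add: recursive1_def)
qed

lemma recursive2_prim:
  assumes "recursive1 f" "recursive 3 (\<lambda>xs. g (xs ! 0) (xs ! 1) (xs ! 2))"
  shows "recursive2 (\<lambda>n x. rec_nat (f x) (\<lambda>m y. g m y x) n)"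
proof -
  have "recursive (Suc 1) (\<lambda>xs. rec_nat (f (tl xs ! 0))
      (\<lambda>n y. g ((n # y # tl xs) ! 0) ((n # y # tl xs) ! 1) ((n # y # tl xs) ! 2)) (hd xs))"
    using recursive_prim[of 1 "\<lambda>xs. f (xs ! 0)" "\<lambda>xs. g (xs ! 0) (xs ! 1) (xs ! 2)"] assms
    by (simp add: recursive1_def numeral_3_eq_3)
  then have "recursive 2 (\<lambda>xs. rec_nat (f (xs ! 1)) (\<lambda>m y. g m y (xs ! 1)) (xs ! 0))"
    by (simp only: Suc_1) (erule recursive_cong, auto simp: length_Suc_conv numeral_2_eq_2)
  then show ?thesis by (simp add: recursive2_def)
qed

lemma recursive1_comp: "recursive1 f \<Longrightarrow> recursive1 g \<Longrightarrow> recursive1 (\<lambda>n. f (g n))"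
  using recursive1_app[of f 1 "\<lambda>xs. g (xs ! 0)"] by (simp add: recursive1_def)

lemma recursive1_comp2:
  "recursive2 f \<Longrightarrow> recursive1 g \<Longrightarrow> recursive1 h \<Longrightarrow> recursive1 (\<lambda>n. f (g n) (h n))"
  using recursive2_app[of f 1 "\<lambda>xs. g (xs ! 0)" "\<lambda>xs. h (xs ! 0)"] by (simp add: recursive1_def)

lemma recursive1_const: "recursive1 (\<lambda>_. c)"
  by (simp add: recursive1_def recursive_const)

lemma recursive1_id: "recursive1 (\<lambda>n. n)"
  by (simp add: recursive1_def recursive_proj)

lemma recursive2_swap: "recursive2 f \<Longrightarrow> recursive2 (\<lambda>x y. f y x)"
  using recursive2_app[of f 2 "\<lambda>xs. xs ! 1" "\<lambda>xs. xs ! 0"] recursive_proj[of _ 2]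
  by (simp add: recursive2_def)

text \<open>Apart from predecessor and triangle numbers, every primitive recursion below is an
  iteration: addition, truncated subtraction, case distinction and folds over lists.\<close>

lemma recursive2_funpow:
  assumes "recursive1 h"
  shows "recursive2 (\<lambda>n x. (h ^^ n) x)"
proof -
  have "recursive2 (\<lambda>n x. rec_nat x (\<lambda>m y. h y) n)"
    using recursive2_prim[OF recursive1_id, of "\<lambda>m y x. h y"] recursive1_app[OF assms recursive_proj[of 1 3]]
    by simp
  moreover have "rec_nat x (\<lambda>m y. h y) n = (h ^^ n) x" for n x by (induction n) auto
  ultimately show ?thesis by simp
qed

lemma recursive2_add: "recursive2 (+)"
proof -
  have "(Suc ^^ n) x = n + x" for n x by (induction n) auto
  then have "(\<lambda>n x. (Suc ^^ n) x) = (+)" by (auto simp: fun_eq_iff)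
  then show ?thesis using recursive2_funpow[OF recursive1_Suc] by simp
qed

lemma recursive1_pred: "recursive1 (\<lambda>n. n - 1)"
proof -
  have "rec_nat 0 (\<lambda>m y. m) n = n - 1" for n :: nat by (cases n) auto
  then have "rec_nat 0 (\<lambda>m y. m) = (\<lambda>n :: nat. n - 1)" by (auto simp: fun_eq_iff)
  then show ?thesis using recursive1_prim[of "\<lambda>m y. m" 0] recursive_proj[of 0 2]
    by (simp add: recursive2_def)
qed

lemma recursive2_diff: "recursive2 (-)"
proof -
  have "((\<lambda>n. n - 1) ^^ n) x = x - n" for n x :: nat by (induction n) auto
  then have eq: "(\<lambda>x n. ((\<lambda>n. n - 1) ^^ n) x) = ((-) :: nat \<Rightarrow> nat \<Rightarrow> nat)" by (intro ext)
  show ?thesis using recursive2_swap[OF recursive2_funpow[OF recursive1_pred]] unfolding eq .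
qed

lemma recursive1_triangle: "recursive1 triangle"
proof -
  have "rec_nat 0 (\<lambda>m y. y + Suc m) n = triangle n" for n by (induction n) auto
  then have "rec_nat 0 (\<lambda>m y. y + Suc m) = triangle" by (auto simp: fun_eq_iff)
  moreover have "recursive2 (\<lambda>m y. y + Suc m)" unfolding recursive2_def
    by (intro recursive2_app[OF recursive2_add] recursive1_app[OF recursive1_Suc] recursive_proj) auto
  ultimately show ?thesis using recursive1_prim[of "\<lambda>m y. y + Suc m" 0] by simp
qed

lemma recursive2_prod_encode: "recursive2 (\<lambda>x y. prod_encode (x, y))"
  unfolding recursive2_def prod_encode_def prod.case
  by (intro recursive2_app[OF recursive2_add] recursive1_app[OF recursive1_triangle] recursive_proj) auto

lemma recursive1_mu:
  assumes "recursive2 f" "\<And>x. \<exists>n. f n x = 0"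
  shows "recursive1 (\<lambda>x. LEAST n. f n x = 0)"
proof -
  have "recursive 1 (\<lambda>xs. LEAST n. f ((n # xs) ! 0) ((n # xs) ! 1) = 0)"
    using assms by (intro recursive_mu) (auto simp: recursive2_def numeral_2_eq_2)
  then show ?thesis by (simp add: recursive1_def)
qed

text \<open>The code of \<open>(x, y)\<close> is \<open>triangle (x + y) + x\<close>, so the
  diagonal \<open>x + y\<close> is the least \<open>s\<close> with
  \<open>k < triangle (s + 1)\<close>. Truncated subtraction turns this inequality into an equation
  with 0.\<close>

lemma prod_decode_Least:
  assumes "k = prod_encode (x, y)"
  shows "(LEAST s. Suc k - triangle (Suc s) = 0) = x + y"
proof (rule Least_equality)
  show "Suc k - triangle (Suc (x + y)) = 0" using assms by (simp add: prod_encode_def)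
next
  fix s assume s: "Suc k - triangle (Suc s) = 0"
  show "x + y \<le> s"
  proof (rule ccontr)
    assume "\<not> x + y \<le> s"
    then have "Suc s \<le> x + y" by simp
    moreover have "mono triangle" by (rule mono_iff_le_Suc[THEN iffD2]) simp
    ultimately have "triangle (Suc s) \<le> triangle (x + y)" by (rule monoD[rotated])
    then show False using s assms by (simp add: prod_encode_def)
  qed
qed

lemma recursive1_prod_decode:
  "recursive1 (\<lambda>k. fst (prod_decode k))" "recursive1 (\<lambda>k. snd (prod_decode k))"
proof -
  define s where "s k = (LEAST s. Suc k - triangle (Suc s) = 0)" for k
  have s: "s k = fst (prod_decode k) + snd (prod_decode k)" for k
    unfolding s_def by (rule prod_decode_Least) simp
  have k: "k = triangle (s k) + fst (prod_decode k)" for k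
    using prod_decode_inverse[of k] s[of k] by (cases "prod_decode k") (simp add: prod_encode_def)
  have "recursive1 s" unfolding s_def
  proof (rule recursive1_mu)
    show "recursive2 (\<lambda>n x. Suc x - triangle (Suc n))" unfolding recursive2_def
      by (intro recursive2_app[OF recursive2_diff] recursive1_app[OF recursive1_triangle]
          recursive1_app[OF recursive1_Suc] recursive_proj) auto
    show "\<exists>n. Suc x - triangle (Suc n) = 0" for x
      by (rule exI[of _ x]) simp
  qed
  have "(\<lambda>k. fst (prod_decode k)) = (\<lambda>k. k - triangle (s k))"
  proof
    fix n show "fst (prod_decode n) = n - triangle (s n)" using k[of n] by linarith
  qed
  moreover have "recursive1 (\<lambda>k. k - triangle (s k))"
    by (intro recursive1_comp2[OF recursive2_diff] recursive1_id recursive1_comp[OF recursive1_triangle]) fact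
  ultimately show fst: "recursive1 (\<lambda>k. fst (prod_decode k))" by simp
  have "(\<lambda>k. snd (prod_decode k)) = (\<lambda>k. s k - fst (prod_decode k))"
    using s by (auto simp: fun_eq_iff)
  moreover have "recursive1 (\<lambda>k. s k - fst (prod_decode k))"
    by (intro recursive1_comp2[OF recursive2_diff] fst) fact
  ultimately show "recursive1 (\<lambda>k. snd (prod_decode k))" by simp
qed

text \<open>Both branches are computed and packed into a pair. The map \<open>h\<close> overwrites
  the first component by the second; it is idempotent, so iterating it \<open>c n\<close> times acts
  as a switch.\<close>

lemma recursive1_If:
  assumes "recursive1 c" "recursive1 f" "recursive1 g"
  shows "recursive1 (\<lambda>n. if c n = 0 then f n else g n)"
proof -
  define h where "h z = prod_encode (snd (prod_decode z), snd (prod_decode z))" for z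
  have h: "recursive1 h" unfolding h_def
    by (intro recursive1_comp2[OF recursive2_prod_encode] recursive1_prod_decode)
  have "(h ^^ m) (prod_encode (x, y)) = prod_encode (if m = 0 then x else y, y)" for m x y
    by (induction m) (auto simp: h_def)
  then have "(\<lambda>n. fst (prod_decode ((h ^^ c n) (prod_encode (f n, g n))))) =
      (\<lambda>n. if c n = 0 then f n else g n)" by (simp add: fun_eq_iff)
  moreover have "recursive1 (\<lambda>n. fst (prod_decode ((h ^^ c n) (prod_encode (f n, g n)))))"
    by (intro recursive1_comp[OF recursive1_prod_decode(1)] recursive1_comp2[OF recursive2_funpow[OF h]]
        recursive1_comp2[OF recursive2_prod_encode] assms)
  ultimately show ?thesis by simp
qed

text \<open>Finite tables, such as the transitions of an automaton, become recursive in this way.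
  One value is split off at a time, and \<open>(n - N) + (N - n) = 0\<close> is the test for
  \<open>n = N\<close>.\<close>

lemma recursive1_finite_support:
  assumes "finite {n. f n \<noteq> (0 :: nat)}"
  shows "recursive1 f"
proof -
  have "recursive1 f" if "\<forall>n\<ge>N. f n = 0" for N f
    using that
  proof (induction N arbitrary: f)
    case 0
    then have "f = (\<lambda>_. 0)" by auto
    then show ?case using recursive1_const[of 0] by simp
  next
    case (Suc N)
    have "recursive1 (\<lambda>n. if (n - N) + (N - n) = 0 then f N else (f(N := 0)) n)"
      by (intro recursive1_If recursive1_comp2[OF recursive2_add] recursive1_comp2[OF recursive2_diff]
          recursive1_id recursive1_const Suc.IH) (use Suc.prems in \<open>auto simp: Suc_le_eq\<close>)
    moreover have "(\<lambda>n. if (n - N) + (N - n) = 0 then f N else (f(N := 0)) n) = f"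
      by (auto simp: fun_eq_iff)
    ultimately show ?case by simp
  qed
  moreover obtain N where "\<forall>n\<in>{n. f n \<noteq> 0}. n < N"
    using assms finite_nat_set_iff_bounded by blast
  ultimately show ?thesis by (metis (mono_tags) linorder_not_le mem_Collect_eq)
qed

lemma decidable_setI:
  assumes "recursive1 f" "\<And>n. f n = of_bool (n \<in> A)"
  shows "decidable_set A"
proof -
  obtain p where "\<And>xs. length xs = 1 \<Longrightarrow> rec_eval p xs (f (xs ! 0))"
    using assms(1) by (auto simp: recursive1_def recursive_def)
  from this[of "[_]"] have "rec_eval p [n] (of_bool (n \<in> A))" for n using assms(2) by simp
  then show ?thesis unfolding decidable_set_def by blast
qed

section \<open>Recursive maps between encoded types\<close>

text \<open>Nothing is asked of \<open>f\<close> outside the range of \<open>e\<close>, so programs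
  compose without tests for well-formed codes.\<close>

definition recursive_map :: "('x \<Rightarrow> nat) \<Rightarrow> ('y \<Rightarrow> nat) \<Rightarrow> ('x \<Rightarrow> 'y) \<Rightarrow> bool" where
  "recursive_map e e' F \<longleftrightarrow> (\<exists>f. recursive1 f \<and> (\<forall>x. f (e x) = e' (F x)))"

definition pair_enc :: "('x \<Rightarrow> nat) \<Rightarrow> ('y \<Rightarrow> nat) \<Rightarrow> 'x \<times> 'y \<Rightarrow> nat" where
  "pair_enc e e' = (\<lambda>(x, y). prod_encode (e x, e' y))"

lemma recursive_mapE:
  assumes "recursive_map e e' F" obtains f where "recursive1 f" "\<And>x. f (e x) = e' (F x)"
  using assms by (auto simp: recursive_map_def)

lemma recursive_mapI: "recursive1 f \<Longrightarrow> (\<And>x. f (e x) = e' (F x)) \<Longrightarrow> recursive_map e e' F"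
  by (auto simp: recursive_map_def)

lemma recursive_map_const: "recursive_map e e' (\<lambda>_. c)"
  by (rule recursive_mapI[OF recursive1_const]) simp

lemma recursive_map_id: "recursive_map e e (\<lambda>x. x)"
  by (rule recursive_mapI[OF recursive1_id]) simp

lemma recursive_map_comp:
  assumes "recursive_map e' e'' G" "recursive_map e e' F"
  shows "recursive_map e e'' (\<lambda>x. G (F x))"
proof -
  obtain g where g: "recursive1 g" "\<And>x. g (e' x) = e'' (G x)" using assms(1) by (auto elim: recursive_mapE)
  obtain f where f: "recursive1 f" "\<And>x. f (e x) = e' (F x)" using assms(2) by (auto elim: recursive_mapE)
  show ?thesis by (rule recursive_mapI[OF recursive1_comp[OF g(1) f(1)]]) (simp only: f g)
qed

lemma recursive_map_Pair:
  assumes "recursive_map e a F" "recursive_map e b G"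
  shows "recursive_map e (pair_enc a b) (\<lambda>x. (F x, G x))"
proof -
  obtain f where f: "recursive1 f" "\<And>x. f (e x) = a (F x)" using assms(1) by (auto elim: recursive_mapE)
  obtain g where g: "recursive1 g" "\<And>x. g (e x) = b (G x)" using assms(2) by (auto elim: recursive_mapE)
  show ?thesis by (rule recursive_mapI[OF recursive1_comp2[OF recursive2_prod_encode f(1) g(1)]])
    (simp only: f g pair_enc_def prod.case)
qed

lemma recursive_map_fst:
  assumes "recursive_map e (pair_enc a b) F" shows "recursive_map e a (\<lambda>x. fst (F x))"
proof -
  obtain f where f: "recursive1 f" "\<And>x. f (e x) = pair_enc a b (F x)" using assms by (auto elim: recursive_mapE)
  show ?thesis by (rule recursive_mapI[OF recursive1_comp[OF recursive1_prod_decode(1) f(1)]])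
    (simp add: f(2) pair_enc_def split_def)
qed

lemma recursive_map_snd:
  assumes "recursive_map e (pair_enc a b) F" shows "recursive_map e b (\<lambda>x. snd (F x))"
proof -
  obtain f where f: "recursive1 f" "\<And>x. f (e x) = pair_enc a b (F x)" using assms by (auto elim: recursive_mapE)
  show ?thesis by (rule recursive_mapI[OF recursive1_comp[OF recursive1_prod_decode(2) f(1)]])
    (simp add: f(2) pair_enc_def split_def)
qed

lemma recursive_map_Cons:
  assumes "recursive_map e id F" "recursive_map e list_encode G"
  shows "recursive_map e list_encode (\<lambda>x. F x # G x)"
proof -
  obtain f where f: "recursive1 f" "\<And>x. f (e x) = F x" using assms(1) by (auto elim: recursive_mapE)
  obtain g where g: "recursive1 g" "\<And>x. g (e x) = list_encode (G x)" using assms(2) by (auto elim: recursive_mapE)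
  show ?thesis
    by (rule recursive_mapI[OF recursive1_comp[OF recursive1_Suc recursive1_comp2[OF recursive2_prod_encode f(1) g(1)]]])
      (simp only: f g list_encode.simps)
qed

lemma recursive_map_If:
  assumes "recursive_map e id c" "recursive_map e e' F" "recursive_map e e' G"
  shows "recursive_map e e' (\<lambda>x. if c x = 0 then F x else G x)"
proof -
  obtain c' where c: "recursive1 c'" "\<And>x. c' (e x) = c x" using assms(1) by (auto elim: recursive_mapE)
  obtain f where f: "recursive1 f" "\<And>x. f (e x) = e' (F x)" using assms(2) by (auto elim: recursive_mapE)
  obtain g where g: "recursive1 g" "\<And>x. g (e x) = e' (G x)" using assms(3) by (auto elim: recursive_mapE)
  show ?thesis by (rule recursive_mapI[OF recursive1_If[OF c(1) f(1) g(1)]]) (simp add: c(2) f(2) g(2))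
qed

lemma recursive_map_case_nat:
  assumes "recursive_map e id n" "recursive_map e e' F" "recursive_map (pair_enc e id) e' (\<lambda>z. G (fst z) (snd z))"
  shows "recursive_map e e' (\<lambda>x. case n x of 0 \<Rightarrow> F x | Suc m \<Rightarrow> G x m)"
proof -
  obtain n' where n': "recursive1 n'" "\<And>x. n' (e x) = n x" using assms(1) by (auto elim: recursive_mapE)
  obtain f where f: "recursive1 f" "\<And>x. f (e x) = e' (F x)" using assms(2) by (auto elim: recursive_mapE)
  obtain g where g: "recursive1 g" "\<And>z. g (pair_enc e id z) = e' (G (fst z) (snd z))"
    using assms(3) by (auto elim: recursive_mapE)
  show ?thesis
  proof (rule recursive_mapI)
    show "recursive1 (\<lambda>k. if n' k = 0 then f k else g (prod_encode (k, n' k - 1)))"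
      by (intro recursive1_If recursive1_comp[OF g(1)] recursive1_comp2[OF recursive2_prod_encode]
          recursive1_id recursive1_comp[OF recursive1_pred] n' f)
    show "(if n' (e x) = 0 then f (e x) else g (prod_encode (e x, n' (e x) - 1)))
        = e' (case n x of 0 \<Rightarrow> F x | Suc m \<Rightarrow> G x m)" for x
      using g(2)[of "(x, _)"] by (auto simp: n' f pair_enc_def split: nat.split)
  qed
qed

text \<open>The code of \<open>y # ys\<close> is the successor of the code of the pair
  \<open>(y, ys)\<close>, so the predecessor of a nonzero code is already the argument of the second
  branch.\<close>

lemma recursive_map_case_list:
  assumes "recursive_map e list_encode L" "recursive_map e e' F"
    "recursive_map (pair_enc e (pair_enc id list_encode)) e' (\<lambda>z. G (fst z) (fst (snd z)) (snd (snd z)))"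
  shows "recursive_map e e' (\<lambda>x. case L x of [] \<Rightarrow> F x | y # ys \<Rightarrow> G x y ys)"
proof -
  obtain l where l: "recursive1 l" "\<And>x. l (e x) = list_encode (L x)"
    using assms(1) by (auto elim: recursive_mapE)
  obtain f where f: "recursive1 f" "\<And>x. f (e x) = e' (F x)" using assms(2) by (auto elim: recursive_mapE)
  obtain g where g: "recursive1 g"
      "\<And>z. g (pair_enc e (pair_enc id list_encode) z) = e' (G (fst z) (fst (snd z)) (snd (snd z)))"
    using assms(3) by (auto elim: recursive_mapE)
  show ?thesis
  proof (rule recursive_mapI)
    show "recursive1 (\<lambda>k. if l k = 0 then f k else g (prod_encode (k, l k - 1)))"
      by (intro recursive1_If recursive1_comp[OF g(1)] recursive1_comp2[OF recursive2_prod_encode]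
          recursive1_id recursive1_comp[OF recursive1_pred] l f)
    show "(if l (e x) = 0 then f (e x) else g (prod_encode (e x, l (e x) - 1)))
        = e' (case L x of [] \<Rightarrow> F x | y # ys \<Rightarrow> G x y ys)" for x
      using g(2)[of "(x, _, _)"] by (auto simp: l f pair_enc_def split: list.split)
  qed
qed

lemma recursive_map_funpow:
  assumes "recursive_map e id n" "recursive_map a a h" "recursive_map e a F"
  shows "recursive_map e a (\<lambda>x. (h ^^ n x) (F x))"
proof -
  obtain n' where n': "recursive1 n'" "\<And>x. n' (e x) = n x" using assms(1) by (auto elim: recursive_mapE)
  obtain h' where h': "recursive1 h'" "\<And>x. h' (a x) = a (h x)" using assms(2) by (auto elim: recursive_mapE)
  obtain f where f: "recursive1 f" "\<And>x. f (e x) = a (F x)" using assms(3) by (auto elim: recursive_mapE)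
  have "(h' ^^ m) (a y) = a ((h ^^ m) y)" for m y by (induction m) (auto simp: h')
  then show ?thesis
    by (intro recursive_mapI[OF recursive1_comp2[OF recursive2_funpow[OF h'(1)] n'(1) f(1)]])
      (simp add: n' f)
qed

lemma length_le_list_encode: "length xs \<le> list_encode xs"
  by (induction xs) (auto intro: order_trans[OF _ le_prod_encode_2])

text \<open>The map \<open>T\<close> consumes one letter and is idle on the empty list, so any
  number of iterations that is at least the length gives the fold. The code of the list is such a
  number.\<close>

lemma recursive_map_foldl:
  assumes st: "recursive_map (pair_enc a id) a (\<lambda>(s, x). st s x)"
    and F: "recursive_map e a F" and L: "recursive_map e list_encode L"
  shows "recursive_map e a (\<lambda>x. foldl st (F x) (L x))"
proof -
  define T where "T z = (case snd z of [] \<Rightarrow> z | y # ys \<Rightarrow> (st (fst z) y, ys))"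
    for z :: "_ \<times> nat list"
  let ?e = "pair_enc a list_encode"
  let ?e' = "pair_enc ?e (pair_enc id list_encode)"
  have id': "recursive_map ?e' ?e' (\<lambda>z. z)" by (rule recursive_map_id)
  have "recursive_map ?e' (pair_enc a id) (\<lambda>z. (fst (fst z), fst (snd z)))"
    by (intro recursive_map_Pair recursive_map_fst[OF recursive_map_fst[OF id']]
        recursive_map_fst[OF recursive_map_snd[OF id']])
  from recursive_map_comp[OF st this] have "recursive_map ?e' ?e (\<lambda>z. (st (fst (fst z)) (fst (snd z)), snd (snd z)))"
    by (intro recursive_map_Pair recursive_map_snd[OF recursive_map_snd[OF id']]) simp
  then have T: "recursive_map ?e ?e T" unfolding T_def
    by (intro recursive_map_case_list recursive_map_id recursive_map_snd[OF recursive_map_id])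
      (simp add: split_def)
  have T0: "(T ^^ n) (s, []) = (s, [])" for n s by (induction n) (auto simp: T_def)
  have "(T ^^ n) (s, ys) = (foldl st s ys, [])" if "length ys \<le> n" for n s ys
    using that
  proof (induction n arbitrary: s ys)
    case (Suc n)
    show ?case
    proof (cases ys)
      case Nil
      then show ?thesis by (simp only: T0 foldl_Nil)
    next
      case (Cons y zs)
      then have "T (s, ys) = (st s y, zs)" by (simp add: T_def)
      then show ?thesis using Suc Cons by (simp add: funpow_Suc_right del: funpow.simps)
    qed
  qed simp
  then have "fst ((T ^^ list_encode (L x)) (F x, L x)) = foldl st (F x) (L x)" for x
    using length_le_list_encode by simp
  moreover obtain l where "recursive1 l" "\<And>x. l (e x) = list_encode (L x)" using L by (auto elim: recursive_mapE)
  then have "recursive_map e id (\<lambda>x. list_encode (L x))" by (intro recursive_mapI) auto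
  then have "recursive_map e a (\<lambda>x. fst ((T ^^ list_encode (L x)) (F x, L x)))"
    by (rule recursive_map_fst[OF recursive_map_funpow[OF _ T recursive_map_Pair[OF F L]]])
  ultimately show ?thesis by simp
qed

section \<open>Searching for derivations\<close>

definition rewriting :: "('b list \<times> 'b list) set \<Rightarrow> ('b list \<times> 'b list) set" where
  "rewriting R = {(p @ l @ q, p @ r @ q) |p l r q. (l, r) \<in> R}"

text \<open>The first component of \<open>z\<close> is the word to return when the match fails;
  callers pass the whole word twice, so that a rule that does not match changes nothing. The
  equality test is arithmetical to fit \<open>recursive_map_If\<close>.\<close>

primrec replace_prefix :: "nat list \<Rightarrow> nat list \<Rightarrow> nat list \<times> nat list \<Rightarrow> nat list" where
  "replace_prefix [] r z = r @ snd z"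
| "replace_prefix (x # l) r z =
     (case snd z of [] \<Rightarrow> fst z
      | y # ys \<Rightarrow> if (y - x) + (x - y) = 0 then replace_prefix l r (fst z, ys) else fst z)"

lemma replace_prefix_match: "replace_prefix l r (d, l @ q) = r @ q"
  by (induction l) auto

lemma replace_prefix_cases:
  "replace_prefix l r (d, w) = d \<or> (\<exists>q. w = l @ q \<and> replace_prefix l r (d, w) = r @ q)"
  by (induction l arbitrary: w) (auto split: list.split)

lemma recursive_map_append: "recursive_map list_encode list_encode (\<lambda>w. r @ w)"
  by (induction r) (auto intro: recursive_map_id recursive_map_Cons recursive_map_const)

lemma recursive_map_replace_prefix:
  "recursive_map (pair_enc list_encode list_encode) list_encode (replace_prefix l r)"
proof (induction l)
  case Nil
  have "recursive_map (pair_enc list_encode list_encode) list_encode (\<lambda>z. r @ snd z)"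
    by (rule recursive_map_comp[OF recursive_map_append recursive_map_snd[OF recursive_map_id]])
  then show ?case by simp
next
  case (Cons x l)
  let ?e = "pair_enc list_encode list_encode"
  let ?e' = "pair_enc ?e (pair_enc id list_encode)"
  have id': "recursive_map ?e' ?e' (\<lambda>z. z)" by (rule recursive_map_id)
  note d = recursive_map_fst[OF recursive_map_fst[OF id']]
  have "recursive1 (\<lambda>y. (y - x) + (x - y))"
    by (intro recursive1_comp2[OF recursive2_add] recursive1_comp2[OF recursive2_diff] recursive1_id recursive1_const)
  then have "recursive_map id id (\<lambda>y. (y - x) + (x - y))" by (rule recursive_mapI) simp
  from recursive_map_comp[OF this recursive_map_fst[OF recursive_map_snd[OF id']]]
  have "recursive_map ?e' list_encode (\<lambda>z. if (fst (snd z) - x) + (x - fst (snd z)) = 0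
      then replace_prefix l r (fst (fst z), snd (snd z)) else fst (fst z))"
    by (rule recursive_map_If[OF _ recursive_map_comp[OF Cons recursive_map_Pair[OF d
        recursive_map_snd[OF recursive_map_snd[OF id']]]] d])
  then have "recursive_map ?e list_encode (\<lambda>z. replace_prefix (x # l) r z)"
    unfolding replace_prefix.simps
    by (intro recursive_map_case_list recursive_map_snd[OF recursive_map_id] recursive_map_fst[OF recursive_map_id])
      (simp add: split_def)
  then show ?case .
qed

text \<open>A word \<open>u @ v\<close> with a cursor between \<open>u\<close> and \<open>v\<close> is stored as \<open>(rev u, v)\<close>.
  Instruction \<open>0\<close> moves the cursor to the right, \<open>1\<close> to the left, and \<open>i + 2\<close> applies the \<open>i\<close>-th rule
  at the cursor.\<close>

primrec apply_rule :: "(nat list \<times> nat list) list \<Rightarrow> (nat list \<times> nat list) \<times> nat \<Rightarrow> nat list \<times> nat list" where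
  "apply_rule [] z = fst z"
| "apply_rule (lr # rs) z = (case snd z of
      0 \<Rightarrow> (fst (fst z), replace_prefix (fst lr) (snd lr) (snd (fst z), snd (fst z)))
    | Suc i \<Rightarrow> apply_rule rs (fst z, i))"

text \<open>This moves the cursor one letter to the left. With the two halves exchanged before and
  after, the same map moves it to the right.\<close>

definition shift :: "nat list \<times> nat list \<Rightarrow> nat list \<times> nat list" where
  "shift z = (case fst z of [] \<Rightarrow> z | x # xs \<Rightarrow> (xs, x # snd z))"

definition run_step :: "(nat list \<times> nat list) list \<Rightarrow> (nat list \<times> nat list) \<times> nat \<Rightarrow> nat list \<times> nat list" where
  "run_step rs z = (case snd z of
      0 \<Rightarrow> (snd (shift (snd (fst z), fst (fst z))), fst (shift (snd (fst z), fst (fst z))))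
    | Suc i \<Rightarrow> (case i of 0 \<Rightarrow> shift (fst z) | Suc j \<Rightarrow> apply_rule rs (fst z, j)))"

abbreviation "word_enc \<equiv> pair_enc list_encode list_encode"

lemma recursive_map_apply_rule: "recursive_map (pair_enc word_enc id) word_enc (apply_rule rs)"
proof (induction rs)
  case Nil
  show ?case unfolding apply_rule.simps by (rule recursive_map_fst[OF recursive_map_id])
next
  case (Cons lr rs)
  let ?e = "pair_enc word_enc id"
  have id: "recursive_map ?e ?e (\<lambda>z. z)" "recursive_map (pair_enc ?e id) (pair_enc ?e id) (\<lambda>z. z)"
    by (rule recursive_map_id)+
  note w = recursive_map_fst[OF id(1)]
  have 0: "recursive_map ?e word_enc (\<lambda>z. (fst (fst z), replace_prefix (fst lr) (snd lr) (snd (fst z), snd (fst z))))"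
    by (rule recursive_map_Pair[OF recursive_map_fst[OF w] recursive_map_comp[OF recursive_map_replace_prefix
        recursive_map_Pair[OF recursive_map_snd[OF w] recursive_map_snd[OF w]]]])
  have 1: "recursive_map (pair_enc ?e id) word_enc (\<lambda>z. apply_rule rs (fst (fst z), snd z))"
    by (rule recursive_map_comp[OF Cons recursive_map_Pair[OF recursive_map_fst[OF recursive_map_fst[OF id(2)]]
        recursive_map_snd[OF id(2)]]])
  show ?case unfolding apply_rule.simps by (rule recursive_map_case_nat[OF recursive_map_snd[OF id(1)] 0 1])
qed

lemma recursive_map_shift: "recursive_map word_enc word_enc shift"
proof -
  let ?e = "pair_enc word_enc (pair_enc id list_encode)"
  have id: "recursive_map word_enc word_enc (\<lambda>z. z)" "recursive_map ?e ?e (\<lambda>z. z)"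
    by (rule recursive_map_id)+
  have "recursive_map ?e word_enc (\<lambda>z. (snd (snd z), fst (snd z) # snd (fst z)))"
    by (rule recursive_map_Pair[OF recursive_map_snd[OF recursive_map_snd[OF id(2)]]
        recursive_map_Cons[OF recursive_map_fst[OF recursive_map_snd[OF id(2)]] recursive_map_snd[OF recursive_map_fst[OF id(2)]]]])
  then show ?thesis unfolding shift_def[abs_def]
    by (rule recursive_map_case_list[OF recursive_map_fst[OF id(1)] id(1)])
qed

lemma recursive_map_run_step: "recursive_map (pair_enc word_enc id) word_enc (run_step rs)"
proof -
  let ?e = "pair_enc word_enc id"
  have id: "recursive_map ?e ?e (\<lambda>z. z)" "recursive_map (pair_enc ?e id) (pair_enc ?e id) (\<lambda>z. z)"
      "recursive_map (pair_enc (pair_enc ?e id) id) (pair_enc (pair_enc ?e id) id) (\<lambda>z. z)"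
    by (rule recursive_map_id)+
  note w = recursive_map_fst[OF id(1)]
  note sh = recursive_map_comp[OF recursive_map_shift recursive_map_Pair[OF recursive_map_snd[OF w] recursive_map_fst[OF w]]]
  note 0 = recursive_map_Pair[OF recursive_map_snd[OF sh] recursive_map_fst[OF sh]]
  note 1 = recursive_map_comp[OF recursive_map_shift recursive_map_fst[OF recursive_map_fst[OF id(2)]]]
  note 2 = recursive_map_comp[OF recursive_map_apply_rule recursive_map_Pair[OF
      recursive_map_fst[OF recursive_map_fst[OF recursive_map_fst[OF id(3)]]] recursive_map_snd[OF id(3)]]]
  show ?thesis unfolding run_step_def[abs_def]
    by (rule recursive_map_case_nat[OF recursive_map_snd[OF id(1)] 0
        recursive_map_case_nat[OF recursive_map_snd[OF id(2)] 1 2]])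
qed

abbreviation "run rs \<equiv> foldl (\<lambda>z i. run_step rs (z, i))"

lemma rewriting_step: "(l, r) \<in> R \<Longrightarrow> (p @ l @ q, p @ r @ q) \<in> rewriting R"
  by (auto simp: rewriting_def)

lemma apply_rule_sound:
  "set rs \<subseteq> R \<Longrightarrow> (rev (fst z) @ snd z, rev (fst (apply_rule rs (z, i))) @ snd (apply_rule rs (z, i))) \<in> (rewriting R)\<^sup>*"
proof (induction rs arbitrary: i)
  case (Cons lr rs)
  show ?case
  proof (cases i)
    case 0
    then show ?thesis
      using replace_prefix_cases[of "fst lr" "snd lr" "snd z" "snd z"] Cons.prems
        rewriting_step[of "fst lr" "snd lr" R "rev (fst z)"]
      by auto
  next
    case (Suc j)
    then show ?thesis using Cons by simp
  qed
qed simp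

lemma run_step_sound:
  assumes "set rs \<subseteq> R"
  shows "(rev (fst z) @ snd z, rev (fst (run_step rs (z, i))) @ snd (run_step rs (z, i))) \<in> (rewriting R)\<^sup>*"
  using apply_rule_sound[OF assms, of z]
  by (cases z) (auto simp: run_step_def shift_def split: nat.split list.split)

text \<open>Instructions that do not apply leave the word unchanged, so every list of numbers is a
  legal program and the search may run through all naturals.\<close>

lemma run_sound:
  assumes "set rs \<subseteq> R"
  shows "(rev (fst z) @ snd z, rev (fst (run rs z c)) @ snd (run rs z c)) \<in> (rewriting R)\<^sup>*"
proof (induction c arbitrary: z)
  case (Cons i c)
  from rtrancl_trans[OF run_step_sound[OF assms] Cons.IH[of "run_step rs (z, i)"]] show ?case by simp
qed simp

lemma apply_rule_nth:
  "i < length rs \<Longrightarrow> apply_rule rs (z, i) = (fst z, replace_prefix (fst (rs ! i)) (snd (rs ! i)) (snd z, snd z))"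
  by (induction rs arbitrary: i) (auto split: nat.split simp: nth_Cons')

lemma run_right: "run rs (u, v @ w) (replicate (length v) 0) = (rev v @ u, w)"
  by (induction v arbitrary: u) (auto simp: run_step_def shift_def)

lemma run_left: "run rs (v, w) (replicate (length v) 1) = ([], rev v @ w)"
  by (induction v arbitrary: w) (auto simp: run_step_def shift_def)

lemma run_complete:
  assumes "(u, v) \<in> (rewriting (set rs))\<^sup>*"
  shows "\<exists>c. run rs ([], u) c = ([], v)"
  using assms
proof induction
  case base
  show ?case by (rule exI[of _ "[]"]) simp
next
  case (step v w)
  obtain c where c: "run rs ([], u) c = ([], v)" using step.IH by blast
  obtain p l r q where v: "v = p @ l @ q" "w = p @ r @ q" "(l, r) \<in> set rs"
    using step.hyps by (auto simp: rewriting_def)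
  then obtain i where i: "i < length rs" "rs ! i = (l, r)" by (auto simp: in_set_conv_nth)
  \<comment> \<open>Walk past \<open>p\<close>, apply rule \<open>i\<close>, and walk back past the
    reversed \<open>p\<close>, so that the cursor is at the beginning again.\<close>
  have "run rs ([], u) (c @ replicate (length p) 0 @ [Suc (Suc i)] @ replicate (length (rev p)) 1) = ([], w)"
    unfolding foldl_append c v(1) run_right
    using i run_left[of rs "rev p" "r @ q"]
    by (simp add: run_step_def apply_rule_nth replace_prefix_match v(2) del: length_rev)
  then show ?case by blast
qed

text \<open>The predicate \<open>P\<close> on words is recognised by the finite automaton whose states are the values of \<open>\<alpha>\<close>.\<close>

lemma recursive_map_recognizable:
  fixes \<alpha> :: "nat list \<Rightarrow> 'q"
  assumes S: "finite S" and fin: "finite (\<alpha> ` lists S)"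
    and congr: "\<And>u v l. u \<in> lists S \<Longrightarrow> v \<in> lists S \<Longrightarrow> l \<in> S \<Longrightarrow> \<alpha> u = \<alpha> v \<Longrightarrow> \<alpha> (u @ [l]) = \<alpha> (v @ [l])"
    and P: "\<And>u v. u \<in> lists S \<Longrightarrow> v \<in> lists S \<Longrightarrow> \<alpha> u = \<alpha> v \<Longrightarrow> P u \<longleftrightarrow> P v"
  shows "recursive_map list_encode id (\<lambda>w. if w \<in> lists S \<and> \<not> P w then 1 else 0 :: nat)"
proof -
  obtain n f where f: "f ` (\<alpha> ` lists S) = {i. i < (n :: nat)}" "inj_on f (\<alpha> ` lists S)"
    using finite_imp_inj_to_nat_seg[OF fin] by blast
  \<comment> \<open>The value 0 is kept for words with a letter outside \<open>S\<close>; it serves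
    as an absorbing state.\<close>
  define code where "code u = (if u \<in> lists S then Suc (f (\<alpha> u)) else 0)" for u
  have code_le: "code u \<le> n" for u
  proof (cases "u \<in> lists S")
    case True
    then have "f (\<alpha> u) \<in> {i. i < n}" unfolding f(1)[symmetric] by blast
    then show ?thesis using True by (simp add: code_def)
  qed (simp add: code_def)
  have code_eq: "\<alpha> u = \<alpha> v" if "code u = code v" "u \<in> lists S" "v \<in> lists S" for u v
  proof (rule inj_onD[OF f(2)])
    show "f (\<alpha> u) = f (\<alpha> v)" using that by (simp add: code_def)
  qed (use that in auto)
  \<comment> \<open>A transition is computed on an arbitrary word with the given state; by
    \<open>congr\<close> the choice does not matter.\<close>
  define \<delta> where "\<delta> z = (if \<exists>u\<in>lists S. fst z = code u \<and> snd z \<in> S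
      then code ((SOME u. u \<in> lists S \<and> fst z = code u) @ [snd z]) else 0)" for z
  have \<delta>: "\<delta> (code u, l) = code (u @ [l])" for u l
  proof (cases "u \<in> lists S \<and> l \<in> S")
    case True
    define v where "v = (SOME v. v \<in> lists S \<and> code u = code v)"
    have "v \<in> lists S \<and> code u = code v" unfolding v_def by (rule someI[of _ u]) (use True in simp)
    then have "code (u @ [l]) = code (v @ [l])" using True congr[of u v l] code_eq[of u v] by (simp add: code_def)
    then show ?thesis using True by (auto simp: \<delta>_def v_def)
  next
    case False
    have "code u \<noteq> code v" if "v \<in> lists S" "u \<notin> lists S" for v using that by (simp add: code_def)
    then show ?thesis using False by (auto simp: \<delta>_def code_def)
  qed
  have fold: "foldl (\<lambda>q l. \<delta> (q, l)) (code []) w = code w" for w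
    by (induction w rule: rev_induct) (auto simp: \<delta>)
  have id: "recursive_map list_encode list_encode (\<lambda>w. w)" by (rule recursive_map_id)
  have "recursive_map (pair_enc id id) id (\<lambda>(q, l). \<delta> (q, l))"
  proof (rule recursive_mapI)
    \<comment> \<open>A nonzero transition starts in a state at most \<open>n\<close> and reads a
      letter of \<open>S\<close>, so the table is finite.\<close>
    have "{k. \<delta> (prod_decode k) \<noteq> 0} \<subseteq> prod_encode ` ({..n} \<times> S)"
    proof
      fix k assume "k \<in> {k. \<delta> (prod_decode k) \<noteq> 0}"
      then have "prod_decode k \<in> {..n} \<times> S"
        using code_le by (cases "prod_decode k") (auto simp: \<delta>_def split: if_splits)
      then show "k \<in> prod_encode ` ({..n} \<times> S)" by (metis image_eqI prod_decode_inverse)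
    qed
    then show "recursive1 (\<lambda>k. \<delta> (prod_decode k))"
      by (intro recursive1_finite_support) (use S in \<open>auto intro: finite_subset\<close>)
  qed (auto simp: pair_enc_def)
  from recursive_map_foldl[OF this recursive_map_const[of _ _ "code []"] id]
  have code: "recursive_map list_encode id code" by (simp add: fold)
  define out where "out q = (if \<exists>u\<in>lists S. q = code u \<and> \<not> P u then 1 else 0 :: nat)" for q
  have "{q. out q \<noteq> 0} \<subseteq> {..n}" using code_le by (auto simp: out_def)
  then have "recursive1 out" by (intro recursive1_finite_support) (auto intro: finite_subset)
  then have "recursive_map id id out" by (rule recursive_mapI) simp
  from recursive_map_comp[OF this code] have "recursive_map list_encode id (\<lambda>w. out (code w))" .
  moreover have "out (code w) = (if w \<in> lists S \<and> \<not> P w then 1 else 0)" for w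
  proof (cases "w \<in> lists S")
    case True
    have "(\<exists>u\<in>lists S. code w = code u \<and> \<not> P u) \<longleftrightarrow> \<not> P w"
      using True P[OF True _ code_eq[OF _ True]] by blast
    then show ?thesis using True by (simp only: out_def if_True simp_thms)
  next
    case False
    then show ?thesis by (auto simp: out_def code_def)
  qed
  ultimately show ?thesis by simp
qed

text \<open>Only existence of a derivation to a word satisfying \<open>P\<close> is assumed, not
  uniqueness: the search takes the first one that it finds, and \<open>A(2)\<close> says that any of
  them gives the right answer.\<close>

theorem decidable_by_normal_forms:
  fixes \<alpha> :: "nat list \<Rightarrow> 'q"
  assumes S: "finite S" and R: "finite R" "R \<subseteq> lists S \<times> lists S" and fin: "finite (\<alpha> ` lists S)"
    and congr: "\<And>u v l. u \<in> lists S \<Longrightarrow> v \<in> lists S \<Longrightarrow> l \<in> S \<Longrightarrow> \<alpha> u = \<alpha> v \<Longrightarrow> \<alpha> (u @ [l]) = \<alpha> (v @ [l])"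
    and P: "\<And>u v. u \<in> lists S \<Longrightarrow> v \<in> lists S \<Longrightarrow> \<alpha> u = \<alpha> v \<Longrightarrow> P u \<longleftrightarrow> P v"
    and ex: "\<And>w. w \<in> lists S \<Longrightarrow> \<exists>v. (w, v) \<in> (rewriting R)\<^sup>* \<and> P v"
    and A: "A \<subseteq> lists S"
      "\<And>w v. w \<in> lists S \<Longrightarrow> (w, v) \<in> (rewriting R)\<^sup>* \<Longrightarrow> P v \<Longrightarrow> w \<in> A \<longleftrightarrow> v = []"
  shows "decidable_set (list_encode ` A)"
proof -
  obtain rs where rs: "set rs = R" using finite_list[OF R(1)] by blast
  have lists: "w \<in> lists S \<longleftrightarrow> v \<in> lists S" if "(w, v) \<in> (rewriting R)\<^sup>*" for w v
    using that
  proof induction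
    case (step v v')
    then obtain p l r q where "v = p @ l @ q" "v' = p @ r @ q" "(l, r) \<in> R" by (auto simp: rewriting_def)
    moreover have "l \<in> lists S" "r \<in> lists S" using R(2) calculation(3) by auto
    ultimately show ?case using step.IH by simp
  qed simp
  define res where "res z = run rs ([], snd z) (fst z)" for z :: "nat list \<times> nat list"
  \<comment> \<open>Words with a letter outside \<open>S\<close> count as good, so that the search
    also stops on inputs that are not words over \<open>S\<close>.\<close>
  define bad where "bad w = (if w \<in> lists S \<and> \<not> P w then 1 else 0 :: nat)" for w
  \<comment> \<open>An empty first half means that the cursor is at the beginning, so the second
    half is the whole word.\<close>
  define test where "test z = (if list_encode (fst (res z)) = 0 then bad (snd (res z)) else 1)" for z
  have id: "recursive_map word_enc word_enc (\<lambda>z. z)" by (rule recursive_map_id)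
  have lid: "recursive_map list_encode id list_encode" by (rule recursive_mapI[OF recursive1_id]) simp
  have "recursive_map (pair_enc word_enc id) word_enc (\<lambda>(z, i). run_step rs (z, i))"
    using recursive_map_run_step by (simp add: split_def)
  from recursive_map_foldl[OF this recursive_map_Pair[OF recursive_map_const[of _ _ "[]"] recursive_map_snd[OF id]]
      recursive_map_fst[OF id]]
  have res: "recursive_map word_enc word_enc res" unfolding res_def[abs_def] .
  have "recursive_map list_encode id bad"
    unfolding bad_def[abs_def] by (rule recursive_map_recognizable[OF S fin congr P])
  from recursive_map_If[OF recursive_map_comp[OF lid recursive_map_fst[OF res]]
      recursive_map_comp[OF this recursive_map_snd[OF res]] recursive_map_const[of _ _ 1]]
  have "recursive_map word_enc id test" unfolding test_def[abs_def] .
  then obtain t where t: "recursive1 t" "\<And>z. t (word_enc z) = test z" by (auto elim: recursive_mapE)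
  define T where "T c w = t (prod_encode (c, w))" for c w
  have T: "T (list_encode c) (list_encode w) = test (c, w)" for c w
    using t(2)[of "(c, w)"] by (simp add: T_def pair_enc_def)
  have T0: "\<exists>c. T c n = 0" for n
  proof -
    define w where "w = list_decode n"
    obtain v where v: "(w, v) \<in> (rewriting R)\<^sup>*" "v \<in> lists S \<longrightarrow> P v"
      using ex[of w] by (cases "w \<in> lists S") auto
    obtain c where "run rs ([], w) c = ([], v)" using run_complete[of w v rs] v rs by blast
    then have "test (c, w) = 0" using v by (simp add: test_def res_def bad_def)
    then show ?thesis using T[of c w] by (auto simp: w_def)
  qed
  define m where "m n = (LEAST c. T c n = 0)" for n
  have "recursive2 T" unfolding recursive2_def T_def
    by (intro recursive1_app[OF t(1)] recursive2_app[OF recursive2_prod_encode] recursive_proj) auto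
  then have m: "recursive1 m" unfolding m_def[abs_def] by (rule recursive1_mu) (rule T0)
  obtain r where r: "recursive1 r" "\<And>z. r (word_enc z) = list_encode (snd (res z))"
    using recursive_map_snd[OF res] by (auto elim: recursive_mapE)
  show ?thesis
  proof (rule decidable_setI)
    show "recursive1 (\<lambda>n. if r (prod_encode (m n, n)) = 0 then 1 else 0)"
      by (intro recursive1_If recursive1_comp[OF r(1)] recursive1_comp2[OF recursive2_prod_encode]
          m recursive1_id recursive1_const)
    fix n
    define w where "w = list_decode n"
    define c where "c = list_decode (m n)"
    define v where "v = snd (res (c, w))"
    have "T (m n) n = 0" unfolding m_def by (rule LeastI_ex) (rule T0)
    then have "test (c, w) = 0" using T[of c w] by (simp add: c_def w_def)
    then have v: "fst (res (c, w)) = []" "v \<in> lists S \<longrightarrow> P v"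
      by (auto simp: test_def bad_def v_def split: if_splits) (metis list_encode_inverse list_decode.simps(1))+
    have wv: "(w, v) \<in> (rewriting R)\<^sup>*"
      using run_sound[of rs R "([], w)" c] rs v(1) by (simp add: res_def v_def)
    \<comment> \<open>For \<open>w\<close> outside \<open>lists S\<close>, the word \<open>v\<close>
      is outside as well, hence nonempty, and the answer is no.\<close>
    have "w \<in> A \<longleftrightarrow> v = []"
      using A wv v lists[OF wv] by (cases "w \<in> lists S") auto
    moreover have "n \<in> list_encode ` A \<longleftrightarrow> w \<in> A"
      by (metis imageE image_eqI list_decode_inverse list_encode_inverse w_def)
    moreover have "r (prod_encode (m n, n)) = list_encode v"
      using r(2)[of "(c, w)"] by (simp add: pair_enc_def c_def w_def v_def)
    moreover have "list_encode v = 0 \<longleftrightarrow> v = []" by (cases v) auto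
    ultimately show "(if r (prod_encode (m n, n)) = 0 then 1 else 0) = of_bool (n \<in> list_encode ` A)"
      by simp
  qed
qed

section \<open>Left and right divisibility\<close>

lemma (in group) mult_inv_mult_cancel:
  assumes "a \<in> carrier G" "x \<in> carrier G" "d \<in> carrier G"
  shows "a \<otimes> x \<otimes> inv (d \<otimes> x) = a \<otimes> inv d"
proof -
  have "a \<otimes> x \<otimes> inv (d \<otimes> x) = a \<otimes> (x \<otimes> inv x) \<otimes> inv d"
    using assms by (simp only: inv_mult_group m_assoc inv_closed m_closed)
  then show ?thesis using assms by simp
qed

text \<open>This identity is why moving a divisor through a middle entry preserves the value in the
  group.\<close>

lemma (in group) swap_quotient:
  assumes "q \<in> carrier G" "y \<in> carrier G" "x \<in> carrier G" "e \<in> carrier G" "q \<otimes> y = x \<otimes> e"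
  shows "inv q \<otimes> x = y \<otimes> inv e"
proof -
  have "inv q \<otimes> x = inv q \<otimes> (x \<otimes> e) \<otimes> inv e"
    using assms(1-4) by (simp add: m_assoc)
  also have "\<dots> = y \<otimes> inv e"
    using assms(1-4) by (simp add: assms(5)[symmetric] m_assoc[symmetric])
  finally show ?thesis .
qed

locale ore_gcd_monoid = gcd_monoid +
  assumes noeth: "noetherian G" and ore: "three_Ore G"
begin

text \<open>Entries of odd and even index are reduced by mirror-image rules. The product \<open>mul True\<close> is
  that of \<open>G\<close> and \<open>mul False\<close> is the opposite one, so that both cases are treated at once.\<close>

definition mul :: "bool \<Rightarrow> 'a \<Rightarrow> 'a \<Rightarrow> 'a" where
  "mul s a b = (if s then a \<otimes> b else b \<otimes> a)"

lemma mul_closed [simp, intro]: "a \<in> carrier G \<Longrightarrow> b \<in> carrier G \<Longrightarrow> mul s a b \<in> carrier G"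
  by (simp add: mul_def)

lemma mul_one [simp]: "a \<in> carrier G \<Longrightarrow> mul s a \<one> = a" "a \<in> carrier G \<Longrightarrow> mul s \<one> a = a"
  by (simp_all add: mul_def)

lemma mul_assoc:
  "a \<in> carrier G \<Longrightarrow> b \<in> carrier G \<Longrightarrow> c \<in> carrier G \<Longrightarrow> mul s (mul s a b) c = mul s a (mul s b c)"
  by (simp add: mul_def m_assoc)

lemma mul_Not: "mul (\<not> s) a b = mul s b a"
  by (simp add: mul_def)

lemma mul_cancel [simp]:
  "a \<in> carrier G \<Longrightarrow> b \<in> carrier G \<Longrightarrow> c \<in> carrier G \<Longrightarrow> mul s a b = mul s a c \<longleftrightarrow> b = c"
  by (auto simp: mul_def dest: l_cancel r_cancel)

lemma mul_cancel_right [simp]: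
  "a \<in> carrier G \<Longrightarrow> b \<in> carrier G \<Longrightarrow> c \<in> carrier G \<Longrightarrow> mul s b a = mul s c a \<longleftrightarrow> b = c"
  by (auto simp: mul_def dest: l_cancel r_cancel)

lemma mul_cancel_one [simp]:
  "a \<in> carrier G \<Longrightarrow> b \<in> carrier G \<Longrightarrow> mul s a b = a \<longleftrightarrow> b = \<one>"
  using mul_cancel[of a b \<one> s] by simp

lemma mult_eq_one:
  assumes "a \<in> carrier G" "b \<in> carrier G" "a \<otimes> b = \<one>"
  shows "a = \<one> \<and> b = \<one>"
proof -
  have "(b \<otimes> a) \<otimes> b = \<one> \<otimes> b" using assms by (simp add: m_assoc)
  then have ba: "b \<otimes> a = \<one>" 
    by (rule r_cancel) (use assms in auto)
  then have "a \<in> Units G" "b \<in> Units G" using assms by (auto simp: Units_def)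
  then show ?thesis using Units_trivial by simp
qed

lemma mul_eq_one:
  "a \<in> carrier G \<Longrightarrow> b \<in> carrier G \<Longrightarrow> mul s a b = \<one> \<Longrightarrow> a = \<one> \<and> b = \<one>"
  using mult_eq_one[of a b] mult_eq_one[of b a] by (auto simp: mul_def split: if_splits)

definition dv :: "bool \<Rightarrow> 'a \<Rightarrow> 'a \<Rightarrow> bool" where
  "dv s a b \<longleftrightarrow> (\<exists>c\<in>carrier G. b = mul s a c)"

lemma dv_True: "dv True a b \<longleftrightarrow> a divides b"
  by (simp add: dv_def mul_def factor_def)

lemma dv_False: "dv False a b \<longleftrightarrow> right_divides G a b"
  by (simp add: dv_def mul_def right_divides_def)

lemma dvI: "c \<in> carrier G \<Longrightarrow> b = mul s a c \<Longrightarrow> dv s a b"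
  by (auto simp: dv_def)

lemma dvE:
  assumes "dv s a b" obtains c where "c \<in> carrier G" "b = mul s a c"
  using assms by (auto simp: dv_def)

lemma dv_refl [simp]: "a \<in> carrier G \<Longrightarrow> dv s a a"
  by (rule dvI[of \<one>]) simp_all

lemma dv_one [simp]: "a \<in> carrier G \<Longrightarrow> dv s \<one> a"
  by (rule dvI[of a]) simp_all

lemma dv_one_iff [simp]: "a \<in> carrier G \<Longrightarrow> dv s a \<one> \<longleftrightarrow> a = \<one>"
  using mul_eq_one[of a _ s] by (auto simp: dv_def)

lemma dv_mul [simp]: "a \<in> carrier G \<Longrightarrow> b \<in> carrier G \<Longrightarrow> dv s a (mul s a b)"
  by (auto simp: dv_def)

lemma dv_trans:
  assumes "a \<in> carrier G" "dv s a b" "dv s b c"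
  shows "dv s a c"
proof -
  obtain x where x: "x \<in> carrier G" "b = mul s a x" using assms(2) by (rule dvE)
  obtain y where y: "y \<in> carrier G" "c = mul s b y" using assms(3) by (rule dvE)
  show ?thesis
    by (rule dvI[of "mul s x y"]) (use assms(1) x y in \<open>simp_all add: mul_assoc\<close>)
qed

lemma dv_mul_mono [simp]:
  assumes "a \<in> carrier G" "b \<in> carrier G" "c \<in> carrier G"
  shows "dv s (mul s a b) (mul s a c) \<longleftrightarrow> dv s b c"
proof -
  have "mul s a c = mul s (mul s a b) z \<longleftrightarrow> c = mul s b z" if "z \<in> carrier G" for z
    using that assms by (simp add: mul_assoc)
  then show ?thesis by (auto simp: dv_def)
qed

lemma gcd_exists:
  assumes "a \<in> carrier G" "b \<in> carrier G"
  obtains d where "d \<in> carrier G" "dv s d a" "dv s d b"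
    "\<And>y. y \<in> carrier G \<Longrightarrow> dv s y a \<Longrightarrow> dv s y b \<Longrightarrow> dv s y d"
proof (cases s)
  case True
  then show thesis using left_gcd_exists[OF assms] that by (auto simp: dv_True isgcd_def)
next
  case False
  then show thesis using right_gcd_exists[OF assms] that by (auto simp: dv_False is_right_gcd_def)
qed

text \<open>The factor \<open>x\<close> is removed on the side where \<open>dv s\<close> looks, so
  reducing \<open>mul s x d\<close> to \<open>d\<close> descends in \<open>proper s\<close>, whereas
  passing to a proper \<open>dv s\<close>-divisor descends in
  \<open>proper (\<not> s)\<close>.\<close>

definition proper :: "bool \<Rightarrow> ('a \<times> 'a) set" where
  "proper s = {(b, a). b \<in> carrier G \<and> a \<in> carrier G \<and> (\<exists>x\<in>carrier G. x \<noteq> \<one> \<and> a = mul s x b)}"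

lemma wf_proper: "wf (proper s)"
proof (cases s)
  case True
  then have "proper s = {(a, b). a \<in> carrier G \<and> b \<in> carrier G \<and> (\<exists>x\<in>carrier G. x \<notin> Units G \<and> b = x \<otimes> a)}"
    by (simp add: proper_def mul_def Units_trivial)
  then show ?thesis using noeth by (simp add: noetherian_def)
next
  case False
  then have "proper s = {(a, b). a \<in> carrier G \<and> b \<in> carrier G \<and> (\<exists>x\<in>carrier G. x \<notin> Units G \<and> b = a \<otimes> x)}"
    by (simp add: proper_def mul_def Units_trivial)
  then show ?thesis using noeth by (simp add: noetherian_def)
qed

section \<open>Common multiples and least common multiples\<close>

definition cm :: "bool \<Rightarrow> 'a \<Rightarrow> 'a \<Rightarrow> bool" where
  "cm s a b \<longleftrightarrow> (\<exists>c\<in>carrier G. dv s a c \<and> dv s b c)"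

lemma cm_True: "cm True a b \<longleftrightarrow> common_right_multiple G {a, b}"
  by (simp add: cm_def dv_True common_right_multiple_def)

lemma cm_False: "cm False a b \<longleftrightarrow> common_left_multiple G {a, b}"
  by (simp add: cm_def dv_False common_left_multiple_def)

lemma cm_ore:
  assumes "a \<in> carrier G" "b \<in> carrier G" "c \<in> carrier G" "cm s a b" "cm s b c" "cm s a c"
  obtains m where "m \<in> carrier G" "dv s a m" "dv s b m" "dv s c m"
proof (cases s)
  case True
  then have "common_right_multiple G {a, b, c}"
    using ore assms by (simp add: three_Ore_def cm_True)
  then show thesis using True that by (auto simp: common_right_multiple_def dv_True)
next
  case False
  then have "common_left_multiple G {a, b, c}"
    using ore assms by (simp add: three_Ore_def cm_False)
  then show thesis using False that by (auto simp: common_left_multiple_def dv_False)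
qed

definition is_lcm :: "bool \<Rightarrow> 'a \<Rightarrow> 'a \<Rightarrow> 'a \<Rightarrow> bool" where
  "is_lcm s a b l \<longleftrightarrow> dv s a l \<and> dv s b l \<and> (\<forall>y\<in>carrier G. dv s a y \<and> dv s b y \<longrightarrow> dv s l y)"

text \<open>Take a common multiple \<open>l\<close> that is minimal for divisibility. Its gcd with
  any other common multiple is again a common multiple, hence equals \<open>l\<close>.\<close>

lemma lcm_exists:
  assumes ab: "a \<in> carrier G" "b \<in> carrier G" and "cm s a b"
  obtains l where "l \<in> carrier G" "is_lcm s a b l"
proof -
  define Q where "Q = {m \<in> carrier G. dv s a m \<and> dv s b m}"
  obtain m where "m \<in> Q" using \<open>cm s a b\<close> by (auto simp: Q_def cm_def)
  then obtain l where l: "l \<in> Q" "\<And>y. (y, l) \<in> proper (\<not> s) \<Longrightarrow> y \<notin> Q"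
    using wfE_min[OF wf_proper[of "\<not> s"]] by metis
  have "dv s l y" if y: "y \<in> carrier G" "dv s a y" "dv s b y" for y
  proof -
    have lc: "l \<in> carrier G" "dv s a l" "dv s b l" using l(1) by (auto simp: Q_def)
    obtain d where d: "d \<in> carrier G" "dv s d l" "dv s d y"
        "\<And>z. z \<in> carrier G \<Longrightarrow> dv s z l \<Longrightarrow> dv s z y \<Longrightarrow> dv s z d"
      using gcd_exists[OF lc(1) y(1), of s] by metis
    obtain x where x: "x \<in> carrier G" "l = mul s d x" using d(2) by (rule dvE)
    have "d \<in> Q" using d ab lc y by (simp add: Q_def)
    then have "x = \<one>" using l(2)[of d] x d lc by (auto simp: proper_def mul_Not)
    then show ?thesis using x d by simp
  qed
  then show thesis using l(1) that by (auto simp: Q_def is_lcm_def)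
qed

section \<open>Reduction of multifractions\<close>

text \<open>A multifraction is a sequence that is eventually \<open>\<one>\<close>. Its entries are numbered from 1; the
  entry 0 is a dummy, which lets the rule dividing the entries 1 and 2 be the case \<open>j = 0\<close> of the
  general rule.\<close>

definition seqs :: "nat \<Rightarrow> (nat \<Rightarrow> 'a) set" where
  "seqs n = {a. range a \<subseteq> carrier G \<and> a 0 = \<one> \<and> (\<forall>i>n. a i = \<one>)}"

definition seq where "seq = (\<Union>n. seqs n)"

lemma seq_closed [simp]: "a \<in> seqs n \<Longrightarrow> a i \<in> carrier G"
  by (auto simp: seqs_def)

lemma seqsD: "a \<in> seqs n \<Longrightarrow> a 0 = \<one>" "a \<in> seqs n \<Longrightarrow> n < i \<Longrightarrow> a i = \<one>"
  by (auto simp: seqs_def)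

text \<open>The common multiple of \<open>x\<close> and the middle entry is not required to be the least one. This
  makes the steps at adjacent levels commute up to \<open>step_drop\<close> below.\<close>

definition step_at :: "nat \<Rightarrow> (nat \<Rightarrow> 'a) \<Rightarrow> (nat \<Rightarrow> 'a) \<Rightarrow> bool" where
  "step_at j a b \<longleftrightarrow> (\<exists>x\<in>carrier G. \<exists>x'\<in>carrier G. \<exists>e\<in>carrier G. \<exists>d\<in>carrier G.
     x \<noteq> \<one> \<and> a (j + 2) = mul (odd j) x d \<and> mul (odd j) (a (j + 1)) x' = mul (odd j) x e \<and>
     (j = 0 \<longrightarrow> x' = \<one>) \<and> b = a(j := mul (odd j) (a j) x', j + 1 := e, j + 2 := d))"

lemma step_atI:
  assumes "x \<in> carrier G" "x' \<in> carrier G" "e \<in> carrier G" "d \<in> carrier G" "x \<noteq> \<one>"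
    "a (j + 2) = mul (odd j) x d" "mul (odd j) (a (j + 1)) x' = mul (odd j) x e"
    "j = 0 \<longrightarrow> x' = \<one>" "b = a(j := mul (odd j) (a j) x', j + 1 := e, j + 2 := d)"
  shows "step_at j a b"
  unfolding step_at_def using assms by blast

lemma step_atE:
  assumes "step_at j a b"
  obtains x x' e d where "x \<in> carrier G" "x' \<in> carrier G" "e \<in> carrier G" "d \<in> carrier G" "x \<noteq> \<one>"
    "a (j + 2) = mul (odd j) x d" "mul (odd j) (a (j + 1)) x' = mul (odd j) x e"
    "j = 0 \<longrightarrow> x' = \<one>" "b = a(j := mul (odd j) (a j) x', j + 1 := e, j + 2 := d)"
  using assms unfolding step_at_def by blast

definition step :: "(nat \<Rightarrow> 'a) \<Rightarrow> (nat \<Rightarrow> 'a) \<Rightarrow> bool" where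
  "step a b \<longleftrightarrow> (\<exists>j. step_at j a b)"

abbreviation steps (infix "\<rightarrow>*" 50) where "steps \<equiv> step\<^sup>*\<^sup>*"

lemma step_at_bound:
  assumes "step_at j a b" "a \<in> seqs n"
  shows "j + 2 \<le> n"
proof (rule ccontr)
  assume "\<not> j + 2 \<le> n"
  then have "a (j + 2) = \<one>" using seqsD(2)[OF assms(2)] by simp
  then show False using assms(1) mul_eq_one by (metis step_atE)
qed

lemma step_seqs:
  assumes "step a b" "a \<in> seqs n"
  shows "b \<in> seqs n"
proof -
  obtain j where j: "step_at j a b" using assms(1) by (auto simp: step_def)
  have n: "j + 2 \<le> n" by (rule step_at_bound[OF j assms(2)])
  from j show ?thesis
  proof (rule step_atE)
    fix x x' e d
    assume "x' \<in> carrier G" "e \<in> carrier G" "d \<in> carrier G" "j = 0 \<longrightarrow> x' = \<one>"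
      and b: "b = a(j := mul (odd j) (a j) x', j + 1 := e, j + 2 := d)"
    moreover have "mul (odd j) (a j) x' = \<one>" if "j = 0"
      using that calculation seqsD(1)[OF assms(2)] by simp
    ultimately show ?thesis using assms(2) n unfolding seqs_def b by auto
  qed
qed

lemma steps_seqs: "a \<rightarrow>* b \<Longrightarrow> a \<in> seqs n \<Longrightarrow> b \<in> seqs n"
  by (induction rule: rtranclp_induct) (auto intro: step_seqs)

section \<open>Termination of reduction\<close>

definition antilex :: "nat \<Rightarrow> ((nat \<Rightarrow> 'a) \<times> (nat \<Rightarrow> 'a)) set" where
  "antilex n = {(b, a). \<exists>k\<le>n. (\<forall>i>k. b i = a i) \<and> (b k, a k) \<in> proper (odd k)}"

text \<open>Lower entries may grow in a step, hence the comparison from the top; the bound on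
  \<open>k\<close> makes it a lexicographic product of finitely many well-founded relations.\<close>

lemma wf_antilex: "wf (antilex n)"
proof (induction n)
  case 0
  show ?case
    by (rule wf_subset[OF wf_inv_image[OF wf_proper[of "odd 0"], of "\<lambda>a. a 0"]])
      (auto simp: antilex_def)
next
  case (Suc n)
  have "antilex (Suc n) \<subseteq> inv_image (proper (odd (Suc n)) <*lex*> antilex n) (\<lambda>a. (a (Suc n), a))"
    by (auto simp: antilex_def le_Suc_eq)
  then show ?case
    by (rule wf_subset[rotated]) (intro wf_inv_image wf_lex_prod wf_proper Suc)
qed

lemma step_antilex:
  assumes "step a b" "a \<in> seqs n"
  shows "(b, a) \<in> antilex n"
proof -
  obtain j where j: "step_at j a b" using assms(1) by (auto simp: step_def)
  have n: "j + 2 \<le> n" by (rule step_at_bound[OF j assms(2)])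
  from j show ?thesis
  proof (rule step_atE)
    fix x x' e d
    assume *: "x \<in> carrier G" "d \<in> carrier G" "x \<noteq> \<one>" "a (j + 2) = mul (odd j) x d"
      "b = a(j := mul (odd j) (a j) x', j + 1 := e, j + 2 := d)"
    then have "(b (j + 2), a (j + 2)) \<in> proper (odd (j + 2))" "\<forall>i>j + 2. b i = a i"
      by (auto simp: proper_def)
    then show ?thesis unfolding antilex_def using n by blast
  qed
qed

section \<open>Confluence of reduction\<close>

lemma step_drop:
  assumes a: "a \<in> seqs n" and u: "u \<in> carrier G" "j = 0 \<Longrightarrow> u = \<one>"
  shows "a(j := mul (odd j) (a j) u, j + 1 := mul (odd j) (a (j + 1)) u) \<rightarrow>* a" (is "?a \<rightarrow>* a")
proof (cases "u = \<one>")
  case True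
  then have "?a = a" using a by (auto simp: fun_eq_iff)
  then show ?thesis by simp
next
  case False
  then obtain k where k: "j = Suc k" using u by (cases j) auto
  \<comment> \<open>Seen from the level below, where the sides are exchanged, \<open>u\<close> is a
    common divisor of the last two of the three entries, and it is cancelled by a step with
    \<open>x' = \<one>\<close>.\<close>
  have "step_at k ?a a"
    using False u a
    by (intro step_atI[of u \<one> "a (k + 1)" "a (k + 2)"])
      (auto simp: k mul_def fun_eq_iff)
  then show ?thesis by (metis step_def r_into_rtranclp)
qed

text \<open>After dividing by \<open>x\<close> it is still possible to end up where division by the
  multiple \<open>x y\<close> leads. First \<open>step_drop\<close> corrects the step to the one
  that uses the lcm of \<open>x\<close> and the middle entry, with result \<open>b0\<close>; then
  the remaining factor \<open>y\<close> is divided out.\<close>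

lemma steps_same_level:
  assumes a: "a \<in> seqs n" and C: "x \<in> carrier G" "x' \<in> carrier G" "e \<in> carrier G" "d \<in> carrier G"
      "y \<in> carrier G" "c \<in> carrier G" "z' \<in> carrier G" "f \<in> carrier G"
    and x: "a (j + 2) = mul (odd j) x d" "mul (odd j) (a (j + 1)) x' = mul (odd j) x e" "j = 0 \<Longrightarrow> x' = \<one>"
    and z: "d = mul (odd j) y c" "mul (odd j) (a (j + 1)) z' = mul (odd j) (mul (odd j) x y) f"
      "j = 0 \<Longrightarrow> z' = \<one>" "is_lcm (odd j) (a (j + 1)) (mul (odd j) x y) (mul (odd j) (a (j + 1)) z')"
  shows "a(j := mul (odd j) (a j) x', j + 1 := e, j + 2 := d) \<rightarrow>*
         a(j := mul (odd j) (a j) z', j + 1 := f, j + 2 := c)" (is "?b \<rightarrow>* ?c")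
proof -
  define s where "s = odd j"
  define p where "p = a (j + 1)"
  have p: "p \<in> carrier G" using a by (simp add: p_def)
  note C = C seq_closed[OF a] p
  have xe: "mul s p x' = mul s x e" and zf: "mul s p z' = mul s (mul s x y) f"
    and lz: "is_lcm s p (mul s x y) (mul s p z')"
    using x z by (simp_all add: p_def s_def)
  have "dv s p (mul s x e)" "dv s x (mul s x e)"
    using C dvI[of x' "mul s x e" s p] xe by simp_all
  note px = this
  then have "cm s p x" using C by (auto simp: cm_def)
  then obtain l where l: "l \<in> carrier G" "is_lcm s p x l" using C by (metis lcm_exists)
  obtain x0 where x0: "x0 \<in> carrier G" "l = mul s p x0" using l by (auto simp: is_lcm_def elim: dvE)
  obtain e0 where e0: "e0 \<in> carrier G" "l = mul s x e0" using l by (auto simp: is_lcm_def elim: dvE)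
  have "dv s l (mul s p x')" using l C px xe by (simp add: is_lcm_def)
  then obtain u where u: "u \<in> carrier G" "x' = mul s x0 u" using x0 C by (auto elim: dvE)
  have eu: "e = mul s e0 u"
  proof -
    have "mul s x e = mul s (mul s p x0) u" using xe u C x0 by (simp add: mul_assoc)
    also have "\<dots> = mul s x (mul s e0 u)" using x0 e0 u C by (simp add: mul_assoc flip: x0(2))
    finally show ?thesis using C e0 u by simp
  qed
  have "dv s x (mul s p z')" using C zf by (simp add: mul_assoc)
  then have "dv s l (mul s p z')" using l C by (simp add: is_lcm_def)
  then obtain w where w: "w \<in> carrier G" "z' = mul s x0 w" using x0 C by (auto elim: dvE)
  have ew: "mul s e0 w = mul s y f"
  proof -
    have "mul s x (mul s y f) = mul s (mul s p x0) w"
      using zf w C x0 by (simp add: mul_assoc)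
    also have "\<dots> = mul s x (mul s e0 w)" using x0 e0 w C by (simp add: mul_assoc flip: x0(2))
    finally show ?thesis using C e0 w by simp
  qed
  have j0: "x0 = \<one>" "u = \<one>" "w = \<one>" if "j = 0"
    using mul_eq_one x(3) z(3) that u w x0(1) by metis+
  define b0 where "b0 = a(j := mul s (a j) x0, j + 1 := e0, j + 2 := d)"
  \<comment> \<open>No step out of \<open>a\<close> is assumed here, so \<open>j + 2\<close> may
    exceed \<open>n\<close>.\<close>
  have b0: "b0 \<in> seqs (max n (j + 2))"
    using a C x0 e0 j0 seqsD[OF a] by (auto simp: seqs_def b0_def)
  have "?b = b0(j := mul (odd j) (b0 j) u, j + 1 := mul (odd j) (b0 (j + 1)) u)"
    using C u x0 eu by (auto simp: b0_def fun_eq_iff mul_assoc s_def)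
  then have "?b \<rightarrow>* b0" using step_drop[OF b0 u(1)] j0 by simp
  moreover have "b0 \<rightarrow>* ?c"
  proof (cases "y = \<one>")
    case True
    \<comment> \<open>With \<open>y = \<one>\<close> no division is left, but both multiples are
      then lcms of the same pair, so \<open>?c\<close> is \<open>b0\<close> itself.\<close>
    have "dv s (mul s p z') l"
      using lz l True C by (simp add: is_lcm_def)
    then obtain t where t: "t \<in> carrier G" "l = mul s (mul s p z') t" by (rule dvE)
    have "mul s l (mul s w t) = mul s (mul s p z') t"
      unfolding x0(2) w(2) using C x0(1) w(1) t(1) by (simp add: mul_assoc)
    also have "\<dots> = l" by (rule t(2)[symmetric])
    finally have "mul s w t = \<one>" using l t w by simp
    then have "w = \<one>" using mul_eq_one t w by blast
    then have "?c = b0" using True ew C x0 w e0 z by (auto simp: b0_def s_def fun_eq_iff)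
    then show ?thesis by simp
  next
    case False
    have "step_at j b0 ?c"
      using False C x0 w e0 ew z x j0
      by (intro step_atI[of y w f c]) (auto simp: b0_def s_def fun_eq_iff mul_assoc)
    then show ?thesis by (metis step_def r_into_rtranclp)
  qed
  ultimately show ?thesis by (rule rtranclp_trans)
qed

text \<open>Both results reduce to the one obtained from the lcm \<open>z\<close> of the two
  divisors. For that division the middle entry and \<open>z\<close> need a common multiple: any two
  of the middle entry, \<open>x\<close> and \<open>y\<close> have one, so by the 3-Ore condition all
  three do, and it is a multiple of \<open>z\<close>.\<close>

lemma joinable_same_level:
  assumes a: "a \<in> seqs n" and b: "step_at j a b" and c: "step_at j a c"
  shows "\<exists>d. b \<rightarrow>* d \<and> c \<rightarrow>* d"
proof -
  define s where "s = odd j"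
  note C = seq_closed[OF a]
  obtain x x' e d where x: "x \<in> carrier G" "x' \<in> carrier G" "e \<in> carrier G" "d \<in> carrier G" "x \<noteq> \<one>"
      "a (j + 2) = mul s x d" "mul s (a (j + 1)) x' = mul s x e"
      "j = 0 \<longrightarrow> x' = \<one>" "b = a(j := mul s (a j) x', j + 1 := e, j + 2 := d)"
    using b unfolding s_def by (rule step_atE)
  obtain y y' g h where y: "y \<in> carrier G" "y' \<in> carrier G" "g \<in> carrier G" "h \<in> carrier G" "y \<noteq> \<one>"
      "a (j + 2) = mul s y h" "mul s (a (j + 1)) y' = mul s y g"
      "j = 0 \<longrightarrow> y' = \<one>" "c = a(j := mul s (a j) y', j + 1 := g, j + 2 := h)"
    using c unfolding s_def by (rule step_atE)
  have xy: "dv s x (a (j + 2))" "dv s y (a (j + 2))"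
    using dvI[OF x(4,6)] dvI[OF y(4,6)] by simp_all
  then have "cm s x y" using C by (auto simp: cm_def)
  then obtain z where z: "z \<in> carrier G" "is_lcm s x y z" using lcm_exists x y by metis
  obtain x2 where x2: "x2 \<in> carrier G" "z = mul s x x2" using z by (auto simp: is_lcm_def elim: dvE)
  obtain y2 where y2: "y2 \<in> carrier G" "z = mul s y y2" using z by (auto simp: is_lcm_def elim: dvE)
  have "dv s z (a (j + 2))" using z xy C by (auto simp: is_lcm_def)
  then obtain k where k: "k \<in> carrier G" "a (j + 2) = mul s z k" by (rule dvE)
  have dk: "d = mul s x2 k" using k x x2 by (simp add: mul_assoc)
  have hk: "h = mul s y2 k" using k y y2 by (simp add: mul_assoc)
  have "dv s (a (j + 1)) (mul s x e)" "dv s x (mul s x e)"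
      "dv s (a (j + 1)) (mul s y g)" "dv s y (mul s y g)"
    using C x y dvI[OF x(2) x(7)[symmetric]] dvI[OF y(2) y(7)[symmetric]] by auto
  then have cxy: "cm s (a (j + 1)) x" "cm s (a (j + 1)) y"
    unfolding cm_def using mul_closed[OF x(1,3)] mul_closed[OF y(1,3)] by blast+
  obtain m where "m \<in> carrier G" "dv s (a (j + 1)) m" "dv s x m" "dv s y m"
    using cm_ore[OF C x(1) y(1) cxy(1) \<open>cm s x y\<close> cxy(2)] .
  then have "cm s (a (j + 1)) z" using z by (auto simp: cm_def is_lcm_def)
  then obtain l where l: "l \<in> carrier G" "is_lcm s (a (j + 1)) z l" using lcm_exists z C by metis
  obtain z' where z': "z' \<in> carrier G" "l = mul s (a (j + 1)) z'" using l by (auto simp: is_lcm_def elim: dvE)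
  obtain f where f: "f \<in> carrier G" "l = mul s z f" using l by (auto simp: is_lcm_def elim: dvE)
  \<comment> \<open>At level 0 nothing can be pushed downwards, so \<open>z\<close> has to divide
    entry 1 itself. It does, because \<open>x\<close> and \<open>y\<close> do.\<close>
  have z0: "z' = \<one>" if "j = 0"
  proof -
    have "a (j + 1) = mul s x e" "a (j + 1) = mul s y g"
      using x(7,8) y(7,8) that mul_one(1)[OF C[of "j + 1"]] by metis+
    then have "dv s x (a (j + 1))" "dv s y (a (j + 1))"
      using dvI[OF x(3)] dvI[OF y(3)] by blast+
    then have "dv s z (a (j + 1))" using z C by (auto simp: is_lcm_def)
    then have "dv s l (a (j + 1))" using l C by (auto simp: is_lcm_def)
    then obtain t where "t \<in> carrier G" "a (j + 1) = mul s (a (j + 1)) (mul s z' t)"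
      using z' C by (auto simp: mul_assoc elim: dvE)
    then show ?thesis using mul_eq_one z' C by (metis mul_cancel_one mul_closed)
  qed
  have "mul s (a (j + 1)) z' = mul s (mul s x x2) f" "is_lcm s (a (j + 1)) (mul s x x2) (mul s (a (j + 1)) z')"
    "mul s (a (j + 1)) z' = mul s (mul s y y2) f" "is_lcm s (a (j + 1)) (mul s y y2) (mul s (a (j + 1)) z')"
    using z' f x2 y2 l by metis+
  then have "b \<rightarrow>* a(j := mul s (a j) z', j + 1 := f, j + 2 := k)"
      "c \<rightarrow>* a(j := mul s (a j) z', j + 1 := f, j + 2 := k)"
    using steps_same_level[OF a x(1-4) x2(1) k(1) z'(1) f(1), of j, folded s_def] x(6-9) dk
      steps_same_level[OF a y(1-4) y2(1) k(1) z'(1) f(1), of j, folded s_def] y(6-9) hk z0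
    by blast+
  then show ?thesis by blast
qed

text \<open>The lower step is wasted: \<open>b\<close> itself reduces to \<open>c\<close>. The upper
  step is still possible in \<open>b\<close>, with multiplier \<open>y' x\<close> instead of
  \<open>y'\<close>, and its result differs from \<open>c\<close> only by the factor
  \<open>x'\<close> in the entries \<open>j\<close> and \<open>j + 1\<close>, which
  \<open>step_drop\<close> cancels.\<close>

lemma joinable_adjacent_level:
  assumes a: "a \<in> seqs n" and b: "step_at j a b" and c: "step_at (j + 1) a c"
  shows "\<exists>d. b \<rightarrow>* d \<and> c \<rightarrow>* d"
proof -
  define s where "s = odd j"
  note C = seq_closed[OF a]
  obtain x x' e d where x: "x \<in> carrier G" "x' \<in> carrier G" "e \<in> carrier G" "d \<in> carrier G" "x \<noteq> \<one>"
      "a (j + 2) = mul s x d" "mul s (a (j + 1)) x' = mul s x e"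
      "j = 0 \<longrightarrow> x' = \<one>" "b = a(j := mul s (a j) x', j + 1 := e, j + 2 := d)"
    using b unfolding s_def by (rule step_atE)
  obtain y y' g h where y: "y \<in> carrier G" "y' \<in> carrier G" "g \<in> carrier G" "h \<in> carrier G" "y \<noteq> \<one>"
      "a (j + 3) = mul s h y" "mul s y' (a (j + 2)) = mul s g y"
      "c = a(j + 1 := mul s y' (a (j + 1)), j + 2 := g, j + 3 := h)"
    using c by (rule step_atE) (simp add: s_def mul_Not numeral_3_eq_3)
  have cn: "c \<in> seqs n" using step_seqs a c by (auto simp: step_def)
  have "step_at (j + 1) b (a(j := mul s (a j) x', j + 1 := mul s (mul s y' x) e, j + 2 := g, j + 3 := h))"
    using x y C
    by (intro step_atI[of y "mul s y' x" g h])
      (auto simp: s_def mul_Not fun_eq_iff numeral_3_eq_3 mul_assoc)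
  moreover have "c(j := mul (odd j) (c j) x', j + 1 := mul (odd j) (c (j + 1)) x') =
      a(j := mul s (a j) x', j + 1 := mul s (mul s y' x) e, j + 2 := g, j + 3 := h)"
    using x y C by (auto simp: s_def fun_eq_iff numeral_3_eq_3 mul_assoc)
  moreover note step_drop[OF cn x(2), of j] x(8)
  ultimately have "b \<rightarrow>* c" by (metis (no_types, lifting) step_def converse_rtranclp_into_rtranclp)
  then show ?thesis by blast
qed

lemma joinable_distant_level:
  assumes a: "a \<in> seqs n" and b: "step_at j a b" and c: "step_at k a c" and k: "j + 2 \<le> k"
  shows "\<exists>d. b \<rightarrow>* d \<and> c \<rightarrow>* d"
proof -
  note C = seq_closed[OF a]
  obtain x x' e d where x: "x \<in> carrier G" "x' \<in> carrier G" "e \<in> carrier G" "d \<in> carrier G" "x \<noteq> \<one>"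
      "a (j + 2) = mul (odd j) x d" "mul (odd j) (a (j + 1)) x' = mul (odd j) x e"
      "j = 0 \<longrightarrow> x' = \<one>" "b = a(j := mul (odd j) (a j) x', j + 1 := e, j + 2 := d)"
    using b by (rule step_atE)
  obtain y y' g h where y: "y \<in> carrier G" "y' \<in> carrier G" "g \<in> carrier G" "h \<in> carrier G" "y \<noteq> \<one>"
      "a (k + 2) = mul (odd k) y h" "mul (odd k) (a (k + 1)) y' = mul (odd k) y g"
      "k = 0 \<longrightarrow> y' = \<one>" "c = a(k := mul (odd k) (a k) y', k + 1 := g, k + 2 := h)"
    using c by (rule step_atE)
  define b' where "b' = b(k := mul (odd k) (b k) y', k + 1 := g, k + 2 := h)"
  have "step_at k b b'"
    unfolding b'_def using x y k by (intro step_atI[of y y' g h]) auto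
  moreover have "step_at j c b'"
  \<comment> \<open>Levels \<open>j\<close> and \<open>j + 2\<close> share the entry
    \<open>j + 2\<close>. They have the same parity, so one divides it on one side while the other
    multiplies it on the other side.\<close>
  proof (cases "k = j + 2")
    case True
    then show ?thesis using x y C
      by (intro step_atI[of x x' e "mul (odd k) d y'"]) (auto simp: b'_def mul_assoc fun_eq_iff)
  next
    case False
    then show ?thesis using x y k
      by (intro step_atI[of x x' e d]) (auto simp: b'_def fun_eq_iff)
  qed
  ultimately show ?thesis by (meson step_def r_into_rtranclp)
qed

lemma local_confluence:
  assumes "a \<in> seqs n" "step a b" "step a c"
  shows "\<exists>d. b \<rightarrow>* d \<and> c \<rightarrow>* d"
proof -
  obtain j k where jk: "step_at j a b" "step_at k a c" using assms by (auto simp: step_def)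
  consider "j = k" | "k = j + 1" | "j + 2 \<le> k" | "j = k + 1" | "k + 2 \<le> j" by linarith
  then show ?thesis
    using jk joinable_same_level joinable_adjacent_level joinable_distant_level assms(1)
    by cases metis+
qed

text \<open>Newman's lemma, by well-founded induction along \<open>antilex n\<close>.\<close>

lemma confluence:
  assumes "a \<in> seqs n" "a \<rightarrow>* b" "a \<rightarrow>* c"
  shows "\<exists>d. b \<rightarrow>* d \<and> c \<rightarrow>* d"
  using assms
proof (induction a arbitrary: b c rule: wf_induct_rule[OF wf_antilex[of n]])
  case (1 a)
  have IH: "\<exists>d. b \<rightarrow>* d \<and> c \<rightarrow>* d" if "step a a'" "a' \<rightarrow>* b" "a' \<rightarrow>* c" for a' b c
    using 1 that step_antilex step_seqs by metis
  show ?case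
  proof (cases "a = b \<or> a = c")
    case True
    then show ?thesis using 1 by blast
  next
    case False
    then obtain b1 c1 where b1: "step a b1" "b1 \<rightarrow>* b" and c1: "step a c1" "c1 \<rightarrow>* c"
      using 1 by (metis converse_rtranclpE)
    obtain d where d: "b1 \<rightarrow>* d" "c1 \<rightarrow>* d" using local_confluence 1 b1 c1 by metis
    obtain p where p: "b \<rightarrow>* p" "d \<rightarrow>* p" using IH[OF b1(1) b1(2) d(1)] by blast
    obtain q where "c \<rightarrow>* q" "p \<rightarrow>* q" using IH[OF c1(1) c1(2)] d p by (meson rtranclp_trans)
    then show ?thesis using p by (meson rtranclp_trans)
  qed
qed

section \<open>Normal forms\<close>

definition irreducible_seq :: "(nat \<Rightarrow> 'a) \<Rightarrow> bool" where
  "irreducible_seq a \<longleftrightarrow> (\<nexists>b. step a b)"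

lemma normal_form_exists:
  assumes "a \<in> seqs n"
  shows "\<exists>b. a \<rightarrow>* b \<and> irreducible_seq b"
  using assms
proof (induction a rule: wf_induct_rule[OF wf_antilex[of n]])
  case (1 a)
  then show ?case
    by (metis irreducible_seq_def step_antilex step_seqs converse_rtranclp_into_rtranclp rtranclp.rtrancl_refl)
qed

lemma normal_form_unique:
  assumes "a \<in> seqs n" "a \<rightarrow>* b" "a \<rightarrow>* c" "irreducible_seq b" "irreducible_seq c"
  shows "b = c"
  using confluence[OF assms(1-3)] assms(4,5) unfolding irreducible_seq_def by (metis converse_rtranclpE)

definition nf :: "(nat \<Rightarrow> 'a) \<Rightarrow> (nat \<Rightarrow> 'a)" where
  "nf a = (THE b. a \<rightarrow>* b \<and> irreducible_seq b)"

lemma seqE: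
  assumes "a \<in> seq" obtains n where "a \<in> seqs n"
  using assms by (auto simp: seq_def)

lemma nf_props:
  assumes "a \<in> seq" shows "a \<rightarrow>* nf a" "irreducible_seq (nf a)"
proof -
  obtain n where "a \<in> seqs n" using assms by (rule seqE)
  then have "\<exists>!b. a \<rightarrow>* b \<and> irreducible_seq b" using normal_form_exists normal_form_unique by metis
  from theI'[OF this] show "a \<rightarrow>* nf a" "irreducible_seq (nf a)" by (auto simp: nf_def)
qed

lemma steps_seq: "a \<rightarrow>* b \<Longrightarrow> a \<in> seq \<Longrightarrow> b \<in> seq"
  using steps_seqs by (auto simp: seq_def)

lemma nf_seq [simp]: "a \<in> seq \<Longrightarrow> nf a \<in> seq"
  using nf_props steps_seq by blast

lemma nf_eqI: "a \<in> seq \<Longrightarrow> a \<rightarrow>* b \<Longrightarrow> irreducible_seq b \<Longrightarrow> nf a = b"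
  using nf_props normal_form_unique by (metis seqE)

lemma nf_steps: "a \<in> seq \<Longrightarrow> a \<rightarrow>* b \<Longrightarrow> nf a = nf b"
  by (meson nf_eqI nf_props rtranclp_trans steps_seq)

lemma nf_id: "a \<in> seq \<Longrightarrow> irreducible_seq a \<Longrightarrow> nf a = a"
  by (rule nf_eqI) auto

lemma nf_cong:
  assumes F: "\<And>a b n. a \<in> seqs n \<Longrightarrow> step a b \<Longrightarrow> step (F a) (F b)" "\<And>a. a \<in> seq \<Longrightarrow> F a \<in> seq"
    and a: "a \<in> seq"
  shows "nf (F (nf a)) = nf (F a)"
proof -
  have "F a \<rightarrow>* F b" if "a \<rightarrow>* b" for b
    using that
  proof induction
    case (step b c)
    then obtain n where "b \<in> seqs n" using steps_seq a by (metis seqE)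
    then show ?case using step F(1) by (metis rtranclp.rtrancl_into_rtrancl)
  qed simp
  then show ?thesis using nf_props(1)[OF a] F(2)[OF a] nf_steps by metis
qed

section \<open>The action of the monoid on normal forms\<close>

definition lmul :: "'a \<Rightarrow> (nat \<Rightarrow> 'a) \<Rightarrow> (nat \<Rightarrow> 'a)" where
  "lmul m a = a(1 := m \<otimes> a 1)"

text \<open>This is \<open>1/m\<close> followed by \<open>a\<close>, a multifraction whose value is
  that of \<open>a\<close> multiplied on the left by the inverse of \<open>m\<close>. Shifting by
  two places preserves the parity of the entries.\<close>

definition ldiv :: "'a \<Rightarrow> (nat \<Rightarrow> 'a) \<Rightarrow> (nat \<Rightarrow> 'a)" where
  "ldiv m a = (\<lambda>i. if i < 2 then \<one> else if i = 2 then m else a (i - 2))"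

lemma lmul_seq [simp]: "m \<in> carrier G \<Longrightarrow> a \<in> seq \<Longrightarrow> lmul m a \<in> seq"
proof -
  assume m: "m \<in> carrier G" and "a \<in> seq"
  then obtain n where "a \<in> seqs n" by (auto elim: seqE)
  then have "lmul m a \<in> seqs (Suc n)" using m by (auto simp: seqs_def lmul_def)
  then show ?thesis by (auto simp: seq_def)
qed

lemma ldiv_seq [simp]: "m \<in> carrier G \<Longrightarrow> a \<in> seq \<Longrightarrow> ldiv m a \<in> seq"
proof -
  assume m: "m \<in> carrier G" and "a \<in> seq"
  then obtain n where "a \<in> seqs n" by (auto elim: seqE)
  then have "ldiv m a \<in> seqs (n + 2)" using m by (auto simp: seqs_def ldiv_def)
  then show ?thesis by (auto simp: seq_def)
qed

text \<open>Entry 1 is only changed from the right: level 0 removes a right factor and level 1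
  appends one. So a left factor \<open>m\<close> does not interfere.\<close>

lemma lmul_step:
  assumes a: "a \<in> seqs n" and m: "m \<in> carrier G" and "step a b"
  shows "step (lmul m a) (lmul m b)"
proof -
  obtain j where "step_at j a b" using \<open>step a b\<close> by (auto simp: step_def)
  then obtain x x' e d where x: "x \<in> carrier G" "x' \<in> carrier G" "e \<in> carrier G" "d \<in> carrier G" "x \<noteq> \<one>"
      "a (j + 2) = mul (odd j) x d" "mul (odd j) (a (j + 1)) x' = mul (odd j) x e"
      "j = 0 \<longrightarrow> x' = \<one>" "b = a(j := mul (odd j) (a j) x', j + 1 := e, j + 2 := d)"
    by (rule step_atE)
  note C = seq_closed[OF a]
  consider "j = 0" | "j = 1" | "j \<ge> 2" by linarith
  then have "step_at j (lmul m a) (lmul m b)"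
  proof cases
    case 1
    then show ?thesis using x m C
      by (intro step_atI[of x \<one> "m \<otimes> e" d]) (auto simp: mul_def lmul_def m_assoc fun_eq_iff)
  next
    case 2
    then show ?thesis using x m C
      by (intro step_atI[of x x' e d]) (auto simp: mul_def lmul_def m_assoc fun_eq_iff)
  next
    case 3
    then show ?thesis using x m C
      by (intro step_atI[of x x' e d]) (auto simp: lmul_def fun_eq_iff)
  qed
  then show ?thesis unfolding step_def by blast
qed

lemma ldiv_step:
  assumes a: "a \<in> seqs n" and m: "m \<in> carrier G" and "step a b"
  shows "step (ldiv m a) (ldiv m b)"
proof -
  obtain j where "step_at j a b" using \<open>step a b\<close> by (auto simp: step_def)
  then obtain x x' e d where x: "x \<in> carrier G" "x' \<in> carrier G" "e \<in> carrier G" "d \<in> carrier G" "x \<noteq> \<one>"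
      "a (j + 2) = mul (odd j) x d" "mul (odd j) (a (j + 1)) x' = mul (odd j) x e"
      "j = 0 \<longrightarrow> x' = \<one>" "b = a(j := mul (odd j) (a j) x', j + 1 := e, j + 2 := d)"
    by (rule step_atE)
  \<comment> \<open>A step of level 0 becomes one of level 2 with \<open>x' = \<one>\<close>, so the
    entry \<open>m\<close> stays as it is.\<close>
  have "step_at (j + 2) (ldiv m a) (ldiv m b)"
    using x m by (intro step_atI[of x x' e d]) (auto simp: ldiv_def fun_eq_iff)
  then show ?thesis unfolding step_def by blast
qed

text \<open>The two leading ones travel to the end, \<open>T k\<close> having them after entry
  \<open>k\<close>. Dividing an entry by itself through a middle entry \<open>\<one>\<close> carries
  it two places down.\<close>

lemma ldiv_one_steps:
  assumes a: "a \<in> seqs n"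
  shows "ldiv \<one> a \<rightarrow>* a"
proof -
  define T where "T k = (\<lambda>i. if i \<le> k then a i else if i \<le> k + 2 then \<one> else a (i - 2))" for k
  have "T k \<rightarrow>* T (Suc k)" for k
  proof (cases "a (k + 1) = \<one>")
    case True
    then have "T k = T (Suc k)"
      by (auto simp: T_def fun_eq_iff le_Suc_eq Suc_diff_le numeral_eq_Suc)
    then show ?thesis by simp
  next
    case False
    have "step_at (k + 1) (T k) (T (Suc k))"
      using False seq_closed[OF a]
      by (intro step_atI[of "a (k + 1)" "a (k + 1)" \<one> \<one>]) (auto simp: T_def fun_eq_iff le_Suc_eq)
    then show ?thesis by (metis step_def r_into_rtranclp)
  qed
  then have "T 0 \<rightarrow>* T k" for k
    by (induction k) (auto intro: rtranclp_trans)
  moreover have "T 0 = ldiv \<one> a" using a by (auto simp: T_def ldiv_def fun_eq_iff seqsD)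
  moreover have "T n = a" using a by (auto simp: T_def fun_eq_iff seqsD)
  ultimately show ?thesis by metis
qed

lemma nf_ldiv_one: "a \<in> seq \<Longrightarrow> nf (ldiv \<one> a) = nf a"
  using nf_steps[OF ldiv_seq[OF one_closed]] ldiv_one_steps by (metis seqE)

text \<open>A multifraction beginning with \<open>m/m\<close> is divided at level 0, and one
  beginning with \<open>1/m/(m b)\<close>, as in \<open>nf_ldiv_lmul\<close>, at level 1; both then
  begin with two ones, which \<open>nf_ldiv_one\<close> removes.\<close>

lemma nf_lmul_ldiv:
  assumes "a \<in> seq" "m \<in> carrier G"
  shows "nf (lmul m (ldiv m a)) = nf a"
proof -
  have "lmul m (ldiv m a) \<rightarrow>* ldiv \<one> a"
  proof (cases "m = \<one>")
    case True
    then have "lmul m (ldiv m a) = ldiv \<one> a" by (auto simp: lmul_def ldiv_def fun_eq_iff)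
    then show ?thesis by simp
  next
    case False
    then have "step_at 0 (lmul m (ldiv m a)) (ldiv \<one> a)"
      using assms by (intro step_atI[of m \<one> \<one> \<one>]) (auto simp: lmul_def ldiv_def fun_eq_iff)
    then show ?thesis by (metis step_def r_into_rtranclp)
  qed
  then show ?thesis using assms nf_steps nf_ldiv_one by simp
qed

lemma nf_ldiv_lmul:
  assumes "a \<in> seq" "m \<in> carrier G"
  shows "nf (ldiv m (lmul m a)) = nf a"
proof -
  obtain n where a: "a \<in> seqs n" using assms by (auto elim: seqE)
  have "ldiv m (lmul m a) \<rightarrow>* ldiv \<one> a"
  proof (cases "m = \<one>")
    case True
    then have "ldiv m (lmul m a) = ldiv \<one> a"
      using seq_closed[OF a] by (auto simp: lmul_def ldiv_def fun_eq_iff)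
    then show ?thesis by simp
  next
    case False
    then have "step_at 1 (ldiv m (lmul m a)) (ldiv \<one> a)"
      using assms seq_closed[OF a]
      by (intro step_atI[of m \<one> \<one> "a 1"]) (auto simp: lmul_def ldiv_def fun_eq_iff mul_def)
    then show ?thesis by (metis step_def r_into_rtranclp)
  qed
  then show ?thesis using assms nf_steps nf_ldiv_one by simp
qed

lemma nf_lmul_nf: "a \<in> seq \<Longrightarrow> m \<in> carrier G \<Longrightarrow> nf (lmul m (nf a)) = nf (lmul m a)"
  by (rule nf_cong) (auto intro: lmul_step)

lemma nf_ldiv_nf: "a \<in> seq \<Longrightarrow> m \<in> carrier G \<Longrightarrow> nf (ldiv m (nf a)) = nf (ldiv m a)"
  by (rule nf_cong) (auto intro: ldiv_step)

section \<open>The morphism from the monoid to the permutations of normal forms\<close>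

definition NF where "NF = {a \<in> seq. irreducible_seq a}"

lemma NF_nf [simp]: "a \<in> seq \<Longrightarrow> nf a \<in> NF"
  by (simp add: NF_def nf_props)

lemma nf_NF [simp]: "a \<in> NF \<Longrightarrow> nf a = a"
  by (simp add: NF_def nf_id)

lemma NF_seq: "a \<in> NF \<Longrightarrow> a \<in> seq"
  by (simp add: NF_def)

text \<open>The restriction to \<open>NF\<close> is there because \<open>BijGroup\<close> consists
  of extensional functions.\<close>

definition act :: "'a \<Rightarrow> (nat \<Rightarrow> 'a) \<Rightarrow> (nat \<Rightarrow> 'a)" where
  "act m = (\<lambda>a\<in>NF. nf (lmul m a))"

lemma act_NF: "a \<in> NF \<Longrightarrow> act m a = nf (lmul m a)"
  by (simp add: act_def)

lemma bij_act: "m \<in> carrier G \<Longrightarrow> bij_betw (act m) NF NF"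
  by (rule bij_betw_byWitness[of _ "\<lambda>a. nf (ldiv m a)"])
    (auto simp: act_def NF_seq nf_lmul_nf nf_ldiv_nf nf_lmul_ldiv nf_ldiv_lmul)

lemma act_Bij: "m \<in> carrier G \<Longrightarrow> act m \<in> carrier (BijGroup NF)"
  using bij_act by (simp add: BijGroup_def Bij_def act_def)

lemma act_hom: "act \<in> hom G (BijGroup NF)"
proof (rule homI)
  fix m k assume mk: "m \<in> carrier G" "k \<in> carrier G"
  have "act (m \<otimes> k) a = act m (act k a)" if a: "a \<in> NF" for a
  proof -
    obtain n where "a \<in> seqs n" using NF_seq[OF a] by (auto elim: seqE)
    then have "lmul m (lmul k a) = lmul (m \<otimes> k) a"
      using mk by (auto simp: lmul_def m_assoc)
    then show ?thesis using mk a by (simp add: act_def NF_seq nf_lmul_nf)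
  qed
  then have "act (m \<otimes> k) = compose NF (act m) (act k)"
    by (auto simp: compose_def fun_eq_iff act_def)
  then show "act (m \<otimes> k) = act m \<otimes>\<^bsub>BijGroup NF\<^esub> act k"
    using act_Bij mk by (simp add: BijGroup_def)
qed (rule act_Bij)

lemma inv_act:
  assumes "m \<in> carrier G" "a \<in> NF"
  shows "(inv\<^bsub>BijGroup NF\<^esub> act m) a = nf (ldiv m a)"
proof -
  have "act m (nf (ldiv m a)) = a" "nf (ldiv m a) \<in> NF"
    using assms by (simp_all add: act_def NF_seq nf_lmul_nf nf_lmul_ldiv)
  moreover have "act m \<in> Bij NF" using act_Bij[OF assms(1)] by (simp add: BijGroup_def)
  ultimately show ?thesis
    using inv_into_f_f[of "act m" NF "nf (ldiv m a)"] bij_act[OF assms(1)] assms(2)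
    by (simp add: inv_BijGroup bij_betw_def)
qed

definition seq_of :: "'a list \<Rightarrow> nat \<Rightarrow> 'a" where
  "seq_of as i = (if 0 < i \<and> i \<le> length as then as ! (i - 1) else \<one>)"

lemma seq_of_seqs: "set as \<subseteq> carrier G \<Longrightarrow> seq_of as \<in> seqs (length as)"
  by (auto simp: seqs_def seq_of_def dest: nth_mem)

lemma seq_of_seq [simp]: "set as \<subseteq> carrier G \<Longrightarrow> seq_of as \<in> seq"
  using seq_of_seqs by (auto simp: seq_def)

lemma irreducible_one: "irreducible_seq (\<lambda>_. \<one>)"
proof -
  have "(\<lambda>_. \<one>) \<in> seqs 0" by (auto simp: seqs_def)
  then show ?thesis unfolding irreducible_seq_def step_def using step_at_bound by fastforce
qed

lemma seq_of_Nil: "seq_of [] = (\<lambda>_. \<one>)"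
  by (auto simp: seq_of_def)

lemma one_NF: "(\<lambda>_. \<one>) \<in> NF"
  using irreducible_one seq_of_seq[of "[]"] by (simp add: NF_def seq_of_Nil)

lemma lmul_seq_of: "seq_of (a # as) = lmul a (seq_of (\<one> # as))" if "a \<in> carrier G"
  using that by (auto simp: seq_of_def lmul_def fun_eq_iff)

lemma ldiv_seq_of: "ldiv b (seq_of as) = seq_of (\<one> # b # as)"
  by (auto simp: seq_of_def ldiv_def fun_eq_iff nth_Cons' numeral_eq_Suc)

section \<open>Values of multifractions in the enveloping group\<close>

abbreviation "E \<equiv> envelope G"
abbreviation "\<iota> \<equiv> envelope_map G"

interpretation E: group E by (rule group_envelope)

lemma iota_hom: "\<iota> \<in> hom G E"
  by (rule envelope_map_hom) (rule monoid_axioms)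

lemma iota_closed [simp]: "a \<in> carrier G \<Longrightarrow> \<iota> a \<in> carrier E"
  using iota_hom by (auto simp: hom_def)

lemma iota_mult: "a \<in> carrier G \<Longrightarrow> b \<in> carrier G \<Longrightarrow> \<iota> (a \<otimes> b) = \<iota> a \<otimes>\<^bsub>E\<^esub> \<iota> b"
  using iota_hom by (auto simp: hom_def)

lemma iota_one [simp]: "\<iota> \<one> = \<one>\<^bsub>E\<^esub>"
proof -
  have "\<iota> \<one> \<otimes>\<^bsub>E\<^esub> \<iota> \<one> = \<iota> \<one>" using iota_mult[of \<one> \<one>] by simp
  then show ?thesis by (simp add: E.r_cancel_one)
qed

abbreviation "alt \<equiv> alt_prod E \<iota>"

lemma alt_closed [simp]: "set as \<subseteq> carrier G \<Longrightarrow> alt s as \<in> carrier E"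
  by (induction as arbitrary: s) auto

theorem alt_prod_eq_imp_nf_eq:
  assumes "set as \<subseteq> carrier G" "set bs \<subseteq> carrier G" "alt True as = alt True bs"
  shows "nf (seq_of as) = nf (seq_of bs)"
proof -
  interpret B: group "BijGroup NF" by (rule group_BijGroup)
  obtain h where h: "h \<in> hom E (BijGroup NF)" "\<forall>a\<in>carrier G. h (\<iota> a) = act a"
    using envelope_universal(1)[OF monoid_axioms group_BijGroup act_hom] by blast
  interpret h: group_hom E "BijGroup NF" h by unfold_locales (rule h)
  have comp: "(f \<otimes>\<^bsub>BijGroup NF\<^esub> g) x = f (g x)"
    if "f \<in> carrier (BijGroup NF)" "g \<in> carrier (BijGroup NF)" "x \<in> NF" for f g x
    using that by (simp add: BijGroup_def compose_def)
  have maps: "f x \<in> NF" if "f \<in> carrier (BijGroup NF)" "x \<in> NF" for f x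
    using that by (auto simp: BijGroup_def Bij_def bij_betw_def)
  have "h (alt True as) (\<lambda>_. \<one>) = nf (seq_of as)" if "set as \<subseteq> carrier G" for as
    using that
  \<comment> \<open>Entries are consumed in pairs: the inverse of \<open>b\<close> acts by prefixing
    \<open>\<one>, b\<close>, and \<open>a\<close> is then multiplied into that leading
    \<open>\<one>\<close>.\<close>
  proof (induction as rule: induct_list012)
    case 1
    then show ?case using one_NF by (simp add: seq_of_Nil BijGroup_def)
  next
    case (2 a)
    have "lmul a (\<lambda>_. \<one>) = seq_of [a]" using 2 by (auto simp: lmul_def seq_of_def fun_eq_iff)
    then show ?case using 2 h(2) one_NF by (simp add: act_def)
  next
    case (3 a b as)
    have IH: "h (alt True as) (\<lambda>_. \<one>) = nf (seq_of as)" using 3 by simp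
    have C: "a \<in> carrier G" "b \<in> carrier G" "set as \<subseteq> carrier G" using 3 by auto
    have "h (alt True (a # b # as)) (\<lambda>_. \<one>) = act a ((inv\<^bsub>BijGroup NF\<^esub> act b) (nf (seq_of as)))"
      using C h(2) one_NF IH act_Bij by (simp add: comp maps)
    also have "\<dots> = nf (lmul a (ldiv b (seq_of as)))"
      using C by (simp add: inv_act act_NF nf_ldiv_nf nf_lmul_nf)
    also have "lmul a (ldiv b (seq_of as)) = seq_of (a # b # as)"
      using C(1) by (simp add: ldiv_seq_of lmul_seq_of[of a])
    finally show ?case .
  qed
  then show ?thesis using assms by metis
qed

text \<open>Sequences carry no length, so their value is taken up to an index; past the support it
  is constant by \<open>partial_alt_tail\<close>.\<close>

primrec partial_alt where
  "partial_alt a 0 = \<one>\<^bsub>E\<^esub>"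
| "partial_alt a (Suc n) =
     partial_alt a n \<otimes>\<^bsub>E\<^esub> (if even n then \<iota> (a (Suc n)) else inv\<^bsub>E\<^esub> \<iota> (a (Suc n)))"

lemma partial_alt_closed [simp]:
  "a \<in> seqs n \<Longrightarrow> partial_alt a k \<in> carrier E"
  by (induction k) (auto simp del: envelope_def)

lemma partial_alt_cong:
  "(\<And>i. 0 < i \<Longrightarrow> i \<le> n \<Longrightarrow> a i = b i) \<Longrightarrow> partial_alt a n = partial_alt b n"
  by (induction n) auto

lemma partial_alt_tail:
  assumes "a \<in> seqs n" "n \<le> m"
  shows "partial_alt a m = partial_alt a n"
  using assms(2)
  by (induction m rule: dec_induct) (use assms(1) in \<open>auto simp: seqsD\<close>)

text \<open>Only the factors \<open>j\<close> to \<open>j + 2\<close> change. For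
  \<open>j = 0\<close> a common right factor cancels; otherwise \<open>swap_quotient\<close>
  applies, the parity of \<open>i\<close> deciding which of the factors are inverted.\<close>

lemma partial_alt_step_at:
  assumes a: "a \<in> seqs n" and st: "step_at j a b" and k: "j + 2 \<le> k"
  shows "partial_alt a k = partial_alt b k"
proof -
  obtain x x' e d where x: "x \<in> carrier G" "x' \<in> carrier G" "e \<in> carrier G" "d \<in> carrier G" "x \<noteq> \<one>"
      "a (j + 2) = mul (odd j) x d" "mul (odd j) (a (j + 1)) x' = mul (odd j) x e"
      "j = 0 \<longrightarrow> x' = \<one>" "b = a(j := mul (odd j) (a j) x', j + 1 := e, j + 2 := d)"
    using st by (rule step_atE)
  note C = seq_closed[OF a]
  have base: "partial_alt a (j + 2) = partial_alt b (j + 2)"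
  proof (cases j)
    case 0
    then have "a 1 = e \<otimes> x" "a 2 = d \<otimes> x" "b 1 = e" "b 2 = d"
      using x C[of 1] by (auto simp: mul_def numeral_2_eq_2)
    then show ?thesis
      using x(1-4) by (simp add: 0 numeral_2_eq_2 iota_mult E.mult_inv_mult_cancel)
  next
    case (Suc i)
    have ix: "i + 2 = Suc (Suc i)" "i + 3 = Suc (Suc (Suc i))" "j + 1 = Suc (Suc i)" "j + 2 = Suc (Suc (Suc i))"
      using Suc by simp_all
    have b: "b (i + 1) = mul (even i) (a (i + 1)) x'" "b (i + 2) = e" "b (i + 3) = d"
      using x(9) Suc by (auto simp: ix)
    have p: "partial_alt b i = partial_alt a i" using x(9) Suc by (intro partial_alt_cong) auto
    have a': "a (i + 3) = mul (even i) x d" "mul (even i) (a (i + 2)) x' = mul (even i) x e"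
      using x(6,7) Suc by (auto simp: ix)
    have pc: "partial_alt a i \<in> carrier E" using a by simp
    have C': "\<iota> (a k) \<in> carrier E" for k using C by simp
    have xc: "\<iota> x \<in> carrier E" "\<iota> x' \<in> carrier E" "\<iota> e \<in> carrier E" "\<iota> d \<in> carrier E" using x by auto
    have "partial_alt a (i + 3) = partial_alt b (i + 3)"
    proof (cases "even i")
      case True
      have "\<iota> (a (i + 2)) \<otimes>\<^bsub>E\<^esub> \<iota> x' = \<iota> x \<otimes>\<^bsub>E\<^esub> \<iota> e"
        using a'(2) True x C by (simp add: mul_def flip: iota_mult)
      from E.swap_quotient[OF C' xc(2,1,3) this] xc C'
      have "inv\<^bsub>E\<^esub> \<iota> (a (i + 2)) \<otimes>\<^bsub>E\<^esub> (\<iota> x \<otimes>\<^bsub>E\<^esub> \<iota> d) = \<iota> x' \<otimes>\<^bsub>E\<^esub> (inv\<^bsub>E\<^esub> \<iota> e \<otimes>\<^bsub>E\<^esub> \<iota> d)"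
        by (simp flip: E.m_assoc)
      then show ?thesis using True b a' p x pc C C'
        by (simp add: mul_def ix iota_mult E.m_assoc)
    next
      case False
      have "\<iota> x' \<otimes>\<^bsub>E\<^esub> \<iota> (a (i + 2)) = \<iota> e \<otimes>\<^bsub>E\<^esub> \<iota> x"
        using a'(2) False x C by (simp add: mul_def flip: iota_mult)
      from E.swap_quotient[OF xc(2) C' xc(3,1) this] xc C'
      have "\<iota> (a (i + 2)) \<otimes>\<^bsub>E\<^esub> (inv\<^bsub>E\<^esub> \<iota> x \<otimes>\<^bsub>E\<^esub> inv\<^bsub>E\<^esub> \<iota> d) = inv\<^bsub>E\<^esub> \<iota> x' \<otimes>\<^bsub>E\<^esub> (\<iota> e \<otimes>\<^bsub>E\<^esub> inv\<^bsub>E\<^esub> \<iota> d)"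
        by (simp flip: E.m_assoc)
      then show ?thesis using False b a' p x pc C C'
        by (simp add: mul_def ix iota_mult E.m_assoc E.inv_mult_group)
    qed
    then show ?thesis by (simp add: Suc ix)
  qed
  show ?thesis using k
  proof (induction k rule: dec_induct)
    case base
    show ?case by (fact \<open>partial_alt a (j + 2) = partial_alt b (j + 2)\<close>)
  next
    case (step k)
    then have "b (Suc k) = a (Suc k)" using x(9) by simp
    then show ?case using step by simp
  qed
qed

lemma partial_alt_steps:
  assumes "a \<in> seqs n" "a \<rightarrow>* b"
  shows "partial_alt a n = partial_alt b n"
  using assms(2)
proof induction
  case (step b c)
  then have b: "b \<in> seqs n" using assms(1) steps_seqs by blast
  obtain j where j: "step_at j b c" using step(2) by (auto simp: step_def)
  show ?case using partial_alt_step_at[OF b j step_at_bound[OF j b]] step.IH by simp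
qed simp

lemma alt_snoc:
  assumes "set as \<subseteq> carrier G" "x \<in> carrier G"
  shows "alt s (as @ [x]) = alt s as \<otimes>\<^bsub>E\<^esub> (if s = even (length as) then \<iota> x else inv\<^bsub>E\<^esub> \<iota> x)"
  using assms by (induction as arbitrary: s) (auto simp: E.m_assoc)

lemma partial_alt_seq_of:
  "set as \<subseteq> carrier G \<Longrightarrow> partial_alt (seq_of as) (length as) = alt True as"
proof (induction as rule: rev_induct)
  case (snoc x as)
  have "partial_alt (seq_of (as @ [x])) (length as) = partial_alt (seq_of as) (length as)"
    by (rule partial_alt_cong) (auto simp: seq_of_def nth_append)
  moreover have "seq_of (as @ [x]) (Suc (length as)) = x" by (simp add: seq_of_def)
  ultimately show ?case using snoc by (simp add: alt_snoc)
qed simp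

section \<open>Irreducible sequences and reduced multifractions\<close>

definition compat :: "nat \<Rightarrow> 'a \<Rightarrow> 'a \<Rightarrow> bool" where
  "compat j x u \<longleftrightarrow> (if j = 0 then dv False x u else cm (odd j) x u)"

definition reduced_pair :: "nat \<Rightarrow> 'a \<Rightarrow> 'a \<Rightarrow> bool" where
  "reduced_pair j u v \<longleftrightarrow> (\<forall>x\<in>carrier G. x \<noteq> \<one> \<and> dv (odd j) x v \<longrightarrow> \<not> compat j x u)"

lemma reduced_pair_one [simp]: "reduced_pair j u \<one>"
  by (auto simp: reduced_pair_def)

text \<open>As \<open>step_at\<close> accepts any common multiple, a nontrivial divisor of entry
  \<open>j + 2\<close> that is compatible with entry \<open>j + 1\<close> already yields a step, so
  irreducibility is a condition on adjacent pairs. At level 0, where nothing can be pushed down,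
  compatibility is divisibility.\<close>

lemma irreducible_seq_iff:
  assumes "a \<in> seqs n"
  shows "irreducible_seq a \<longleftrightarrow> (\<forall>j. reduced_pair j (a (j + 1)) (a (j + 2)))"
proof -
  note C = seq_closed[OF assms]
  have "(\<exists>b. step_at j a b) \<longleftrightarrow> \<not> reduced_pair j (a (j + 1)) (a (j + 2))" for j
  proof
    assume "\<exists>b. step_at j a b"
    then obtain b where "step_at j a b" ..
    then obtain x x' e d where x: "x \<in> carrier G" "x' \<in> carrier G" "e \<in> carrier G" "d \<in> carrier G" "x \<noteq> \<one>"
      "a (j + 2) = mul (odd j) x d" "mul (odd j) (a (j + 1)) x' = mul (odd j) x e"
      "j = 0 \<longrightarrow> x' = \<one>" "b = a(j := mul (odd j) (a j) x', j + 1 := e, j + 2 := d)"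
      by (rule step_atE)
    have "dv (odd j) x (a (j + 2))" by (rule dvI[OF x(4,6)])
    moreover have "compat j x (a (j + 1))"
    proof (cases "j = 0")
      case True
      then show ?thesis using x C[of "j + 1"] by (auto simp: compat_def intro: dvI[of e])
    next
      case False
      have "dv (odd j) x (mul (odd j) x e)" "dv (odd j) (a (j + 1)) (mul (odd j) x e)"
        using x(1,3) dvI[OF x(2) x(7)[symmetric]] by simp_all
      then show ?thesis using False mul_closed[OF x(1,3)] unfolding compat_def cm_def by auto
    qed
    ultimately show "\<not> reduced_pair j (a (j + 1)) (a (j + 2))"
      using x unfolding reduced_pair_def by blast
  next
    assume "\<not> reduced_pair j (a (j + 1)) (a (j + 2))"
    then obtain x where x: "x \<in> carrier G" "x \<noteq> \<one>" "dv (odd j) x (a (j + 2))" "compat j x (a (j + 1))"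
      by (auto simp: reduced_pair_def)
    obtain d where d: "d \<in> carrier G" "a (j + 2) = mul (odd j) x d" using x(3) by (rule dvE)
    have "\<exists>x'\<in>carrier G. \<exists>e\<in>carrier G. mul (odd j) (a (j + 1)) x' = mul (odd j) x e \<and> (j = 0 \<longrightarrow> x' = \<one>)"
    proof (cases "j = 0")
      case True
      then obtain e where "e \<in> carrier G" "a 1 = mul False x e"
        using x(4) by (auto simp: compat_def elim: dvE)
      then show ?thesis using True x by (intro bexI[of _ \<one>] bexI[of _ e]) auto
    next
      case False
      then have "cm (odd j) x (a (j + 1))" using x(4) by (simp add: compat_def)
      then show ?thesis unfolding cm_def using False by (metis dvE neq0_conv)
    qed
    then show "\<exists>b. step_at j a b" unfolding step_at_def using x d by blast
  qed
  then show ?thesis unfolding irreducible_seq_def step_def by blast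
qed

lemma irreducible_seq_of_iff:
  assumes "set as \<subseteq> carrier G"
  shows "irreducible_seq (seq_of as) \<longleftrightarrow>
    (\<forall>j. Suc j < length as \<longrightarrow> reduced_pair j (as ! j) (as ! Suc j))"
proof -
  have "reduced_pair j (seq_of as (j + 1)) (seq_of as (j + 2)) \<longleftrightarrow>
      (Suc j < length as \<longrightarrow> reduced_pair j (as ! j) (as ! Suc j))" for j
    by (auto simp: seq_of_def)
  then show ?thesis using irreducible_seq_iff[OF seq_of_seqs[OF assms]] by simp
qed

lemma is_right_gcd_one_iff:
  assumes "a \<in> carrier G" "b \<in> carrier G"
  shows "is_right_gcd G \<one> a b \<longleftrightarrow> reduced_pair 0 a b"
  using assms dv_one_iff[of _ False]
  by (auto simp: is_right_gcd_def reduced_pair_def compat_def dv_False simp del: dv_one_iff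
      intro: dv_one[of _ False, unfolded dv_False])

lemma reduced_multifraction_iff:
  "reduced_multifraction G as \<longleftrightarrow>
     set as \<subseteq> carrier G \<and> (as \<noteq> [] \<longrightarrow> last as \<noteq> \<one>) \<and> irreducible_seq (seq_of as)"
proof (cases "set as \<subseteq> carrier G")
  case True
  \<comment> \<open>The index \<open>i\<close> of \<open>reduced_multifraction\<close> is level
    \<open>i - 1\<close>: even \<open>i\<close> are the odd levels, odd \<open>i\<close> from 3 on
    the even nonzero levels, and level 0 is the gcd condition.\<close>
  have split: "(\<forall>j. P j) \<longleftrightarrow> P 0 \<and> (\<forall>i. even i \<and> 2 \<le> i \<longrightarrow> P (i - 1)) \<and> (\<forall>i. odd i \<and> 3 \<le> i \<longrightarrow> P (i - 1))"
    for P :: "nat \<Rightarrow> bool"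
  proof (intro iffI allI)
    fix j
    assume *: "P 0 \<and> (\<forall>i. even i \<and> 2 \<le> i \<longrightarrow> P (i - 1)) \<and> (\<forall>i. odd i \<and> 3 \<le> i \<longrightarrow> P (i - 1))"
    have "j = 0 \<or> even (Suc j) \<and> 2 \<le> Suc j \<or> odd (Suc j) \<and> 3 \<le> Suc j" by presburger
    then show "P j" using * by (metis diff_Suc_1)
  qed blast
  define P where "P j \<longleftrightarrow> (Suc j < length as \<longrightarrow> reduced_pair j (as ! j) (as ! Suc j))" for j
  have P0: "P 0 \<longleftrightarrow> (length as \<ge> 2 \<longrightarrow> is_right_gcd G \<one> (as ! 0) (as ! 1))"
  proof (cases "length as \<ge> 2")
    case len: True
    then have "as ! 0 \<in> carrier G" "as ! 1 \<in> carrier G" by (auto intro!: subsetD[OF True] nth_mem)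
    then show ?thesis using len by (simp add: P_def is_right_gcd_one_iff)
  qed (simp add: P_def)
  have P1: "P (i - 1) \<longleftrightarrow> (i < length as \<longrightarrow>
      (\<forall>x\<in>carrier G. x \<noteq> \<one> \<and> x divides (as ! i) \<longrightarrow> \<not> common_right_multiple G {x, as ! (i - 1)}))"
    if i: "even i" "2 \<le> i" for i
  proof -
    obtain j where "i = Suc j" "odd j" "j \<noteq> 0" using i by (cases i) auto
    then show ?thesis
      by (simp add: P_def reduced_pair_def compat_def flip: dv_True cm_True)
  qed
  have P2: "P (i - 1) \<longleftrightarrow> (i < length as \<longrightarrow>
      (\<forall>x\<in>carrier G. x \<noteq> \<one> \<and> right_divides G x (as ! i) \<longrightarrow> \<not> common_left_multiple G {x, as ! (i - 1)}))"
    if i: "odd i" "3 \<le> i" for i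
  proof -
    obtain j where "i = Suc j" "even j" "j \<noteq> 0" using i by (cases i) auto
    then show ?thesis
      by (simp add: P_def reduced_pair_def compat_def flip: dv_False cm_False)
  qed
  have "irreducible_seq (seq_of as) \<longleftrightarrow> (\<forall>j. P j)"
    unfolding irreducible_seq_of_iff[OF True] P_def ..
  also note split[of P]
  finally show ?thesis
    using P0 P1 P2 True by (simp add: reduced_multifraction_def Suc_le_eq) blast
next
  case False
  then show ?thesis by (auto simp: reduced_multifraction_def)
qed

text \<open>Padding with ones forgets only trailing ones, and a nontrivial last entry excludes
  them.\<close>

lemma seq_of_inj:
  assumes eq: "seq_of as = seq_of bs" and "as \<noteq> [] \<longrightarrow> last as \<noteq> \<one>" "bs \<noteq> [] \<longrightarrow> last bs \<noteq> \<one>"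
  shows "as = bs"
proof (rule nth_equalityI)
  have "length as \<le> length bs" if "seq_of as = seq_of bs" "as \<noteq> [] \<longrightarrow> last as \<noteq> \<one>" for as bs
  proof (rule ccontr)
    assume "\<not> length as \<le> length bs"
    then have "seq_of as (length as) = last as" "seq_of bs (length as) = \<one>" "as \<noteq> []"
      by (auto simp: seq_of_def last_conv_nth)
    then show False using that by simp
  qed
  then show len: "length as = length bs" using assms by (metis order_antisym)
  fix i assume "i < length as"
  then show "as ! i = bs ! i" using fun_cong[OF eq, of "Suc i"] len by (simp add: seq_of_def)
qed

section \<open>Uniqueness, embedding and existence\<close>

lemma reduced_multifraction_unique:
  assumes "reduced_multifraction G as" "reduced_multifraction G bs" "alt True as = alt True bs"
  shows "as = bs"
proof (rule seq_of_inj)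
  show "seq_of as = seq_of bs"
    using alt_prod_eq_imp_nf_eq[of as bs] assms by (simp add: reduced_multifraction_iff nf_id)
qed (use assms in \<open>auto simp: reduced_multifraction_iff\<close>)

lemma inj_iota: "inj_on \<iota> (carrier G)"
proof (rule inj_onI)
  fix a b assume ab: "a \<in> carrier G" "b \<in> carrier G" "\<iota> a = \<iota> b"
  have "reduced_multifraction G (if c = \<one> then [] else [c])" if "c \<in> carrier G" for c
    using that by (simp add: reduced_multifraction_def)
  moreover have "alt True (if c = \<one> then [] else [c]) = \<iota> c" if "c \<in> carrier G" for c
    using that by auto
  ultimately have "(if a = \<one> then [] else [a]) = (if b = \<one> then [] else [b])"
    using ab by (intro reduced_multifraction_unique) auto
  then show "a = b" by (auto split: if_splits)
qed

text \<open>By induction on a word over the letters of the envelope: a positive letter is multiplied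
  into the first entry, a negative one is put in front as \<open>1/a\<close>, which keeps the signs
  alternating.\<close>

lemma envelope_alt_prod:
  assumes "g \<in> carrier E"
  obtains as where "set as \<subseteq> carrier G" "g = alt True as"
proof -
  let ?C = "word_cong (carrier G \<times> (UNIV :: bool set)) (envelope_rels G)"
  obtain u where u: "u \<in> lists (carrier G \<times> UNIV)" and g: "g = ?C `` {u}"
    using assms unfolding envelope_def by (rule presented_monoid_carrierE)
  from u have "\<exists>as. set as \<subseteq> carrier G \<and> ?C `` {u} = alt True as"
  proof induction
    case Nil
    show ?case by (rule exI[of _ "[]"]) (simp add: envelope_def presented_monoid_one)
  next
    case (Cons l u)
    obtain a s where l: "l = (a, s)" "a \<in> carrier G" using Cons.hyps by auto
    obtain as where as: "set as \<subseteq> carrier G" "?C `` {u} = alt True as" using Cons.IH by blast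
    have app: "?C `` {l # u} = ?C `` {[l]} \<otimes>\<^bsub>E\<^esub> alt True as"
      using presented_monoid_mult[of "[l]" "carrier G \<times> (UNIV :: bool set)" u "envelope_rels G"]
        Cons.hyps as by (simp add: envelope_def)
    show ?case
    proof (cases s)
      case True
      have "?C `` {[l]} = \<iota> a" using True l by (simp add: envelope_map_def)
      then have "?C `` {l # u} = alt True (case as of [] \<Rightarrow> [a] | b # bs \<Rightarrow> a \<otimes> b # bs)"
        using app l as by (auto simp: iota_mult E.m_assoc split: list.split)
      moreover have "set (case as of [] \<Rightarrow> [a] | b # bs \<Rightarrow> a \<otimes> b # bs) \<subseteq> carrier G"
        using l as by (auto split: list.split)
      ultimately show ?thesis by blast
    next
      case False
      have "([(a, False), (a, True)], []) \<in> ?C"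
        using l by (intro word_cong.base) (force simp: envelope_rels_def)+
      then have "?C `` {[(a, False)]} \<otimes>\<^bsub>E\<^esub> \<iota> a = \<one>\<^bsub>E\<^esub>"
        using l by (simp add: envelope_map_def envelope_def presented_monoid_mult
            presented_monoid_one equiv_class_eq[OF equiv_word_cong])
      then have "?C `` {[l]} = inv\<^bsub>E\<^esub> \<iota> a"
        using l False presented_monoid_carrierI[of "[(a, False)]" "carrier G \<times> (UNIV :: bool set)" "envelope_rels G"]
        by (intro E.inv_equality[symmetric]) (auto simp flip: envelope_def)
      then have "?C `` {l # u} = alt True (\<one> # a # as)" using app l as by simp
      then show ?thesis using l as by (intro exI[of _ "\<one> # a # as"]) auto
    qed
  qed
  then show thesis using that g by blast
qed

lemma reduced_multifraction_exists:
  assumes "g \<in> carrier E"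
  obtains as where "reduced_multifraction G as" "g = alt True as"
proof -
  obtain as where as: "set as \<subseteq> carrier G" "g = alt True as" using assms by (rule envelope_alt_prod)
  define n where "n = length as"
  define c where "c = nf (seq_of as)"
  have st: "seq_of as \<rightarrow>* c" and ir: "irreducible_seq c" using as nf_props by (auto simp: c_def)
  have c: "c \<in> seqs n" using steps_seqs[OF st] seq_of_seqs as by (simp add: n_def)
  \<comment> \<open>The least bound on the support of \<open>c\<close> strips the trailing
    ones.\<close>
  define m where "m = (LEAST m. c \<in> seqs m)"
  have m: "c \<in> seqs m" "m \<le> n" unfolding m_def using c by (auto intro: LeastI Least_le)
  define bs where "bs = map c [1..<Suc m]"
  have bs: "seq_of bs = c" "set bs \<subseteq> carrier G" "length bs = m"
    using m by (auto simp: bs_def seq_of_def fun_eq_iff seqsD simp del: upt_Suc)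
  have "last bs \<noteq> \<one>" if ne: "bs \<noteq> []"
  proof
    assume l: "last bs = \<one>"
    obtain k where k: "m = Suc k" using ne bs(3) by (cases m) auto
    have "c m = \<one>" using l k by (simp add: bs_def)
    then have "c \<in> seqs k" using m(1) k by (auto simp: seqs_def) (metis Suc_lessI)
    then have "m \<le> k" unfolding m_def by (rule Least_le)
    then show False using k by simp
  qed
  then have "reduced_multifraction G bs" using bs ir by (simp add: reduced_multifraction_iff)
  moreover have "g = alt True bs"
  proof -
    have "g = partial_alt (seq_of as) n" using as by (simp add: partial_alt_seq_of n_def)
    also have "\<dots> = partial_alt c n" using as seq_of_seqs by (intro partial_alt_steps st) (simp add: n_def)
    also have "\<dots> = partial_alt c m" using m by (rule partial_alt_tail)
    also have "\<dots> = alt True bs" using partial_alt_seq_of[OF bs(2)] bs by simp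
    finally show ?thesis .
  qed
  ultimately show thesis by (rule that)
qed

end

context ore_gcd_monoid
begin

section \<open>Atoms and residues\<close>

lemma atom_closed: "p \<in> atoms G \<Longrightarrow> p \<in> carrier G"
  by (simp add: atoms_def)

lemma atom_not_one: "p \<in> atoms G \<Longrightarrow> p \<noteq> \<one>"
  by (auto simp: atoms_def)

lemma atom_dv:
  assumes "v \<in> carrier G" "v \<noteq> \<one>"
  shows "\<exists>p\<in>atoms G. dv s p v"
  using assms
proof (induction v rule: wf_induct_rule[OF wf_proper[of "\<not> s"]])
  case (1 v)
  show ?case
  proof (cases "v \<in> atoms G")
    case True
    then show ?thesis using 1 by (intro bexI[of _ v]) auto
  next
    case False
    then obtain x y where "x \<in> carrier G" "y \<in> carrier G" "x \<noteq> \<one>" "y \<noteq> \<one>" "v = x \<otimes> y"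
      using 1 by (auto simp: atoms_def Units_trivial)
    then obtain u w where uw: "u \<in> carrier G" "w \<in> carrier G" "u \<noteq> \<one>" "w \<noteq> \<one>" "v = mul s u w"
      unfolding mul_def by (cases s) auto
    then have "(u, v) \<in> proper (\<not> s)" using 1 by (auto simp: proper_def mul_Not)
    then obtain p where p: "p \<in> atoms G" "dv s p u" using 1 uw by blast
    have "dv s u v" by (rule dvI[OF uw(2,5)])
    then show ?thesis using p atom_closed dv_trans by blast
  qed
qed

text \<open>Atoms are multiplied on the left for \<open>s = True\<close> and on the right for
  \<open>s = False\<close>. Words are read from left to right, so both versions occur.\<close>

lemma atom_induct [consumes 1, case_names one mult]:
  assumes "v \<in> carrier G" and one: "P \<one>"
    and mult: "\<And>p a. p \<in> atoms G \<Longrightarrow> a \<in> carrier G \<Longrightarrow> P a \<Longrightarrow> P (mul s p a)"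
  shows "P v"
  using assms(1)
proof (induction v rule: wf_induct_rule[OF wf_proper[of s]])
  case (1 v)
  show ?case
  proof (cases "v = \<one>")
    case False
    then obtain p where p: "p \<in> atoms G" "dv s p v" using atom_dv 1 by blast
    then obtain c where c: "c \<in> carrier G" "v = mul s p c" by (auto elim: dvE)
    then have "(c, v) \<in> proper s" using 1 p atom_closed atom_not_one by (auto simp: proper_def)
    then have "P c" using 1 c by blast
    then show ?thesis using mult[OF p(1) c(1)] c by simp
  qed (simp add: one)
qed

lemma dv_antisym:
  assumes "a \<in> carrier G" "dv s a b" "dv s b a"
  shows "a = b"
proof -
  obtain x where x: "x \<in> carrier G" "b = mul s a x" using assms(2) by (rule dvE)
  obtain y where y: "y \<in> carrier G" "a = mul s b y" using assms(3) by (rule dvE)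
  have "mul s a (mul s x y) = a" using assms(1) x y by (metis mul_assoc)
  then have "mul s x y = \<one>"
    using mul_cancel_one[OF assms(1) mul_closed[OF x(1) y(1)]] by blast
  then have "x = \<one>" using mul_eq_one[OF x(1) y(1)] by blast
  then show ?thesis unfolding x(2) using assms(1) by simp
qed

lemma is_lcm_one: "x \<in> carrier G \<Longrightarrow> z \<in> carrier G \<Longrightarrow> is_lcm s x \<one> z \<longleftrightarrow> z = x"
  using dv_antisym[of x s z] by (auto simp: is_lcm_def)

lemma is_lcm_sym: "is_lcm s x y z \<longleftrightarrow> is_lcm s y x z"
  by (auto simp: is_lcm_def)

lemma is_lcm_self: "x \<in> carrier G \<Longrightarrow> a \<in> carrier G \<Longrightarrow> is_lcm s x a a \<longleftrightarrow> dv s x a"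
  by (auto simp: is_lcm_def)

text \<open>Lcm squares can be glued: complete \<open>x\<close> across \<open>a\<close>, which
  leaves \<open>y\<close>, then \<open>y\<close> across \<open>b\<close>. Conversely, an lcm of
  \<open>x\<close> and \<open>a b\<close> is a common multiple of \<open>x\<close> and
  \<open>a\<close>, so it passes through their lcm \<open>a y\<close>, and cancelling
  \<open>a\<close> leaves the lcm of \<open>y\<close> and \<open>b\<close>.\<close>

lemma is_lcm_mul:
  assumes C: "x \<in> carrier G" "a \<in> carrier G" "b \<in> carrier G" "z \<in> carrier G"
  shows "is_lcm s x (mul s a b) (mul s (mul s a b) z) \<longleftrightarrow>
    (\<exists>y\<in>carrier G. is_lcm s x a (mul s a y) \<and> is_lcm s y b (mul s b z))"
proof
  assume l: "is_lcm s x (mul s a b) (mul s (mul s a b) z)"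
  have m: "mul s (mul s a b) z = mul s a (mul s b z)" using C by (simp add: mul_assoc)
  have xd: "dv s x (mul s a (mul s b z))" using l m by (simp add: is_lcm_def)
  then have "cm s x a" using C by (auto simp: cm_def)
  then obtain c where c: "c \<in> carrier G" "is_lcm s x a c" using lcm_exists C by metis
  then obtain y where y: "y \<in> carrier G" "c = mul s a y" by (auto simp: is_lcm_def elim: dvE)
  have "dv s c (mul s a (mul s b z))" using c C xd by (auto simp: is_lcm_def)
  then have yd: "dv s y (mul s b z)" using y C by simp
  have "dv s (mul s b z) v" if v: "v \<in> carrier G" "dv s y v" "dv s b v" for v
  proof -
    have "dv s x c" using c by (simp add: is_lcm_def)
    moreover have "dv s c (mul s a v)" "dv s (mul s a b) (mul s a v)" using v y C by simp_all
    ultimately have "dv s (mul s (mul s a b) z) (mul s a v)"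
      using l v C dv_trans[OF C(1)] by (auto simp: is_lcm_def)
    then show ?thesis using m v C by simp
  qed
  then have "is_lcm s y b (mul s b z)" using yd C by (simp add: is_lcm_def)
  then show "\<exists>y\<in>carrier G. is_lcm s x a (mul s a y) \<and> is_lcm s y b (mul s b z)"
    using y c by auto
next
  assume "\<exists>y\<in>carrier G. is_lcm s x a (mul s a y) \<and> is_lcm s y b (mul s b z)"
  then obtain y where y: "y \<in> carrier G" "is_lcm s x a (mul s a y)" "is_lcm s y b (mul s b z)" by blast
  have m: "mul s (mul s a b) z = mul s a (mul s b z)" using C by (simp add: mul_assoc)
  have "dv s x (mul s a y)" "dv s (mul s a y) (mul s a (mul s b z))"
    using y C by (simp_all add: is_lcm_def)
  then have "dv s x (mul s a (mul s b z))" using dv_trans C by blast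
  moreover have "dv s (mul s a (mul s b z)) w" if w: "w \<in> carrier G" "dv s x w" "dv s (mul s a b) w" for w
  proof -
    obtain w' where w': "w' \<in> carrier G" "w = mul s (mul s a b) w'" using w(3) by (rule dvE)
    have ww: "w = mul s a (mul s b w')" using w' C by (simp add: mul_assoc)
    have "dv s (mul s a y) w" using y(2) w C ww w' by (simp add: is_lcm_def)
    then have "dv s y (mul s b w')" using ww y(1) C w' by simp
    moreover have "\<forall>v\<in>carrier G. dv s y v \<and> dv s b v \<longrightarrow> dv s (mul s b z) v"
      using y(3) unfolding is_lcm_def by blast
    ultimately have "dv s (mul s b z) (mul s b w')" using C w' dv_mul mul_closed by blast
    then show ?thesis using ww C w' by simp
  qed
  ultimately show "is_lcm s x (mul s a b) (mul s (mul s a b) z)"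
    unfolding m using C by (auto simp: is_lcm_def mul_assoc)
qed

text \<open>The unit is adjoined because a residue equal to \<open>\<one>\<close> is what signals
  divisibility; closure under residues persists by \<open>bas_residue\<close>.\<close>

definition bas :: "bool \<Rightarrow> 'a set" where
  "bas s = insert \<one> (if s then right_basic G else left_basic G)"

lemma right_basic_closed: "a \<in> right_basic G \<Longrightarrow> a \<in> carrier G"
  by (induction rule: right_basic.induct) (auto simp: atom_closed)

lemma left_basic_closed: "a \<in> left_basic G \<Longrightarrow> a \<in> carrier G"
  by (induction rule: left_basic.induct) (auto simp: atom_closed)

lemma bas_closed [simp]: "x \<in> bas s \<Longrightarrow> x \<in> carrier G"
  by (auto simp: bas_def right_basic_closed left_basic_closed split: if_splits)

lemma atom_bas: "p \<in> atoms G \<Longrightarrow> p \<in> bas s"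
  by (auto simp: bas_def intro: right_basic.atom left_basic.atom)

lemma bas_residue:
  assumes x: "x \<in> bas s" and y: "y \<in> bas s" and z: "z \<in> carrier G" and l: "is_lcm s x y (mul s y z)"
  shows "z \<in> bas s"
proof -
  consider "x = \<one>" | "y = \<one>" | "x \<noteq> \<one>" "y \<noteq> \<one>" by blast
  then show ?thesis
  proof cases
    case 1
    then have "mul s y z = y" using l y z is_lcm_one[of y "mul s y z" s] by (simp add: is_lcm_sym)
    then show ?thesis using y z by (simp add: bas_def)
  next
    case 2
    then show ?thesis using l x z is_lcm_one[of x z s] by simp
  next
    case 3
    have c: "mul s y z \<in> carrier G" using y z by simp
    show ?thesis
    proof (cases s)
      case True
      then have "x \<in> right_basic G" "y \<in> right_basic G" using x y 3 by (auto simp: bas_def)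
      moreover have "(y \<otimes> z) lcmof x y" using l True by (simp add: is_lcm_def islcm_def dv_True mul_def)
      ultimately show ?thesis
        using right_basic.residue[of x G y "y \<otimes> z" z] c z True by (simp add: bas_def mul_def)
    next
      case False
      then have "x \<in> left_basic G" "y \<in> left_basic G" using x y 3 by (auto simp: bas_def)
      moreover have "is_left_lcm G (z \<otimes> y) x y" using l False by (simp add: is_lcm_def is_left_lcm_def dv_False mul_def)
      ultimately show ?thesis
        using left_basic.residue[of x G y "z \<otimes> y" z] c z False by (simp add: bas_def mul_def)
    qed
  qed
qed

text \<open>The graph of a partial map on basic elements, undefined where there is no common
  multiple with \<open>a\<close>. As a relation it composes by \<open>O\<close>.\<close>

definition residues :: "bool \<Rightarrow> 'a \<Rightarrow> ('a \<times> 'a) set" where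
  "residues s a = {(x, z). x \<in> bas s \<and> z \<in> carrier G \<and> is_lcm s x a (mul s a z)}"

text \<open>By definition the residue of a basic element by an atom is basic. Writing
  \<open>a\<close> as a product of atoms and gluing extends this to all \<open>a\<close>.\<close>

lemma residues_range:
  assumes "a \<in> carrier G" "(x, z) \<in> residues s a"
  shows "z \<in> bas s"
  using assms
proof (induction a arbitrary: x z rule: atom_induct[where s = s])
  case one
  then show ?case using is_lcm_one[of x z s] by (auto simp: residues_def)
next
  case (mult p a)
  have p: "p \<in> carrier G" by (rule atom_closed) fact
  obtain y where y: "y \<in> carrier G" "is_lcm s x p (mul s p y)" "is_lcm s y a (mul s a z)"
    using mult.prems is_lcm_mul[of x p a z s] p mult.hyps by (auto simp: residues_def)
  have xz: "x \<in> bas s" "z \<in> carrier G" using mult.prems by (auto simp: residues_def)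
  have "y \<in> bas s" by (rule bas_residue[OF xz(1) atom_bas[OF mult.hyps(1)] y(1,2)])
  then have "(y, z) \<in> residues s a" using y(3) xz(2) by (simp add: residues_def)
  then show ?case by (rule mult.IH)
qed

lemma residues_mul:
  assumes "a \<in> carrier G" "b \<in> carrier G"
  shows "residues s (mul s a b) = residues s a O residues s b"
proof -
  have "(x, z) \<in> residues s (mul s a b) \<longleftrightarrow> (\<exists>y. (x, y) \<in> residues s a \<and> (y, z) \<in> residues s b)" for x z
  proof
    assume "(x, z) \<in> residues s (mul s a b)"
    then have xz: "x \<in> bas s" "z \<in> carrier G" "is_lcm s x (mul s a b) (mul s (mul s a b) z)"
      by (simp_all add: residues_def)
    then obtain y where y: "y \<in> carrier G" "is_lcm s x a (mul s a y)" "is_lcm s y b (mul s b z)"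
      using is_lcm_mul[OF bas_closed assms] by blast
    then have xy: "(x, y) \<in> residues s a" using xz by (simp add: residues_def)
    then have "y \<in> bas s" by (rule residues_range[OF assms(1)])
    then have "(y, z) \<in> residues s b" using y xz by (simp add: residues_def)
    then show "\<exists>y. (x, y) \<in> residues s a \<and> (y, z) \<in> residues s b" using xy by blast
  next
    assume "\<exists>y. (x, y) \<in> residues s a \<and> (y, z) \<in> residues s b"
    then obtain y where y: "x \<in> bas s" "z \<in> carrier G" "y \<in> carrier G"
        "is_lcm s x a (mul s a y)" "is_lcm s y b (mul s b z)"
      by (auto simp: residues_def)
    then have "is_lcm s x (mul s a b) (mul s (mul s a b) z)"
      using is_lcm_mul[OF bas_closed[OF y(1)] assms y(2)] by blast
    then show "(x, z) \<in> residues s (mul s a b)" using y by (simp add: residues_def)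
  qed
  then show ?thesis by auto
qed

lemma residues_subset:
  assumes "a \<in> carrier G"
  shows "residues s a \<subseteq> bas s \<times> bas s"
proof (rule subrelI)
  fix x z assume xz: "(x, z) \<in> residues s a"
  then have "x \<in> bas s" by (simp add: residues_def)
  then show "(x, z) \<in> bas s \<times> bas s" using residues_range[OF assms xz] by simp
qed

lemma dv_iff_residues: "x \<in> bas s \<Longrightarrow> a \<in> carrier G \<Longrightarrow> dv s x a \<longleftrightarrow> (x, \<one>) \<in> residues s a"
  by (simp add: residues_def is_lcm_self)

lemma cm_iff_residues:
  assumes "x \<in> bas s" "a \<in> carrier G"
  shows "cm s x a \<longleftrightarrow> x \<in> Domain (residues s a)"
proof
  assume "cm s x a"
  then obtain l where l: "l \<in> carrier G" "is_lcm s x a l" using assms by (metis lcm_exists bas_closed)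
  then obtain z where "z \<in> carrier G" "l = mul s a z" by (auto simp: is_lcm_def elim: dvE)
  then show "x \<in> Domain (residues s a)" using l assms by (auto simp: residues_def)
next
  assume "x \<in> Domain (residues s a)"
  then obtain z where "z \<in> carrier G" "is_lcm s x a (mul s a z)" by (auto simp: residues_def)
  then show "cm s x a" using assms mul_closed unfolding cm_def is_lcm_def by blast
qed

text \<open>Consecutive levels look from opposite sides: an entry is divided at one level and is the
  middle entry of the next. Hence both sides are recorded.\<close>

definition profile :: "'a \<Rightarrow> ('a \<times> 'a) set \<times> ('a \<times> 'a) set" where
  "profile a = (residues True a, residues False a)"

lemma residues_eq: "profile a = profile b \<Longrightarrow> residues s a = residues s b"
  by (cases s) (auto simp: profile_def)

lemma profile_mul:
  assumes "a \<in> carrier G" "b \<in> carrier G" "x \<in> carrier G" "profile a = profile b"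
  shows "profile (mul t a x) = profile (mul t b x)"
proof -
  have "residues s (mul t a x) = residues s (mul t b x)" for s
  proof (cases "s = t")
    case True
    then show ?thesis using assms by (simp add: residues_mul residues_eq[OF assms(4)])
  next
    case False
    then have "mul t y x = mul s x y" for y by (auto simp: mul_def)
    then show ?thesis using assms by (simp add: residues_mul residues_eq[OF assms(4)])
  qed
  then show ?thesis by (simp add: profile_def)
qed

text \<open>A nontrivial divisor has an atom dividing it on the same side, and
  \<open>compat j\<close> is inherited by divisors on that side.\<close>

lemma reduced_pair_atoms:
  assumes "u \<in> carrier G" "v \<in> carrier G"
  shows "reduced_pair j u v \<longleftrightarrow> (\<forall>p\<in>atoms G. dv (odd j) p v \<longrightarrow> \<not> compat j p u)"
proof
  assume "reduced_pair j u v"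
  then show "\<forall>p\<in>atoms G. dv (odd j) p v \<longrightarrow> \<not> compat j p u"
    using atom_closed atom_not_one by (auto simp: reduced_pair_def)
next
  assume *: "\<forall>p\<in>atoms G. dv (odd j) p v \<longrightarrow> \<not> compat j p u"
  show "reduced_pair j u v"
    unfolding reduced_pair_def
  proof (intro ballI impI notI)
    fix x assume x: "x \<in> carrier G" "x \<noteq> \<one> \<and> dv (odd j) x v" "compat j x u"
    then obtain p where p: "p \<in> atoms G" "dv (odd j) p x" using atom_dv by blast
    have "dv (odd j) p v" using p x atom_closed dv_trans by blast
    moreover have "compat j p u"
    proof (cases "j = 0")
      case True
      then show ?thesis using x(3) p(2) dv_trans[OF atom_closed[OF p(1)]] by (simp add: compat_def)
    next
      case False
      then obtain c where "c \<in> carrier G" "dv (odd j) x c" "dv (odd j) u c"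
        using x(3) by (auto simp: compat_def cm_def)
      then have "cm (odd j) p u"
        unfolding cm_def using dv_trans[OF atom_closed[OF p(1)] p(2)] by blast
      then show ?thesis using False by (simp add: compat_def)
    qed
    ultimately show False using * p by blast
  qed
qed

lemma reduced_pair_profile:
  assumes C: "u \<in> carrier G" "v \<in> carrier G" "u' \<in> carrier G" "v' \<in> carrier G"
    and eq: "profile u = profile u'" "profile v = profile v'" and j: "j = 0 \<longleftrightarrow> k = 0" "odd j \<longleftrightarrow> odd k"
  shows "reduced_pair j u v \<longleftrightarrow> reduced_pair k u' v'"
proof -
  have "dv s p u \<longleftrightarrow> dv s p u'" "dv s p v \<longleftrightarrow> dv s p v'" "cm s p u \<longleftrightarrow> cm s p u'"
    if "p \<in> atoms G" for p s
    using atom_bas[OF that, of s] C residues_eq[OF eq(1)] residues_eq[OF eq(2)]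
    by (simp_all add: dv_iff_residues cm_iff_residues)
  then show ?thesis using C j by (simp add: reduced_pair_atoms compat_def)
qed

section \<open>Multifractions read from words\<close>

text \<open>The last entry counts positively when the length is odd. A letter of the same sign is
  multiplied into it, on the left for a negative entry as inversion reverses products; any other
  letter opens a new entry.\<close>

definition seg_step :: "'a list \<Rightarrow> 'a \<Rightarrow> bool \<Rightarrow> 'a list" where
  "seg_step as x t =
     (if t \<longleftrightarrow> odd (length as) then butlast as @ [mul t (last as) x] else as @ [x])"

lemma seg_step_Nil [simp]: "seg_step as x t \<noteq> []"
  by (simp add: seg_step_def)

lemma seg_step_closed:
  "as \<noteq> [] \<Longrightarrow> set as \<subseteq> carrier G \<Longrightarrow> x \<in> carrier G \<Longrightarrow> set (seg_step as x t) \<subseteq> carrier G"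
  by (cases as rule: rev_cases) (auto simp: seg_step_def)

definition irr :: "'a list \<Rightarrow> bool" where
  "irr as \<longleftrightarrow> (\<forall>j. Suc j < length as \<longrightarrow> reduced_pair j (as ! j) (as ! Suc j))"

lemma irr_snoc2: "irr (as @ [a, b]) \<longleftrightarrow> irr (as @ [a]) \<and> reduced_pair (length as) a b"
  unfolding irr_def
  by (auto simp: nth_append less_Suc_eq all_conj_distrib)

lemma irr_single [simp]: "irr [a]"
  by (simp add: irr_def)

text \<open>The last entry can still grow, so its pair with the previous one is not judged yet: only
  their profiles are kept, and \<open>irr\<close> covers what is final. Length 2 is singled out
  since the last pair is then at level 0; with length 1 there is no previous entry, and
  \<open>\<one>\<close> stands in for it.\<close>

definition state where
  "state as = (length as = 1, length as = 2, odd (length as),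
     profile (if length as = 1 then \<one> else last (butlast as)), profile (last as), irr (butlast as))"

lemma irr_state:
  assumes "as \<noteq> []" "bs \<noteq> []" "set as \<subseteq> carrier G" "set bs \<subseteq> carrier G" and st: "state as = state bs"
  shows "irr as \<longleftrightarrow> irr bs"
proof (cases "length as = 1")
  case True
  then have "length bs = 1" using st by (simp add: state_def)
  then show ?thesis using True by (auto simp: length_Suc_conv)
next
  case False
  then have "length bs \<noteq> 1" using st by (simp add: state_def)
  then obtain bs' c d where bs: "bs = bs' @ [c, d]" using assms(2)
    by (cases bs rule: rev_cases; cases "butlast bs" rule: rev_cases) auto
  obtain as' a b where as: "as = as' @ [a, b]" using assms(1) False
    by (cases as rule: rev_cases; cases "butlast as" rule: rev_cases) auto
  have "butlast (as' @ [a, b]) = as' @ [a]" "butlast (bs' @ [c, d]) = bs' @ [c]" by (simp_all add: butlast_append)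
  then have "irr (as' @ [a]) \<longleftrightarrow> irr (bs' @ [c])" "profile a = profile c" "profile b = profile d"
    "as' = [] \<longleftrightarrow> bs' = []" "odd (length as') \<longleftrightarrow> odd (length bs')"
    using st by (auto simp: state_def as bs)
  then show ?thesis
    using assms(3,4) reduced_pair_profile[of a b c d "length as'" "length bs'"] by (simp add: as bs irr_snoc2)
qed

lemma state_seg_step:
  assumes as: "as \<noteq> []" "set as \<subseteq> carrier G" and bs: "bs \<noteq> []" "set bs \<subseteq> carrier G"
    and x: "x \<in> carrier G" and st: "state as = state bs"
  shows "state (seg_step as x t) = state (seg_step bs x t)"
proof -
  have irr: "irr as \<longleftrightarrow> irr bs" by (rule irr_state) fact+
  obtain as' a where as': "as = as' @ [a]" using as(1) by (cases as rule: rev_cases) auto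
  obtain bs' b where bs': "bs = bs' @ [b]" using bs(1) by (cases bs rule: rev_cases) auto
  have p: "profile a = profile b" using st by (simp add: state_def as' bs')
  have "profile (mul t a x) = profile (mul t b x)"
    using profile_mul[OF _ _ x p] as bs by (simp add: as' bs')
  then show ?thesis
    using st irr p by (auto simp: state_def seg_step_def as' bs' butlast_append)
qed

lemma finite_states:
  assumes "finite (basic_elements G)"
  shows "finite (state ` {as. as \<noteq> [] \<and> set as \<subseteq> carrier G})"
proof -
  define PP where "PP = Pow (bas True \<times> bas True) \<times> Pow (bas False \<times> bas False)"
  have "finite PP" using assms by (auto simp: PP_def bas_def basic_elements_def)
  then have fin: "finite ((UNIV :: bool set) \<times> (UNIV :: bool set) \<times> (UNIV :: bool set) \<times> PP \<times> PP \<times> (UNIV :: bool set))"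
    by simp
  have prof: "profile a \<in> PP" if "a \<in> carrier G" for a
    using residues_subset[OF that] by (auto simp: profile_def PP_def)
  have "state as \<in> UNIV \<times> UNIV \<times> UNIV \<times> PP \<times> PP \<times> UNIV" if as: "as \<noteq> []" "set as \<subseteq> carrier G" for as
  proof -
    have "last as \<in> carrier G" using as by auto
    moreover have "last (butlast as) \<in> carrier G" if "length as \<noteq> 1"
    proof -
      have "butlast as \<noteq> []" using that as(1) by (cases as rule: rev_cases) auto
      then have "last (butlast as) \<in> set as" by (meson in_set_butlastD last_in_set)
      then show ?thesis using as by blast
    qed
    ultimately show ?thesis using prof by (simp add: state_def)
  qed
  then have "state ` {as. as \<noteq> [] \<and> set as \<subseteq> carrier G} \<subseteq> UNIV \<times> UNIV \<times> UNIV \<times> PP \<times> PP \<times> UNIV"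
    by (intro image_subsetI) simp
  then show ?thesis by (rule finite_subset[OF _ fin])
qed

lemma alt_seg_step:
  assumes "as \<noteq> []" "set as \<subseteq> carrier G" "x \<in> carrier G"
  shows "alt True (seg_step as x t) = alt True as \<otimes>\<^bsub>E\<^esub> (if t then \<iota> x else inv\<^bsub>E\<^esub> \<iota> x)"
proof -
  interpret E: group E by (rule group_envelope)
  obtain bs c where as: "as = bs @ [c]" using assms(1) by (cases as rule: rev_cases) auto
  have C: "set bs \<subseteq> carrier G" "c \<in> carrier G" using assms(2) as by auto
  show ?thesis
  proof (cases "t \<longleftrightarrow> odd (length as)")
    case True
    then have "alt True (seg_step as x t) = alt True (bs @ [mul t c x])"
      by (simp add: seg_step_def as)
    also have "\<dots> = alt True as \<otimes>\<^bsub>E\<^esub> (if t then \<iota> x else inv\<^bsub>E\<^esub> \<iota> x)"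
      using C assms(3) True
      by (simp add: as alt_snoc mul_def iota_mult E.inv_mult_group E.m_assoc)
    finally show ?thesis .
  next
    case False
    then show ?thesis using assms alt_snoc[of as x True] by (auto simp: seg_step_def)
  qed
qed

end

section \<open>The word problem\<close>

text \<open>The search works on words over numbers, so a letter is a number \<open>l\<close> with an
  atom \<open>at l\<close> and a sign \<open>sg l\<close>. Different letters may name the same atom
  and sign, since an enumeration of the generators may have repetitions.\<close>

locale atom_letters = ore_gcd_monoid +
  fixes S :: "nat set" and at :: "nat \<Rightarrow> 'a" and sg :: "nat \<Rightarrow> bool"
  assumes finite_S: "finite S" and finite_basic: "finite (basic_elements G)"
    and at_atom: "l \<in> S \<Longrightarrow> at l \<in> atoms G"
    and letter_exists: "p \<in> atoms G \<Longrightarrow> \<exists>l\<in>S. at l = p \<and> (sg l \<longleftrightarrow> t)"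
begin

interpretation E: group E by (rule group_envelope)

lemma at_closed [simp]: "l \<in> S \<Longrightarrow> at l \<in> carrier G"
  by (rule atom_closed[OF at_atom])

definition letter_val where
  "letter_val l = (if sg l then \<iota> (at l) else inv\<^bsub>E\<^esub> \<iota> (at l))"

definition val where
  "val w = foldr (\<lambda>l g. letter_val l \<otimes>\<^bsub>E\<^esub> g) w \<one>\<^bsub>E\<^esub>"

lemma val_simps [simp]:
  "val [] = \<one>\<^bsub>E\<^esub>" "val (l # w) = letter_val l \<otimes>\<^bsub>E\<^esub> val w"
  by (simp_all add: val_def)

lemma letter_val_closed [simp]: "l \<in> S \<Longrightarrow> letter_val l \<in> carrier E"
  by (simp add: letter_val_def)

lemma val_closed [simp]: "w \<in> lists S \<Longrightarrow> val w \<in> carrier E"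
  by (induction w) auto

lemma val_append: "u \<in> lists S \<Longrightarrow> v \<in> lists S \<Longrightarrow> val (u @ v) = val u \<otimes>\<^bsub>E\<^esub> val v"
  by (induction u) (auto simp: E.m_assoc)

section \<open>A finite presentation of the monoid\<close>

definition mval where
  "mval w = foldr (\<lambda>l m. at l \<otimes> m) w \<one>"

lemma mval_simps [simp]: "mval [] = \<one>" "mval (l # w) = at l \<otimes> mval w"
  by (simp_all add: mval_def)

abbreviation "pos \<equiv> {l \<in> S. sg l}"

lemma mval_closed [simp]: "w \<in> lists pos \<Longrightarrow> mval w \<in> carrier G"
  by (induction w) auto

lemma mval_append: "u \<in> lists pos \<Longrightarrow> v \<in> lists pos \<Longrightarrow> mval (u @ v) = mval u \<otimes> mval v"
  by (induction u) (auto simp: m_assoc)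

lemma val_pos: "w \<in> lists pos \<Longrightarrow> val w = \<iota> (mval w)"
  by (induction w) (auto simp: letter_val_def iota_mult)

lemma pos_S: "w \<in> lists pos \<Longrightarrow> w \<in> lists S"
  by (induction w) auto

definition word_of :: "'a \<Rightarrow> nat list" where
  "word_of m = (SOME w. w \<in> lists pos \<and> mval w = m)"

lemma word_of:
  assumes "m \<in> carrier G"
  shows "word_of m \<in> lists pos" "mval (word_of m) = m"
proof -
  from assms have "\<exists>w. w \<in> lists pos \<and> mval w = m"
  proof (induction m rule: atom_induct[where s = True])
    case one
    show ?case by (rule exI[of _ "[]"]) simp
  next
    case (mult p a)
    obtain w where w: "w \<in> lists pos" "mval w = a" using mult.IH by blast
    obtain l where l: "l \<in> S" "at l = p" "sg l" using letter_exists[OF mult.hyps(1), of True] by auto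
    show ?case by (rule exI[of _ "l # w"]) (use w l in \<open>simp add: mul_def\<close>)
  qed
  from someI_ex[OF this] show "word_of m \<in> lists pos" "mval (word_of m) = m" by (simp_all add: word_of_def)
qed

text \<open>With all valid relations up to some length, soundness is immediate. The bound is chosen such
  that the relations given by the least common multiples of pairs of atoms are included.\<close>

definition bound :: nat where
  "bound = Suc (Suc (Max ((\<lambda>x. length (word_of x)) ` bas True)))"

definition rels :: "(nat list \<times> nat list) set" where
  "rels = {(u, v). u \<in> lists S \<and> v \<in> lists S \<and> length u \<le> bound \<and> length v \<le> bound \<and> val u = val v}"

lemma finite_bas: "finite (bas s)"
  using finite_basic by (auto simp: bas_def basic_elements_def)

lemma bound_word_of: "x \<in> bas True \<Longrightarrow> Suc (length (word_of x)) \<le> bound"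
  using Max_ge[OF finite_imageI[OF finite_bas], of "length (word_of x)" "\<lambda>x. length (word_of x)" True]
  by (simp add: bound_def le_SucI)

lemma rels_lists: "rels \<subseteq> lists S \<times> lists S"
  by (auto simp: rels_def)

lemma finite_rels: "finite rels"
proof (rule finite_subset)
  have "{w. set w \<subseteq> S \<and> length w \<le> bound} = {w \<in> lists S. length w \<le> bound}" by auto
  then show "finite ({w \<in> lists S. length w \<le> bound} \<times> {w \<in> lists S. length w \<le> bound})"
    using finite_lists_length_le[OF finite_S, of bound] by simp
qed (auto simp: rels_def)

abbreviation "cong \<equiv> word_cong S rels"

lemma rel_cong: "(u, v) \<in> rels \<Longrightarrow> (u, v) \<in> cong"
  using rels_lists by (intro word_cong.base) auto

text \<open>Cancelling the least common multiple of the first letters leaves a smaller element.\<close>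

lemma pos_cong:
  assumes "u \<in> lists pos" "v \<in> lists pos" "mval u = mval v"
  shows "(u, v) \<in> cong"
proof -
  have nil: "w = []" if "w \<in> lists pos" "mval w = \<one>" for w
    using that
  proof (cases w)
    case (Cons l w')
    then have "at l = \<one>" using mult_eq_one[of "at l" "mval w'"] that by auto
    then show ?thesis using that Cons at_atom[of l] atom_not_one by auto
  qed
  have "(u, v) \<in> cong" if "m \<in> carrier G" "u \<in> lists pos" "v \<in> lists pos" "mval u = m" "mval v = m" for m u v
    using that
  proof (induction m arbitrary: u v rule: wf_induct_rule[OF wf_proper[of True]])
    case (1 m)
    show ?case
    proof (cases "m = \<one>")
      case True
      then show ?thesis using nil[of u] nil[of v] 1(2-) by (simp add: word_cong.refl)
    next
      case False
      then obtain k u' where u: "u = k # u'" using 1(2-) by (cases u) auto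
      obtain l v' where v: "v = l # v'" using 1(2-) False by (cases v) auto
      have kl: "k \<in> S" "sg k" "l \<in> S" "sg l" and w': "u' \<in> lists pos" "v' \<in> lists pos" using 1(2-) u v by auto
      have at: "at k \<in> atoms G" "at l \<in> atoms G" using kl at_atom by auto
      have m: "m = mul True (at k) (mval u')" "m = mul True (at l) (mval v')" using 1(2-) u v by (auto simp: mul_def)
      have d: "dv True (at k) m" "dv True (at l) m"
        using dvI[OF mval_closed[OF w'(1)] m(1)] dvI[OF mval_closed[OF w'(2)] m(2)] by auto
      then have "cm True (at k) (at l)" using \<open>m \<in> carrier G\<close> by (auto simp: cm_def)
      then obtain c where c: "c \<in> carrier G" "is_lcm True (at k) (at l) c"
        using lcm_exists kl at_closed by metis
      obtain y where y: "y \<in> carrier G" "c = mul True (at k) y" using c by (auto simp: is_lcm_def elim: dvE)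
      obtain z where z: "z \<in> carrier G" "c = mul True (at l) z" using c by (auto simp: is_lcm_def elim: dvE)
      \<comment> \<open>The complements \<open>y\<close> and \<open>z\<close> are residues of atoms
        by atoms, hence basic, so the relation between \<open>k # word_of y\<close> and
        \<open>l # word_of z\<close> is short enough to lie in \<open>rels\<close>.\<close>
      have zb: "z \<in> bas True"
        by (rule bas_residue[OF atom_bas[OF at(1)] atom_bas[OF at(2)] z(1)]) (use c z in simp)
      have yb: "y \<in> bas True"
        by (rule bas_residue[OF atom_bas[OF at(2)] atom_bas[OF at(1)] y(1)]) (use c y in \<open>simp add: is_lcm_sym\<close>)
      have "dv True c m" using c d \<open>m \<in> carrier G\<close> by (simp add: is_lcm_def)
      \<comment> \<open>The chain is \<open>u\<close>, then \<open>k y t\<close>, then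
        \<open>l z t\<close>, then \<open>v\<close>: the outer links are the induction hypothesis
        for the tails, the middle one is the lcm relation.\<close>
      then obtain t where t: "t \<in> carrier G" "m = mul True c t" by (rule dvE)
      note Y = word_of[OF y(1)] and Z = word_of[OF z(1)] and T = word_of[OF t(1)]
      have "mul True (at k) (mval u') = mul True (at k) (mul True y t)"
        using m(1) t y kl by (metis at_closed mul_assoc)
      then have u': "mval u' = mval (word_of y @ word_of t)"
        using w' y t kl Y T by (simp add: mval_append) (simp add: mul_def)
      have "mul True (at l) (mval v') = mul True (at l) (mul True z t)"
        using m(2) t z kl by (metis at_closed mul_assoc)
      then have v': "mval v' = mval (word_of z @ word_of t)"
        using w' z t kl Z T by (simp add: mval_append) (simp add: mul_def)
      have "(mval u', m) \<in> proper True" "(mval v', m) \<in> proper True"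
        using m w' kl at atom_not_one \<open>m \<in> carrier G\<close> mval_closed at_closed unfolding proper_def by blast+
      then have IH: "(u', word_of y @ word_of t) \<in> cong" "(v', word_of z @ word_of t) \<in> cong"
        using "1.IH" w' u' v' Y Z T mval_closed by auto
      have "\<iota> (at k) \<otimes>\<^bsub>E\<^esub> \<iota> y = \<iota> (at l) \<otimes>\<^bsub>E\<^esub> \<iota> z"
        using y z kl by (simp add: mul_def flip: iota_mult)
      moreover have "val (word_of y) = \<iota> y" "val (word_of z) = \<iota> z"
        using val_pos[OF Y(1)] val_pos[OF Z(1)] by (simp_all only: Y(2) Z(2))
      ultimately have "val (k # word_of y) = val (l # word_of z)" using kl by (simp add: letter_val_def)
      then have "(k # word_of y, l # word_of z) \<in> rels"
        using kl(1,3) pos_S[OF Y(1)] pos_S[OF Z(1)] bound_word_of[OF yb] bound_word_of[OF zb]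
        unfolding rels_def by simp
      from word_cong_append[OF rel_cong[OF this] word_cong.refl[OF pos_S[OF T(1)]]]
      have R: "(k # word_of y @ word_of t, l # word_of z @ word_of t) \<in> cong" by simp
      have "[k] \<in> lists S" "[l] \<in> lists S" using kl by auto
      from word_cong_append[OF word_cong.refl[OF this(1)] IH(1)] word_cong_append[OF word_cong.refl[OF this(2)] IH(2)]
      have "(u, k # word_of y @ word_of t) \<in> cong" "(v, l # word_of z @ word_of t) \<in> cong" by (simp_all add: u v)
      then show ?thesis using R by (meson word_cong.sym word_cong.trans)
    qed
  qed
  then show ?thesis using assms mval_closed by blast
qed

section \<open>The group presented by the short relations\<close>

definition inv_letter :: "nat \<Rightarrow> nat" where
  "inv_letter l = (SOME l'. l' \<in> S \<and> at l' = at l \<and> (sg l' \<longleftrightarrow> \<not> sg l))"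

lemma inv_letter:
  assumes "l \<in> S"
  shows "inv_letter l \<in> S" "at (inv_letter l) = at l" "sg (inv_letter l) \<longleftrightarrow> \<not> sg l"
proof -
  have "\<exists>l'. l' \<in> S \<and> at l' = at l \<and> (sg l' \<longleftrightarrow> \<not> sg l)" using letter_exists[OF at_atom[OF assms]] by blast
  from someI_ex[OF this]
  show "inv_letter l \<in> S" "at (inv_letter l) = at l" "sg (inv_letter l) \<longleftrightarrow> \<not> sg l"
    unfolding inv_letter_def by auto
qed

text \<open>The two successors in \<open>bound\<close> make it at least 2, so these relations of
  length two belong to \<open>rels\<close>.\<close>

lemma inv_letter_cong:
  assumes "l \<in> S"
  shows "([inv_letter l, l], []) \<in> cong" "([l, inv_letter l], []) \<in> cong"
proof -
  have "([inv_letter l, l], []) \<in> rels" "([l, inv_letter l], []) \<in> rels"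
    using assms inv_letter[OF assms] by (cases "sg l"; simp add: rels_def letter_val_def bound_def)+
  then show "([inv_letter l, l], []) \<in> cong" "([l, inv_letter l], []) \<in> cong"
    by (simp_all only: rel_cong)
qed

abbreviation "P \<equiv> presented_monoid S rels"
abbreviation "cls w \<equiv> cong `` {w}"

lemma cls_eq: "u \<in> lists S \<Longrightarrow> v \<in> lists S \<Longrightarrow> cls u = cls v \<longleftrightarrow> (u, v) \<in> cong"
  by (rule eq_equiv_class_iff[OF equiv_word_cong])

lemma cls_closed: "w \<in> lists S \<Longrightarrow> cls w \<in> carrier P"
  by (rule presented_monoid_carrierI)

lemma cls_mult: "u \<in> lists S \<Longrightarrow> v \<in> lists S \<Longrightarrow> cls u \<otimes>\<^bsub>P\<^esub> cls v = cls (u @ v)"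
  by (rule presented_monoid_mult)

lemma group_P: "group P"
proof -
  interpret monoid P by (rule monoid_presented_monoid)
  show ?thesis
  proof (rule group_l_invI)
    fix X assume "X \<in> carrier P"
    then obtain u where u: "u \<in> lists S" "X = cls u" by (rule presented_monoid_carrierE)
    from u(1) have "\<exists>v\<in>lists S. (v @ u, []) \<in> cong"
    proof induction
      case Nil
      show ?case by (rule bexI[of _ "[]"]) (simp_all add: word_cong.refl)
    next
      case (Cons l u)
      obtain v where v: "v \<in> lists S" "(v @ u, []) \<in> cong" using Cons.IH by blast
      have "(v @ [inv_letter l, l] @ u, v @ [] @ u) \<in> cong"
        by (rule word_cong.ctxt[OF inv_letter_cong(1)]) (use Cons.hyps v in auto)
      then have "((v @ [inv_letter l]) @ l # u, []) \<in> cong" using v(2) word_cong.trans by fastforce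
      moreover have "v @ [inv_letter l] \<in> lists S" using v Cons.hyps inv_letter by auto
      ultimately show ?case by blast
    qed
    then obtain v where v: "v \<in> lists S" "(v @ u, []) \<in> cong" by blast
    then have "cls v \<otimes>\<^bsub>P\<^esub> X = \<one>\<^bsub>P\<^esub>" using u by (simp add: cls_mult cls_eq presented_monoid_one)
    then show "\<exists>Y\<in>carrier P. Y \<otimes>\<^bsub>P\<^esub> X = \<one>\<^bsub>P\<^esub>" using cls_closed[OF v(1)] by blast
  qed
qed

text \<open>Choosing a positive word for each element is a morphism from the monoid to the presented
  group, by \<open>pos_cong\<close>. The universal property extends it to the enveloping group,
  where it sends the value of a word back to the class of that word.\<close>

lemma val_eq_imp_cong:
  assumes "u \<in> lists S" "v \<in> lists S" "val u = val v"
  shows "(u, v) \<in> cong"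
proof -
  interpret P: group P by (rule group_P)
  have "(\<lambda>m. cls (word_of m)) \<in> hom G P"
  proof (rule homI)
    fix m k assume mk: "m \<in> carrier G" "k \<in> carrier G"
    note W = word_of[OF mk(1)] word_of[OF mk(2)] word_of[OF m_closed[OF mk]]
    have "(word_of (m \<otimes> k), word_of m @ word_of k) \<in> cong"
      by (rule pos_cong) (use W in \<open>simp_all add: mval_append\<close>)
    then show "cls (word_of (m \<otimes> k)) = cls (word_of m) \<otimes>\<^bsub>P\<^esub> cls (word_of k)"
      using W pos_S by (simp add: cls_mult cls_eq)
  qed (use word_of pos_S cls_closed in blast)
  then obtain h where h: "h \<in> hom E P" "\<forall>a\<in>carrier G. h (\<iota> a) = cls (word_of a)"
    using envelope_universal(1)[OF monoid_axioms group_P] by blast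
  interpret h: group_hom E P h by unfold_locales (rule h)
  have pos: "h (\<iota> (at l)) = cls [l]" if l: "l \<in> S" "sg l" for l
  proof -
    note W = word_of[OF at_closed[OF l(1)]]
    have "(word_of (at l), [l]) \<in> cong" by (rule pos_cong) (use W l in simp_all)
    then show ?thesis using h(2) l W pos_S by (simp add: cls_eq)
  qed
  have letter: "h (letter_val l) = cls [l]" if l: "l \<in> S" for l
  proof (cases "sg l")
    case True
    then show ?thesis using pos l by (simp add: letter_val_def)
  next
    case False
    note i = inv_letter[OF l]
    have "cls [l] \<otimes>\<^bsub>P\<^esub> cls [inv_letter l] = \<one>\<^bsub>P\<^esub>"
      using l i inv_letter_cong[OF l] by (simp add: cls_mult cls_eq presented_monoid_one)
    then have "cls [l] = inv\<^bsub>P\<^esub> cls [inv_letter l]"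
      using l i cls_closed[of "[l]"] cls_closed[of "[inv_letter l]"] by (intro P.inv_equality[symmetric]) auto
    then show ?thesis using False pos[OF i(1)] i l by (simp add: letter_val_def)
  qed
  have "h (val w) = cls w" if "w \<in> lists S" for w
    using that
  proof induction
    case Nil
    then show ?case by (simp add: presented_monoid_one)
  next
    case (Cons l w)
    then show ?case using letter cls_mult[of "[l]" w] by simp
  qed
  then have "cls u = cls v" using assms by metis
  then show ?thesis using cls_eq assms by blast
qed

section \<open>Congruence as rewriting\<close>

lemma rewriting_context:
  "(u, v) \<in> rewriting R \<Longrightarrow> (x @ u @ y, x @ v @ y) \<in> rewriting R"
proof -
  assume "(u, v) \<in> rewriting R"
  then obtain p l r q where "u = p @ l @ q" "v = p @ r @ q" "(l, r) \<in> R" by (auto simp: rewriting_def)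
  then show ?thesis using rewriting_step[of l r R "x @ p" "q @ y"] by simp
qed

lemma cong_imp_rewriting:
  assumes "(u, v) \<in> cong"
  shows "(u, v) \<in> (rewriting rels)\<^sup>*"
  using assms
proof induction
  case (base u v)
  then show ?case using rewriting_step[of u v rels "[]" "[]"] by auto
next
  case (sym u v)
  have "sym (rewriting rels)"
  proof (rule symI)
    fix u v assume "(u, v) \<in> rewriting rels"
    then obtain p l r q where "u = p @ l @ q" "v = p @ r @ q" "(l, r) \<in> rels" by (auto simp: rewriting_def)
    moreover have "(r, l) \<in> rels" using calculation(3) by (simp add: rels_def)
    ultimately show "(v, u) \<in> rewriting rels" using rewriting_step by simp
  qed
  then show ?case using sym.IH sym_rtrancl by (meson symD)
next
  case (ctxt u v x y)
  from ctxt.IH show ?case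
  proof induction
    case (step v w)
    then show ?case using rewriting_context by (meson rtrancl.rtrancl_into_rtrancl)
  qed simp
qed auto

lemma rewriting_val:
  assumes "(u, v) \<in> (rewriting rels)\<^sup>*" "u \<in> lists S"
  shows "v \<in> lists S \<and> val u = val v"
  using assms(1)
proof induction
  case (step v w)
  then obtain p l r q where *: "v = p @ l @ q" "w = p @ r @ q" "(l, r) \<in> rels" by (auto simp: rewriting_def)
  then have "l \<in> lists S" "r \<in> lists S" "val l = val r" by (auto simp: rels_def)
  moreover have "p \<in> lists S" "q \<in> lists S" using step.IH * by auto
  ultimately show ?case using step.IH * by (simp add: val_append)
qed (use assms(2) in simp)

text \<open>Starting from the single entry \<open>\<one>\<close> keeps the list nonempty and lets a
  word beginning with a negative letter be read as \<open>1/a\<close> followed by further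
  entries.\<close>

definition segs :: "nat list \<Rightarrow> 'a list" where
  "segs w = foldl (\<lambda>as l. seg_step as (at l) (sg l)) [\<one>] w"

lemma segs_snoc [simp]: "segs (w @ [l]) = seg_step (segs w) (at l) (sg l)"
  by (simp add: segs_def)

lemma segs_Nil [simp]: "segs [] = [\<one>]"
  by (simp add: segs_def)

lemma segs_closed:
  assumes "w \<in> lists S"
  shows "segs w \<noteq> [] \<and> set (segs w) \<subseteq> carrier G"
  using assms by (induction w rule: rev_induct) (auto dest!: seg_step_closed[THEN subsetD, rotated 3])

lemma alt_segs: "w \<in> lists S \<Longrightarrow> alt True (segs w) = val w"
proof (induction w rule: rev_induct)
  case (snoc l w)
  then have "w \<in> lists S" "l \<in> S" by auto
  then show ?case using snoc.IH segs_closed[of w]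
    by (simp add: alt_seg_step val_append letter_val_def)
qed simp

lemma last_segs:
  assumes "w \<in> lists S" "w \<noteq> []"
  shows "last (segs w) \<noteq> \<one>"
proof -
  obtain v l where w: "w = v @ [l]" using assms(2) by (cases w rule: rev_cases) auto
  then have v: "v \<in> lists S" "l \<in> S" using assms by auto
  have "last (segs v) \<in> carrier G" using segs_closed[OF v(1)] by auto
  then show ?thesis
    using mul_eq_one[of "last (segs v)" "at l" "sg l"] v atom_not_one[OF at_atom[OF v(2)]]
    by (auto simp: w seg_step_def)
qed

lemma fold_segment:
  assumes "as \<noteq> []" "\<forall>l\<in>set w. sg l = odd (length as)"
  shows "foldl (\<lambda>as l. seg_step as (at l) (sg l)) as w =
    butlast as @ [foldl (\<lambda>a l. mul (odd (length as)) a (at l)) (last as) w]"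
  using assms
proof (induction w arbitrary: as)
  case (Cons l w)
  have s: "seg_step as (at l) (sg l) = butlast as @ [mul (odd (length as)) (last as) (at l)]" (is "_ = ?bs")
    using Cons.prems by (simp add: seg_step_def)
  have len: "length ?bs = length as" using Cons.prems(1) by (cases as rule: rev_cases) auto
  have "foldl (\<lambda>as l. seg_step as (at l) (sg l)) as (l # w) = foldl (\<lambda>as l. seg_step as (at l) (sg l)) ?bs w"
    by (simp only: foldl_Cons s)
  also have "\<dots> = butlast ?bs @ [foldl (\<lambda>a l. mul (odd (length as)) a (at l)) (last ?bs) w]"
    using Cons.IH[of ?bs] Cons.prems len by simp
  finally show ?case by simp
qed simp

lemma segment_word:
  assumes "m \<in> carrier G"
  shows "\<exists>w\<in>lists S. (\<forall>l\<in>set w. sg l = t) \<and> foldl (\<lambda>a l. mul t a (at l)) \<one> w = m"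
  using assms
proof (induction m rule: atom_induct[where s = "\<not> t"])
  case one
  show ?case by (rule bexI[of _ "[]"]) auto
next
  case (mult p a)
  obtain w where w: "w \<in> lists S" "\<forall>l\<in>set w. sg l = t" "foldl (\<lambda>a l. mul t a (at l)) \<one> w = a"
    using mult.IH by blast
  obtain l where l: "l \<in> S" "at l = p" "sg l \<longleftrightarrow> t" using letter_exists[OF mult.hyps(1), of t] by auto
  show ?case by (rule bexI[of _ "w @ [l]"]) (use w l in \<open>auto simp: mul_Not\<close>)
qed

text \<open>A trivial entry has common multiples with everything, so a nontrivial entry above it
  could be reduced; nontriviality therefore descends from the last entry. It stops before the first
  one, where divisibility takes the place of common multiples.\<close>

lemma reduced_entries:
  assumes "irr bs" "set bs \<subseteq> carrier G" "last bs \<noteq> \<one>" "0 < i" "i < length bs"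
  shows "bs ! i \<noteq> \<one>"
proof -
  have C: "bs ! k \<in> carrier G" if "k < length bs" for k using assms(2) that by (auto intro: subsetD nth_mem)
  have "i \<le> length bs - 1" using assms(5) by simp
  then show ?thesis
  proof (induction rule: inc_induct)
    case base
    have "bs \<noteq> []" using assms(5) by auto
    then show ?case using assms(3) by (simp add: last_conv_nth)
  next
    case (step k)
    have k: "Suc k < length bs" "k < length bs" "k \<noteq> 0" using step assms(4) by auto
    then have "reduced_pair k (bs ! k) (bs ! Suc k)" using assms(1) by (simp add: irr_def)
    then have "\<not> compat k (bs ! Suc k) (bs ! k)"
      using step.IH C[OF k(1)] by (auto simp: reduced_pair_def)
    then show ?case using k C[OF k(1)] by (auto simp: compat_def cm_def)
  qed
qed

text \<open>The entries are spelled one after the other in letters of alternating sign. Entries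
  after the first are nontrivial, so their words are nonempty and each really opens a new entry; a
  trivial first entry is spelled by the empty word.\<close>

lemma segs_surj:
  assumes "irr bs" "set bs \<subseteq> carrier G" "bs \<noteq> []" "last bs \<noteq> \<one>"
  shows "\<exists>w\<in>lists S. segs w = bs"
proof -
  have C: "bs ! k \<in> carrier G" if "k < length bs" for k using assms(2) that by (auto intro: subsetD nth_mem)
  have "Suc k \<le> length bs \<Longrightarrow> \<exists>w\<in>lists S. segs w = take (Suc k) bs" for k
  proof (induction k)
    case 0
    have "bs ! 0 \<in> carrier G" using C[of 0] assms(3) by simp
    from segment_word[OF this, of True]
    obtain w where w: "w \<in> lists S" "\<forall>l\<in>set w. sg l = True" "foldl (\<lambda>a l. mul True a (at l)) \<one> w = bs ! 0"
      by blast
    then have "segs w = [bs ! 0]" unfolding segs_def by (subst fold_segment) auto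
    then show ?case using w(1) assms(3) by (intro bexI[of _ w]) (simp_all add: take_Suc_conv_app_nth)
  next
    case (Suc k)
    obtain u where u: "u \<in> lists S" "segs u = take (Suc k) bs" using Suc by auto
    define t where "t = odd (Suc (Suc k))"
    have "bs ! Suc k \<in> carrier G" using C[of "Suc k"] Suc.prems by simp
    from segment_word[OF this, of t]
    obtain w where w: "w \<in> lists S" "\<forall>l\<in>set w. sg l = t" "foldl (\<lambda>a l. mul t a (at l)) \<one> w = bs ! Suc k"
      by blast
    have ne: "bs ! Suc k \<noteq> \<one>"
      by (rule reduced_entries[OF assms(1,2,4)]) (use Suc.prems in auto)
    then obtain l w' where lw: "w = l # w'" using w by (cases w) auto
    have len: "length (segs u) = Suc k" using u Suc.prems by simp
    have "l \<in> S" "sg l = t" using w lw by auto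
    then have "seg_step (segs u) (at l) (sg l) = segs u @ [at l]"
      by (simp add: seg_step_def len t_def)
    then have "segs (u @ w) = foldl (\<lambda>as l. seg_step as (at l) (sg l)) (segs u @ [at l]) w'"
      by (simp add: segs_def lw)
    also have "\<dots> = segs u @ [foldl (\<lambda>a l. mul t a (at l)) (at l) w']"
      using w lw by (subst fold_segment) (auto simp: len t_def)
    also have "foldl (\<lambda>a l. mul t a (at l)) (at l) w' = bs ! Suc k"
      using w(3) lw \<open>l \<in> S\<close> by simp
    also have "segs u @ [bs ! Suc k] = take (Suc (Suc k)) bs"
      using u Suc.prems by (simp add: take_Suc_conv_app_nth)
    finally show ?case using u w by (intro bexI[of _ "u @ w"]) auto
  qed
  from this[of "length bs - 1"] show ?thesis using assms(3) by simp
qed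

theorem decidable_val_one: "decidable_set (list_encode ` {w \<in> lists S. val w = \<one>\<^bsub>E\<^esub>})"
proof (rule decidable_by_normal_forms[where S = S and R = rels and \<alpha> = "\<lambda>w. state (segs w)" and P = "\<lambda>w. irr (segs w)"])
  show "finite S" "finite rels" "rels \<subseteq> lists S \<times> lists S"
    by (rule finite_S finite_rels rels_lists)+
  show "finite ((\<lambda>w. state (segs w)) ` lists S)"
    by (rule finite_subset[OF _ finite_states[OF finite_basic]]) (use segs_closed in auto)
  show "state (segs (u @ [l])) = state (segs (v @ [l]))"
    if "u \<in> lists S" "v \<in> lists S" "l \<in> S" "state (segs u) = state (segs v)" for u v l
    using state_seg_step segs_closed[OF that(1)] segs_closed[OF that(2)] that by simp
  show "irr (segs u) \<longleftrightarrow> irr (segs v)"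
    if "u \<in> lists S" "v \<in> lists S" "state (segs u) = state (segs v)" for u v
    using irr_state segs_closed[OF that(1)] segs_closed[OF that(2)] that by blast
  show "\<exists>v. (w, v) \<in> (rewriting rels)\<^sup>* \<and> irr (segs v)" if w: "w \<in> lists S" for w
  proof -
    obtain bs where bs: "reduced_multifraction G bs" "val w = alt True bs"
      using reduced_multifraction_exists[OF val_closed[OF w]] .
    have C: "set bs \<subseteq> carrier G" and ne: "bs \<noteq> [] \<longrightarrow> last bs \<noteq> \<one>" and irr: "irr bs"
      using bs(1) irreducible_seq_of_iff[of bs] by (auto simp: reduced_multifraction_iff irr_def)
    have "\<exists>v\<in>lists S. irr (segs v) \<and> val v = val w"
    proof (cases "bs = []")
      case True
      then show ?thesis using bs by (intro bexI[of _ "[]"]) auto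
    next
      case False
      then obtain v where "v \<in> lists S" "segs v = bs" using segs_surj irr C ne by blast
      then show ?thesis using irr bs(2) alt_segs by metis
    qed
    then show ?thesis using val_eq_imp_cong[OF w] cong_imp_rewriting by metis
  qed
  show "w \<in> {w \<in> lists S. val w = \<one>\<^bsub>E\<^esub>} \<longleftrightarrow> v = []"
    if w: "w \<in> lists S" and wv: "(w, v) \<in> (rewriting rels)\<^sup>*" and irr: "irr (segs v)" for w v
  proof -
    have v: "v \<in> lists S" "val w = val v" using rewriting_val[OF wv w] by auto
    \<comment> \<open>For nonempty \<open>v\<close> the list \<open>segs v\<close> would be a
      reduced multifraction of value \<open>\<one>\<close>, hence empty by uniqueness, which
      \<open>segs\<close> never is.\<close>
    have "v = []" if one: "val v = \<one>\<^bsub>E\<^esub>"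
    proof (rule ccontr)
      assume "v \<noteq> []"
      then have "reduced_multifraction G (segs v)"
        using segs_closed[OF v(1)] last_segs[OF v(1)] irr irreducible_seq_of_iff[of "segs v"]
        by (simp add: reduced_multifraction_iff irr_def)
      moreover have "reduced_multifraction G []" by (simp add: reduced_multifraction_def)
      moreover have "alt True (segs v) = alt True []" using alt_segs[OF v(1)] one by simp
      ultimately have "segs v = []" by (rule reduced_multifraction_unique)
      then show False using segs_closed[OF v(1)] by simp
    qed
    then show ?thesis using v w by auto
  qed
qed auto

end

context ore_gcd_monoid
begin

lemma generate_atoms: "generate E (\<iota> ` atoms G) = carrier E"
proof -
  interpret E: group E by (rule group_envelope)
  have sub: "\<iota> ` atoms G \<subseteq> carrier E" using atom_closed by auto
  have el: "\<iota> m \<in> generate E (\<iota> ` atoms G)" if "m \<in> carrier G" for m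
    using that
  proof (induction m rule: atom_induct[where s = True])
    case one
    show ?case by (simp add: generate.one)
  next
    case (mult p a)
    then have "\<iota> p \<in> generate E (\<iota> ` atoms G)" by (intro generate.incl) simp
    then show ?case using mult atom_closed by (simp add: mul_def iota_mult generate.eng)
  qed
  have "alt s as \<in> generate E (\<iota> ` atoms G)" if "set as \<subseteq> carrier G" for s as
    using that
  proof (induction as arbitrary: s)
    case Nil
    show ?case by (simp add: generate.one)
  next
    case (Cons a as)
    then show ?case using el[of a] E.generate_m_inv_closed[OF sub] by (auto intro!: generate.eng)
  qed
  then have "carrier E \<subseteq> generate E (\<iota> ` atoms G)"
    using envelope_alt_prod by (metis subsetI)
  then show ?thesis using E.generate_incl[OF sub] by blast
qed

theorem decidable_word_problem_envelope:
  assumes fin: "finite (basic_elements G)"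
  shows "decidable_word_problem E (\<iota> ` atoms G)"
proof -
  interpret E: group E by (rule group_envelope)
  have "atoms G \<subseteq> basic_elements G" by (auto simp: basic_elements_def intro: right_basic.atom)
  then have finA: "finite (atoms G)" using fin finite_subset by blast
  have "decidable_set {list_encode (map sum_encode w) |w. w \<in> group_words xs \<and> word_value E xs w = \<one>\<^bsub>E\<^esub>}"
    if xs: "set xs = \<iota> ` atoms G" for xs
  proof -
    define gen where "gen i = inv_into (atoms G) \<iota> (xs ! i)" for i
    define at where "at l = gen (case sum_decode l of Inl i \<Rightarrow> i | Inr i \<Rightarrow> i)" for l
    define sg where "sg l = isl (sum_decode l)" for l
    \<comment> \<open>Letters are their own codes under \<open>sum_encode\<close>, so the code of a
      word over \<open>S\<close> is exactly the one used in
      \<open>decidable_word_problem\<close>.\<close>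
    define S where "S = sum_encode ` ({..<length xs} <+> {..<length xs})"
    have gen: "gen i \<in> atoms G" "\<iota> (gen i) = xs ! i" if "i < length xs" for i
    proof -
      have "xs ! i \<in> \<iota> ` atoms G" using xs that nth_mem by blast
      then show "gen i \<in> atoms G" "\<iota> (gen i) = xs ! i"
        unfolding gen_def by (rule inv_into_into, rule f_inv_into_f)
    qed
    interpret W: atom_letters G S at sg
    proof
      show "finite S" by (simp add: S_def)
      show "finite (basic_elements G)" by (rule fin)
      show "at l \<in> atoms G" if "l \<in> S" for l using that gen by (auto simp: S_def at_def)
      show "\<exists>l\<in>S. at l = p \<and> (sg l \<longleftrightarrow> t)" if p: "p \<in> atoms G" for p t
      proof -
        obtain i where i: "i < length xs" "xs ! i = \<iota> p" using p xs by (metis imageI in_set_conv_nth)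
        then have "gen i = p"
          using inj_onD[OF inj_iota, of "gen i" p] gen[OF i(1)] atom_closed p by auto
        then show ?thesis using i
          by (intro bexI[of _ "sum_encode (if t then Inl i else Inr i)"]) (auto simp: S_def at_def sg_def)
      qed
    qed
    have "word_value E xs w = W.val (map sum_encode w)" if "w \<in> group_words xs" for w
    proof -
      have "set w \<subseteq> {..<length xs} <+> {..<length xs}" using that by (auto simp: group_words_def)
      then show ?thesis
      proof (induction w)
        case Nil
        show ?case by (simp add: word_value_def)
      next
        case (Cons c w)
        have "(case c of Inl i \<Rightarrow> xs ! i | Inr i \<Rightarrow> inv\<^bsub>E\<^esub> (xs ! i)) = W.letter_val (sum_encode c)"
          using Cons.prems gen by (auto simp: W.letter_val_def at_def sg_def)
        then show ?case using Cons by (simp add: word_value_def)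
      qed
    qed
    then have "{list_encode (map sum_encode w) |w. w \<in> group_words xs \<and> word_value E xs w = \<one>\<^bsub>E\<^esub>}
        = list_encode ` (map sum_encode ` {w \<in> group_words xs. W.val (map sum_encode w) = \<one>\<^bsub>E\<^esub>})"
      by auto
    also have "map sum_encode ` {w \<in> group_words xs. W.val (map sum_encode w) = \<one>\<^bsub>E\<^esub>} = {w \<in> lists S. W.val w = \<one>\<^bsub>E\<^esub>}"
      unfolding group_words_def S_def lists_image by auto
    finally show ?thesis using W.decidable_val_one by simp
  qed
  moreover have "\<iota> ` atoms G \<subseteq> carrier E" using atom_closed by auto
  ultimately show ?thesis using finA generate_atoms by (simp add: decidable_word_problem_def)
qed

end

theorem theoremA:
  fixes M :: "('a, 'm) monoid_scheme"
  assumes "gcd_monoid M" and "noetherian M" and "three_Ore M"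
  shows "(inj_on (envelope_map M) (carrier M) \<and>
      (\<forall>g\<in>carrier (envelope M).
         \<exists>!as. reduced_multifraction M as \<and>
               g = alt_prod (envelope M) (envelope_map M) True as)) \<and>
    ((\<exists>(S :: 'b set) R. R \<subseteq> lists S \<times> lists S \<and> length_preserving R \<and>
         presented_monoid S R \<cong> M) \<and>
       finite (basic_elements M) \<longrightarrow>
     decidable_word_problem (envelope M) (envelope_map M ` atoms M))"
proof -
  interpret ore_gcd_monoid M
    using assms by (intro ore_gcd_monoid.intro ore_gcd_monoid_axioms.intro)
  show ?thesis
    using inj_iota reduced_multifraction_exists reduced_multifraction_unique decidable_word_problem_envelope
    by (intro conjI ballI ex_ex1I impI) blast+
qed

end
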